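(* Let $A \in \mathbb{R}^{n\times n}$, let $\mathbf{u}, \mathbf{v} \in \mathbb{R}^n$, let $f$ be a (scalar) function whose associated matrix function is Fréchet differentiable at $A$, and for $i,j\in\{1,\dots,n\}$ let $E_{ij} = \mathbf{e}_i\mathbf{e}_j^T$. Then $$\mathbf{u}^T L_f(A,E_{ij})\,\mathbf{v} = [L_f(A^T,\mathbf{u}\mathbf{v}^T)]_{ij}.$$
   Context: $\mathbf{e}_i\in\mathbb{R}^n$ denotes the $i$th canonical unit vector and $[M]_{ij}$ the $(i,j)$ entry of a matrix $M$. $f(A)$ denotes the usual (primary) matrix function associated with a scalar function $f$; it can be defined via the Jordan canonical form, via Hermite interpolation on the spectrum or, for $f$ analytic on a region containing the spectrum of $A$, via $f(A) = \frac{1}{2\pi i}\int_\Gamma f(\zeta)(\zeta I-A)^{-1}\,d\zeta$, where $\Gamma$ winds around the spectrum exactly once. The Fréchet derivative of $f$ at $A$ is the (unique, if it exists) linear operator $L_f(A,\cdot)$ with $f(A+E)-f(A) = L_f(A,E) + o(\|E\|)$ for all $E\in\mathbb{R}^{n\times n}$.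
   Formalization: The formal statement additionally assumes that f is complex differentiable at the non-real eigenvalues of A; with only real perturbations E the claim fails without this, e.g. A a rotation by a right angle and f(z) = i·conj(z) for Im z > 0, −i·conj(z) for Im z < 0. *)

theory Defs
  imports "HOL-Analysis.Analysis" "HOL-Computational_Algebra.Polynomial"
begin

definition cvec :: "real^'n \<Rightarrow> complex^'n" where
  "cvec v = (\<chi> i. complex_of_real (v $ i))"

definition cmat :: "real^'n^'n \<Rightarrow> complex^'n^'n" where
  "cmat A = map_matrix complex_of_real A"

definition outer :: "real^'n \<Rightarrow> real^'n \<Rightarrow> real^'n^'n" where
  "outer u v = (\<chi> i j. u $ i * v $ j)"

definition spectrum :: "complex^'n^'n \<Rightarrow> complex set" where
  "spectrum A = {\<mu>. \<exists>x. x \<noteq> 0 \<and> A *v x = \<mu> *s x}"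

(* The multiplication of the type class times on vec is componentwise, hence the explicit
   iteration of the matrix product. *)
definition mat_power :: "complex^'n^'n \<Rightarrow> nat \<Rightarrow> complex^'n^'n" where
  "mat_power A k = ((\<lambda>X. A ** X) ^^ k) (mat 1)"

definition mat_poly :: "complex poly \<Rightarrow> complex^'n^'n \<Rightarrow> complex^'n^'n" where
  "mat_poly p A = (\<Sum>k\<le>degree p. map_matrix (\<lambda>x. coeff p k * x) (mat_power A k))"

definition min_poly :: "complex^'n^'n \<Rightarrow> complex poly" where
  "min_poly A = (THE p. lead_coeff p = 1 \<and> mat_poly p A = 0 \<and>
                        (\<forall>q. q \<noteq> 0 \<and> mat_poly q A = 0 \<longrightarrow> degree p \<le> degree q))"

(* The index of an eigenvalue: the size of its largest Jordan block, that is, its multiplicity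
   as a zero of the minimal polynomial. *)
definition eig_index :: "complex^'n^'n \<Rightarrow> complex \<Rightarrow> nat" where
  "eig_index A \<mu> = order \<mu> (min_poly A)"

(* The complex derivatives of orders 1, ..., k exist at z. Since deriv is total, the existence
   of the derivatives of lower order in a neighbourhood of z has to be demanded explicitly. *)
primrec derivs_exist :: "(complex \<Rightarrow> complex) \<Rightarrow> nat \<Rightarrow> complex \<Rightarrow> bool" where
  "derivs_exist f 0 z \<longleftrightarrow> True"
| "derivs_exist f (Suc k) z \<longleftrightarrow>
     eventually (\<lambda>w. derivs_exist f k w) (nhds z) \<and> ((deriv ^^ k) f) field_differentiable (at z)"

definition defined_on_spectrum :: "(complex \<Rightarrow> complex) \<Rightarrow> complex^'n^'n \<Rightarrow> bool" where
  "defined_on_spectrum f A \<longleftrightarrow> (\<forall>\<mu>\<in>spectrum A. derivs_exist f (eig_index A \<mu> - 1) \<mu>)"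

definition hermite_poly :: "(complex \<Rightarrow> complex) \<Rightarrow> complex^'n^'n \<Rightarrow> complex poly" where
  "hermite_poly f A = (THE p. degree p < degree (min_poly A) \<and>
     (\<forall>\<mu>\<in>spectrum A. \<forall>j<eig_index A \<mu>. poly ((pderiv ^^ j) p) \<mu> = (deriv ^^ j) f \<mu>))"

(* The primary matrix function by Hermite interpolation on the spectrum; it is meaningful
   when f is defined on the spectrum of A. *)
definition mat_fun :: "(complex \<Rightarrow> complex) \<Rightarrow> complex^'n^'n \<Rightarrow> complex^'n^'n" where
  "mat_fun f A = mat_poly (hermite_poly f A) A"

(* Perturbations are real, values may be complex; f(A + E) has to be defined for every
   sufficiently small E. This places no condition of complex differentiability on f at a simple
   non-real eigenvalue of A: e.g. f z = \<i> * cnj z for Im z > 0 and f z = - \<i> * cnj z for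
   Im z < 0 has a smooth matrix function near the 2x2 rotation by a right angle. *)
definition mat_fun_frechet_differentiable :: "(complex \<Rightarrow> complex) \<Rightarrow> real^'n^'n \<Rightarrow> bool" where
  "mat_fun_frechet_differentiable f A \<longleftrightarrow>
     eventually (\<lambda>M. defined_on_spectrum f (cmat M)) (nhds A) \<and>
     (\<lambda>M. mat_fun f (cmat M)) differentiable (at A)"

definition mat_fun_frechet ::
    "(complex \<Rightarrow> complex) \<Rightarrow> real^'n^'n \<Rightarrow> real^'n^'n \<Rightarrow> complex^'n^'n" where
  "mat_fun_frechet f A = frechet_derivative (\<lambda>M. mat_fun f (cmat M)) (at A)"

end

(* Let L be the derivative at A of the matrix function F on real matrices. The identity says that
   the form (X, Y) -> trace (L X * Y) is symmetric, which is clear for a polynomial, so it suffices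
   to find a polynomial q whose matrix function has derivative L at A. Choose q interpolating f at
   the eigenvalues to high order and let K be the difference of the two derivatives. Since F(A) = q(A)
   and F is equivariant under conjugation, K vanishes on commutators with A. By duality it remains to
   find, for each eigenvalue, enough perturbations E supported on its generalized eigenspace with
   K E = 0. What f satisfies there follows from f(M) being defined for all real M near A:
   - if the index is at least 3, or at least 2 for a non-real eigenvalue, f is holomorphic nearby, and
     Newton interpolation bounds (f - q)(A + t E) by O(t^2);
   - if the index is 1, rank one perturbations only see the derivative of f (along the reals, for a
     real eigenvalue);
   - if the index is 2 and the eigenvalue m is real, rank one and rank two perturbations of a single
     Jordan block show that the derivative of f has a derivative along the reals at m and that
     (f(m + s) - f(m - s)) / (2 s) = f'(m) + b s^2 + o(s^2); prescribing the second and third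
     derivative of q accordingly makes K vanish on these perturbations. *)
theory Submission
  imports Defs "HOL-Complex_Analysis.Complex_Analysis"
    "HOL-Computational_Algebra.Fundamental_Theorem_Algebra"
begin

subsection \<open>The action of polynomials in a matrix on vectors\<close>

text \<open>Since f need not be holomorphic near the spectrum, a contour integral for L is not at
  hand; the comparison with a polynomial uses only those values of f that perturbed matrices see.
  Complex differentiability at non-real eigenvalues has to be assumed: for f equal to
  \<open>\<i> * cnj z\<close> above and \<open>- \<i> * cnj z\<close> below the real axis and A = J
  the rotation by a right angle, L E = (trace E * J - trace (J * E) * I) / 2, so the form (X, Y) ->
  trace (L X * Y) is antisymmetric and not zero. Jordan bases are avoided by letting polynomials act
  on single vectors: F(M) w equals p(M) w as soon as p interpolates f at the roots of some
  polynomial annihilating w. A perturbation then has to be understood only on the vectors that it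
  moves. Duality replaces a description of the kernel of K: a real matrix D orthogonal to the kernel
  commutes with the transpose of A, so only pairings of generalized eigenspaces for the same
  eigenvalue are left, and a few test perturbations kill each of them.\<close>

definition pact :: "complex poly \<Rightarrow> complex^'n^'n \<Rightarrow> complex^'n \<Rightarrow> complex^'n" where
  "pact p M w = mat_poly p M *v w"

lemma scaled_matrix_vector: "map_matrix (\<lambda>x. c * x) (M :: complex^'n^'m) *v w = c *s (M *v w)"
  by (simp add: vec_eq_iff matrix_vector_mult_def map_matrix_def sum_distrib_left mult.assoc)

lemma sum_matrix_vector: "(\<Sum>k\<in>S. M k) *v w = (\<Sum>k\<in>S. (M k :: complex^'n^'m) *v w)"
  by (induct S rule: infinite_finite_induct) (simp_all add: matrix_vector_mult_add_rdistrib)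

lemma mat_power_simps [simp]:
  "mat_power M 0 = mat 1" "mat_power M (Suc k) = M ** mat_power M k"
  by (simp_all add: mat_power_def)

lemma pact_altdef:
  assumes "degree p \<le> n"
  shows "pact p M w = (\<Sum>k\<le>n. coeff p k *s (mat_power M k *v w))"
proof -
  have "pact p M w = (\<Sum>k\<le>degree p. coeff p k *s (mat_power M k *v w))"
    by (simp add: pact_def mat_poly_def sum_matrix_vector scaled_matrix_vector)
  also have "\<dots> = (\<Sum>k\<le>n. coeff p k *s (mat_power M k *v w))"
    using assms by (intro sum.mono_neutral_left) (auto simp: coeff_eq_0)
  finally show ?thesis .
qed

lemma matrix_vector_sum: "M *v (\<Sum>k\<in>S. f k) = (\<Sum>k\<in>S. (M :: complex^'n^'m) *v f k)"
  by (induct S rule: infinite_finite_induct) (simp_all add: matrix_vector_right_distrib)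

lemma matrix_vector_smult: "(M :: complex^'n^'m) *v (c *s w) = c *s (M *v w)"
  by (simp add: vec_eq_iff matrix_vector_mult_def sum_distrib_left mult_ac)

lemma pact_0 [simp]: "pact 0 M w = 0"
  using pact_altdef[of 0 0 M w] by simp

lemma pact_pCons: "pact (pCons a p) M w = a *s w + M *v pact p M w"
proof -
  have "pact (pCons a p) M w = (\<Sum>k\<le>Suc (degree p). coeff (pCons a p) k *s (mat_power M k *v w))"
    by (intro pact_altdef) (simp add: degree_pCons_le)
  also have "\<dots> = a *s w + (\<Sum>k\<le>degree p. coeff p k *s (M *v (mat_power M k *v w)))"
    by (subst sum.atMost_Suc_shift) (simp add: matrix_vector_mul_assoc)
  also have "\<dots> = a *s w + M *v pact p M w"
    by (simp add: pact_altdef[of p "degree p"] matrix_vector_sum matrix_vector_smult)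
  finally show ?thesis .
qed

lemma pact_const [simp]: "pact [:a:] M w = a *s w"
  by (simp add: pact_pCons)

lemma pact_1 [simp]: "pact 1 M w = w"
  by (simp add: one_pCons)

lemma pact_linear_factor: "pact [:- l, 1:] M w = M *v w - l *s w"
  by (simp add: pact_pCons vec_eq_iff)

lemma pact_vec_0 [simp]: "pact p M 0 = 0"
  by (simp add: pact_def)

lemma pact_vec_add: "pact p M (v + w) = pact p M v + pact p M w"
  by (simp add: pact_def matrix_vector_right_distrib)

lemma pact_vec_smult: "pact p M (c *s w) = c *s pact p M w"
  by (simp add: pact_def matrix_vector_smult)

lemma pact_add: "pact (p + q) M w = pact p M w + pact q M w"
proof (induct p arbitrary: q rule: pCons_induct)
  case (pCons a p)
  obtain b r where q: "q = pCons b r" by (cases q) auto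
  show ?case using pCons(2)[of r]
    by (simp add: q pact_pCons matrix_vector_right_distrib vec.scale_left_distrib add_ac)
qed simp

lemma pact_smult: "pact (smult c p) M w = c *s pact p M w"
  by (induct p)
    (simp_all add: pact_pCons vec.scale_right_distrib matrix_vector_smult)

lemma pact_minus: "pact (- p) M w = - pact p M w"
  using pact_smult[of "-1" p M w] by (simp add: vec_eq_iff)

lemma pact_diff: "pact (p - q) M w = pact p M w - pact q M w"
  using pact_add[of p "- q" M w] by (simp add: pact_minus)

lemma pact_mult: "pact (p * q) M w = pact p M (pact q M w)"
  by (induct p) (simp_all add: pact_pCons pact_add pact_smult)

lemma pact_eigen: "M *v w = l *s w \<Longrightarrow> pact p M w = poly p l *s w"
  by (induct p) (simp_all add: pact_pCons matrix_vector_smult vec.scale_left_distrib mult.commute)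

lemma pact_intertwine:
  assumes "\<And>v. X *v (M *v v) = M' *v (X *v v)"
  shows "X *v pact p M w = pact p M' (X *v w)"
  by (induct p) (simp_all add: pact_pCons assms matrix_vector_right_distrib matrix_vector_smult)

lemma pact_dvd: "d dvd p \<Longrightarrow> pact d M w = 0 \<Longrightarrow> pact p M w = 0"
  by (metis dvd_def mult.commute pact_mult pact_vec_0)

lemma pact_invariant:
  assumes "\<And>v. v \<in> U \<Longrightarrow> M *v v \<in> U" "\<And>v w. v \<in> U \<Longrightarrow> w \<in> U \<Longrightarrow> v + w \<in> U"
    "\<And>c v. v \<in> U \<Longrightarrow> c *s v \<in> U" "w \<in> U"
  shows "pact p M w \<in> U"
proof (induct p)
  case 0
  show ?case using assms(3)[OF assms(4), of 0] by simp
qed (auto simp: pact_pCons intro: assms)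

lemma pact_cong_invariant:
  assumes "\<And>v. v \<in> U \<Longrightarrow> M *v v \<in> U" "\<And>v w. v \<in> U \<Longrightarrow> w \<in> U \<Longrightarrow> v + w \<in> U"
    "\<And>c v. v \<in> U \<Longrightarrow> c *s v \<in> U" "w \<in> U" "\<And>v. v \<in> U \<Longrightarrow> M' *v v = M *v v"
  shows "pact p M' w = pact p M w"
  by (induct p) (simp_all add: pact_pCons assms(5) pact_invariant[of U M, OF assms(1-4)])

lemma mat_poly_eq_0_iff: "mat_poly p M = 0 \<longleftrightarrow> (\<forall>w. pact p M w = 0)"
  unfolding pact_def by (metis matrix_eq matrix_vector_mult_0)

subsection \<open>Minimal polynomials\<close>

text \<open>Serves two ideals: the polynomials annihilating a matrix and those annihilating a single
  vector. A normalized element of least degree divides all others because remainders stay in the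
  ideal.\<close>

lemma poly_ideal_generator:
  fixes I :: "complex poly set"
  assumes "p0 \<in> I" "p0 \<noteq> 0" and diff: "\<And>p q. p \<in> I \<Longrightarrow> q \<in> I \<Longrightarrow> p - q \<in> I"
    and mult: "\<And>p q. p \<in> I \<Longrightarrow> q * p \<in> I"
  obtains d where "d \<in> I" "lead_coeff d = 1" "\<And>p. p \<in> I \<Longrightarrow> d dvd p"
proof -
  define n where "n = (LEAST n. \<exists>p\<in>I. p \<noteq> 0 \<and> degree p = n)"
  have "\<exists>p\<in>I. p \<noteq> 0 \<and> degree p = n"
    unfolding n_def by (rule LeastI_ex) (use assms in blast)
  then obtain p where p: "p \<in> I" "p \<noteq> 0" "degree p = n" by blast
  have least: "n \<le> degree q" if "q \<in> I" "q \<noteq> 0" for q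
    unfolding n_def by (rule Least_le) (use that in blast)
  define d where "d = smult (inverse (lead_coeff p)) p"
  have dI: "d \<in> I" using mult[OF p(1), of "[:inverse (lead_coeff p):]"] by (simp add: d_def)
  have "lead_coeff p \<noteq> 0" using p(2) by simp
  then have lc: "lead_coeff d = 1" unfolding d_def lead_coeff_smult by (rule left_inverse)
  have deg: "degree d = n" using p(2) unfolding d_def p(3)[symmetric] by simp
  have "d dvd q" if "q \<in> I" for q
  proof -
    have "q mod d = q - q div d * d" by (simp add: minus_div_mult_eq_mod)
    then have "q mod d \<in> I" using diff[OF that mult[OF dI, of "q div d"]] by simp
    moreover have "d \<noteq> 0" using lc by auto
    ultimately have "q mod d = 0"
      using least[of "q mod d"] degree_mod_less[of d q] deg by (metis not_less)
    then show ?thesis by (simp add: mod_eq_0_iff_dvd)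
  qed
  with dI lc show ?thesis using that by blast
qed

text \<open>One power more than the real dimension of the matrix space forces a linear relation. The
  crude degree bound does not depend on the matrix, which later makes Newton interpolation uniform
  along a perturbation.\<close>

lemma ex_annihilating_poly:
  "\<exists>p. p \<noteq> 0 \<and> degree p \<le> DIM(complex^'n^'n) \<and> (\<forall>w. pact p (M :: complex^'n^'n) w = 0)"
proof -
  let ?K = "DIM(complex^'n^'n)"
  have ex: "\<exists>u. (\<exists>k\<le>?K. u k \<noteq> 0) \<and> (\<Sum>k\<le>?K. u k *\<^sub>R mat_power M k) = 0"
  \<comment> \<open>\<open>dependent\<close> speaks of sets, so coinciding powers, which give a
    relation at once, are treated apart.\<close>
  proof (cases "inj_on (mat_power M) {..?K}")
    case True
    have "dependent (mat_power M ` {..?K})"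
      by (rule dependent_biggerset) (use True in \<open>auto simp: card_image\<close>)
    then obtain u v where u: "v \<in> mat_power M ` {..?K}" "u v \<noteq> 0"
      "(\<Sum>v\<in>mat_power M ` {..?K}. u v *\<^sub>R v) = 0"
      by (auto simp: dependent_finite)
    then show ?thesis using True
      by (intro exI[of _ "\<lambda>k. u (mat_power M k)"]) (auto simp: sum.reindex)
  next
    case False
    then obtain a b where ab: "a \<le> ?K" "b \<le> ?K" "a \<noteq> b" "mat_power M a = mat_power M b"
      by (auto simp: inj_on_def)
    have "(\<Sum>k\<le>?K. ((if k = a then 1 else 0) - (if k = b then 1 else 0)) *\<^sub>R mat_power M k)
        = (\<Sum>k\<le>?K. if k = a then mat_power M k else 0) - (\<Sum>k\<le>?K. if k = b then mat_power M k else 0)"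
      unfolding sum_subtractf[symmetric] by (intro sum.cong) auto
    also have "\<dots> = 0" using ab by simp
    finally show ?thesis using ab
      by (intro exI[of _ "\<lambda>k. (if k = a then 1 else 0) - (if k = b then 1 else 0)"]) auto
  qed
  then obtain u k0 where u: "k0 \<le> ?K" "u k0 \<noteq> 0" "(\<Sum>k\<le>?K. u k *\<^sub>R mat_power M k) = 0" by blast
  define p where "p = (\<Sum>k\<le>?K. monom (complex_of_real (u k)) k)"
  have co: "coeff p k = (if k \<le> ?K then of_real (u k) else 0)" for k
    by (simp add: p_def coeff_sum)
  have deg: "degree p \<le> ?K" by (rule degree_le) (simp add: co)
  have "pact p M w = 0" for w
  proof -
    have "pact p M w = (\<Sum>k\<le>?K. u k *\<^sub>R mat_power M k) *v w"
      unfolding pact_altdef[OF deg] sum_matrix_vector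
      by (intro sum.cong) (auto simp: co vec_eq_iff matrix_vector_mult_def sum_distrib_left
          scaleR_conv_of_real[of _ "_ :: complex"] mult.assoc)
    with u show ?thesis by simp
  qed
  moreover have "p \<noteq> 0" using u co[of k0] by auto
  ultimately show ?thesis using deg by blast
qed

lemma
  fixes M :: "complex^'n^'n"
  shows pact_min_poly: "pact (min_poly M) M w = 0"
    and min_poly_nonzero: "min_poly M \<noteq> 0"
    and min_poly_dvd: "(\<And>w. pact p M w = 0) \<Longrightarrow> min_poly M dvd p"
proof -
  obtain p0 where p0: "p0 \<noteq> 0" "\<forall>w. pact p0 M w = 0" using ex_annihilating_poly by blast
  obtain d where d: "d \<in> {p. \<forall>w. pact p M w = 0}" "lead_coeff d = 1"
    "\<And>p. p \<in> {p. \<forall>w. pact p M w = 0} \<Longrightarrow> d dvd p"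
    by (rule poly_ideal_generator[of p0 "{p. \<forall>w. pact p M w = 0}"])
      (use p0 in \<open>auto simp: pact_diff pact_mult\<close>)
  have "min_poly M = d"
    unfolding min_poly_def
  proof (rule the_equality)
    show "lead_coeff d = 1 \<and> mat_poly d M = 0 \<and> (\<forall>q. q \<noteq> 0 \<and> mat_poly q M = 0 \<longrightarrow> degree d \<le> degree q)"
      using d by (auto simp: mat_poly_eq_0_iff intro: dvd_imp_degree_le)
  next
    fix p assume p: "lead_coeff p = 1 \<and> mat_poly p M = 0 \<and> (\<forall>q. q \<noteq> 0 \<and> mat_poly q M = 0 \<longrightarrow> degree p \<le> degree q)"
    then have "d dvd p" using d by (auto simp: mat_poly_eq_0_iff)
    then obtain e where e: "p = d * e" by (auto elim: dvdE)
    have nz: "d \<noteq> 0" "p \<noteq> 0" "e \<noteq> 0" using d(2) p e by auto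
    have "degree p \<le> degree d" using p d nz by (auto simp: mat_poly_eq_0_iff)
    then have "degree e = 0" using e nz by (simp add: degree_mult_eq)
    then obtain c where "e = [:c:]" by (auto elim: degree_eq_zeroE)
    moreover have "lead_coeff e = 1" using p d(2) by (simp add: e lead_coeff_mult)
    ultimately show "p = d" using e by simp
  qed
  with d show "pact (min_poly M) M w = 0" "min_poly M \<noteq> 0"
    "(\<And>w. pact p M w = 0) \<Longrightarrow> min_poly M dvd p" by auto
qed

section \<open>Divisibility by root multiplicities and Hermite interpolation\<close>

lemma poly_dvd_if_order_powers_dvd:
  assumes "\<And>l. [:- l, 1:] ^ order l P dvd q" "P \<noteq> 0"
  shows "P dvd (q :: complex poly)"
  using assms
proof (induct "degree P" arbitrary: P q)
  case 0
  then have "is_unit P" using is_unit_iff_degree by metis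
  then show ?case by auto
next
  case (Suc n)
  then obtain a where a: "poly P a = 0"
    using Fundamental_Theorem_Algebra.fundamental_theorem_of_algebra[of P] by (auto simp: constant_degree)
  then obtain P' where P': "P = [:- a, 1:] * P'" by (auto simp: poly_eq_0_iff_dvd elim: dvdE)
  have nz: "P' \<noteq> 0" "P \<noteq> 0" using Suc P' by auto
  have ord: "order l P = order l [:- a, 1:] + order l P'" for l
    using order_mult[of "[:- a, 1:]" P' l] nz P' by simp
  have o1: "order l [:- a, 1:] = (if l = a then 1 else 0)" for l
    using order_power_n_n[of a 1] by (auto intro: order_0I)
  have "[:- a, 1:] dvd q" using Suc(3)[of a] ord[of a] o1[of a]
    by (metis dvd_trans dvd_triv_left plus_1_eq_Suc power_Suc)
  then obtain q' where q': "q = [:- a, 1:] * q'" by (auto elim: dvdE)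
  have "P' dvd q'"
  proof (rule Suc(1))
    show "n = degree P'"
      using Suc(2) nz unfolding P' by (subst (asm) degree_mult_eq) auto
    fix l
    show "[:- l, 1:] ^ order l P' dvd q'"
    proof (cases "q' = 0")
      case False
      have a1: "[:- a, 1:] \<noteq> 0" by simp
      with False have "q \<noteq> 0" using no_zero_divisors[of "[:- a, 1:]" q'] a1 unfolding q' by blast
      then have "order l P \<le> order l q" using Suc(3)[of l] by (subst (asm) order_divides) blast
      moreover have "order l q = order l [:- a, 1:] + order l q'"
        using order_mult[of "[:- a, 1:]" q' l] \<open>q \<noteq> 0\<close> unfolding q' by blast
      ultimately show ?thesis using ord[of l] by (simp add: order_divides)
    qed simp
  qed (use nz in auto)
  then show ?case unfolding P' q' by (rule mult_dvd_mono[OF dvd_refl])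
qed

text \<open>In characteristic zero, differentiation lowers the order of a root by exactly one. This
  translates divisibility into interpolation conditions.\<close>

lemma power_dvd_iff_pderivs:
  "[:- l, 1:] ^ k dvd (q :: complex poly) \<longleftrightarrow> (\<forall>j<k. poly ((pderiv ^^ j) q) l = 0)"
proof (induct k arbitrary: q)
  case (Suc k)
  show ?case
  proof
    assume "[:- l, 1:] ^ Suc k dvd q"
    then obtain r where r: "q = [:- l, 1:] ^ Suc k * r" by (auto elim: dvdE)
    have "pderiv q = [:- l, 1:] ^ k * ([:- l, 1:] * pderiv r + smult (of_nat (Suc k)) r)"
      unfolding r pderiv_mult pderiv_power_Suc by (simp add: algebra_simps pderiv_pCons)
    then have "[:- l, 1:] ^ k dvd pderiv q" by (metis dvd_triv_left)
    with Suc[of "pderiv q"] have *: "\<forall>j<k. poly ((pderiv ^^ j) (pderiv q)) l = 0" by blast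
    show "\<forall>j<Suc k. poly ((pderiv ^^ j) q) l = 0"
    proof (intro allI impI)
      fix j assume "j < Suc k"
      then show "poly ((pderiv ^^ j) q) l = 0"
        using * by (cases j) (auto simp: r funpow_Suc_right simp del: funpow.simps)
    qed
  next
    assume *: "\<forall>j<Suc k. poly ((pderiv ^^ j) q) l = 0"
    then have q0: "poly q l = 0" by (metis funpow_0 zero_less_Suc)
    have "\<forall>j<k. poly ((pderiv ^^ j) (pderiv q)) l = 0"
      using * by (metis Suc_less_eq comp_apply funpow_Suc_right)
    then have d: "[:- l, 1:] ^ k dvd pderiv q" using Suc by blast
    show "[:- l, 1:] ^ Suc k dvd q"
    proof (cases "pderiv q = 0")
      case True
      then obtain h where "q = [:h:]" using pderiv_iszero by blast
      with q0 show ?thesis by simp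
    next
      case False
      then have "q \<noteq> 0" by auto
      then have "order l q = Suc (order l (pderiv q))"
        using q0 False by (intro order_pderiv) (auto simp: order_root)
      moreover have "k \<le> order l (pderiv q)" using d False by (auto simp: order_divides)
      ultimately show ?thesis by (simp only: order_divides) simp
    qed
  qed
qed simp

lemma poly_dvd_if_pderivs:
  assumes "P \<noteq> 0" "\<And>l j. j < order l P \<Longrightarrow> poly ((pderiv ^^ j) q) l = 0"
  shows "P dvd (q :: complex poly)"
  by (rule poly_dvd_if_order_powers_dvd) (use assms in \<open>auto simp: power_dvd_iff_pderivs\<close>)

lemma pderiv_funpow_add: "(pderiv ^^ j) (p + q) = (pderiv ^^ j) p + (pderiv ^^ j) (q :: complex poly)"
  by (induct j) (simp_all add: pderiv_add)

lemma pderiv_funpow_smult: "(pderiv ^^ j) (smult c p) = smult c ((pderiv ^^ j) (p :: complex poly))"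
  by (induct j) (simp_all add: pderiv_smult)

lemma pderiv_funpow_diff: "(pderiv ^^ j) (p - q) = (pderiv ^^ j) p - (pderiv ^^ j) (q :: complex poly)"
  by (induct j) (simp_all add: pderiv_diff)

text \<open>Induction on the degree: splitting off a root a leaves one new condition, on the
  derivative of order m at a, where m is the multiplicity of a in the cofactor P'. A multiple of P'
  corrects it without disturbing the other conditions, because order m is the first at which the
  derivative of P' does not vanish at a.\<close>

lemma hermite_interpolation:
  fixes P :: "complex poly"
  assumes "P \<noteq> 0"
  shows "\<exists>q. \<forall>l j. j < order l P \<longrightarrow> poly ((pderiv ^^ j) q) l = c l j"
  using assms
proof (induct "degree P" arbitrary: P)
  case 0
  then have "order l P = 0" for l using order_degree[of P l] by simp
  then show ?case by simp
next
  case (Suc n)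
  then obtain a where a: "poly P a = 0"
    using Fundamental_Theorem_Algebra.fundamental_theorem_of_algebra[of P] by (auto simp: constant_degree)
  then obtain P' where P': "P = [:- a, 1:] * P'" by (auto simp: poly_eq_0_iff_dvd elim: dvdE)
  have nz: "P' \<noteq> 0" using Suc P' by auto
  have ord: "order l P = order l [:- a, 1:] + order l P'" for l
    using order_mult[of "[:- a, 1:]" P' l] Suc P' by simp
  have o1: "order l [:- a, 1:] = (if l = a then 1 else 0)" for l
    using order_power_n_n[of a 1] by (auto intro: order_0I)
  have "n = degree P'"
    using Suc(2) nz unfolding P' by (subst (asm) degree_mult_eq) auto
  with Suc(1)[OF _ nz] obtain q where q: "\<And>l j. j < order l P' \<Longrightarrow> poly ((pderiv ^^ j) q) l = c l j"
    by blast
  define m where "m = order a P'"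
  have z: "poly ((pderiv ^^ j) P') l = 0" if "j < order l P'" for l j
    using order_1[of l P'] that by (subst (asm) power_dvd_iff_pderivs) auto
  have "poly ((pderiv ^^ m) P') a \<noteq> 0"
  proof
    assume "poly ((pderiv ^^ m) P') a = 0"
    then have "[:- a, 1:] ^ Suc m dvd P'"
      using z[of _ a] by (simp only: power_dvd_iff_pderivs) (auto simp: less_Suc_eq m_def)
    then show False using nz by (auto simp: order_divides m_def simp del: power_Suc)
  qed
  define t where "t = (c a m - poly ((pderiv ^^ m) q) a) / poly ((pderiv ^^ m) P') a"
  have "poly ((pderiv ^^ j) (q + smult t P')) l = c l j" if "j < order l P" for l j
  proof (cases "j < order l P'")
    case True
    then show ?thesis using q z by (simp add: pderiv_funpow_add pderiv_funpow_smult)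
  next
    case False
    then have "l = a" "j = m" using that ord[of l] o1[of l] by (auto simp: m_def split: if_splits)
    then show ?thesis using \<open>poly ((pderiv ^^ m) P') a \<noteq> 0\<close>
      by (simp add: pderiv_funpow_add pderiv_funpow_smult t_def)
  qed
  then show ?case by blast
qed

section \<open>The spectrum and the interpolating polynomial of a matrix\<close>

lemma eigenvalue_iff_root_min_poly: "l \<in> spectrum M \<longleftrightarrow> poly (min_poly M) l = 0"
proof
  assume "l \<in> spectrum M"
  then obtain x where x: "x \<noteq> 0" "M *v x = l *s x" by (auto simp: spectrum_def)
  then have "poly (min_poly M) l *s x = 0" using pact_min_poly[of M x] by (simp add: pact_eigen)
  with x(1) show "poly (min_poly M) l = 0" by auto
next
  assume "poly (min_poly M) l = 0"
  then obtain q where q: "min_poly M = [:- l, 1:] * q" by (auto simp: poly_eq_0_iff_dvd elim: dvdE)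
  have "q \<noteq> 0" using min_poly_nonzero[of M] q by auto
  have "\<not> min_poly M dvd q"
  proof
    assume "min_poly M dvd q"
    from dvd_imp_degree_le[OF this \<open>q \<noteq> 0\<close>] show False
      unfolding q using \<open>q \<noteq> 0\<close> by (subst (asm) degree_mult_eq) auto
  qed
  then obtain w where w: "pact q M w \<noteq> 0" using min_poly_dvd by blast
  have "pact [:- l, 1:] M (pact q M w) = 0" by (metis pact_min_poly pact_mult q)
  then have "M *v pact q M w = l *s pact q M w" by (simp add: pact_linear_factor)
  with w show "l \<in> spectrum M" by (auto simp: spectrum_def)
qed

lemma eig_index_pos_iff: "0 < eig_index M l \<longleftrightarrow> l \<in> spectrum M"
  by (simp add: eig_index_def eigenvalue_iff_root_min_poly order_gt_0_iff min_poly_nonzero)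

text \<open>Resolves the definite description in \<open>hermite_poly\<close>: an interpolant reduced
  modulo the minimal polynomial is a candidate, and two candidates differ by a multiple of the
  minimal polynomial of smaller degree, hence by 0.\<close>

lemma hermite_poly_agrees:
  assumes "j < eig_index M l"
  shows "poly ((pderiv ^^ j) (hermite_poly f M)) l = (deriv ^^ j) f l"
proof -
  let ?m = "min_poly M"
  have idx: "j < eig_index M l \<Longrightarrow> l \<in> spectrum M" for j l
    using eig_index_pos_iff[of M l] by auto
  obtain q where q: "\<And>l j. j < order l ?m \<Longrightarrow> poly ((pderiv ^^ j) q) l = (deriv ^^ j) f l"
    using hermite_interpolation[OF min_poly_nonzero, where c = "\<lambda>l j. (deriv ^^ j) f l"] by blast
  define r where "r = q mod ?m"
  let ?Q = "\<lambda>p. degree p < degree ?m \<and>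
     (\<forall>l\<in>spectrum M. \<forall>j<eig_index M l. poly ((pderiv ^^ j) p) l = (deriv ^^ j) f l)"
  \<comment> \<open>The remainder may be 0, whose degree is 0, so the strict degree bound requires a
    non-constant minimal polynomial.\<close>
  have "degree ?m \<noteq> 0"
  proof
    assume "degree ?m = 0"
    then obtain c where c: "?m = [:c:]" by (auto elim: degree_eq_zeroE)
    then have "c *s 1 = (0 :: complex^'a)" using pact_min_poly[of M 1] by simp
    then have "c = 0" by (simp add: vec_eq_iff)
    then show False using c min_poly_nonzero[of M] by simp
  qed
  then have deg: "degree r < degree ?m"
    using degree_mod_less[of ?m q] min_poly_nonzero[of M] by (auto simp: r_def)
  have "?m dvd q - r" by (simp add: r_def)
  then have dv: "[:- l, 1:] ^ order l ?m dvd q - r" for l using order_1 dvd_trans by blast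
  have "poly ((pderiv ^^ j) r) l = (deriv ^^ j) f l" if "j < order l ?m" for l j
    using dv[of l] q[OF that] that unfolding power_dvd_iff_pderivs by (auto simp: pderiv_funpow_diff)
  with deg have Q: "?Q r" by (auto simp: eig_index_def)
  have "hermite_poly f M = r" unfolding hermite_poly_def
  proof (rule the_equality)
    show "?Q r" by (rule Q)
    fix p assume p: "?Q p"
    have "?m dvd p - r"
    proof (rule poly_dvd_if_pderivs)
      fix l j assume j: "j < order l ?m"
      then have "l \<in> spectrum M" using idx by (simp add: eig_index_def)
      then show "poly ((pderiv ^^ j) (p - r)) l = 0"
        using p Q j by (simp add: eig_index_def pderiv_funpow_diff)
    qed (rule min_poly_nonzero)
    moreover have "degree (p - r) < degree ?m" using p deg by (auto intro: degree_diff_less)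
    ultimately show "p = r" using dvd_imp_degree_le[of ?m "p - r"] by fastforce
  qed
  with Q assms idx[OF assms] show ?thesis by simp
qed

text \<open>The leading coefficient 1 and the degree bound allow the annihilator to be written as a
  product over a list of Newton nodes of bounded length.\<close>

lemma ex_min_annihilator:
  fixes M :: "complex^'n^'n"
  obtains d where "d \<noteq> 0" "pact d M w = 0" "\<And>p. pact p M w = 0 \<Longrightarrow> d dvd p"
    "degree d \<le> DIM(complex^'n^'n)" "lead_coeff d = 1"
proof -
  obtain p0 where p0: "p0 \<noteq> 0" "degree p0 \<le> DIM(complex^'n^'n)" "\<forall>w. pact p0 M w = 0"
    using ex_annihilating_poly by blast
  obtain d where d: "d \<in> {p. pact p M w = 0}" "lead_coeff d = 1"
    "\<And>p. p \<in> {p. pact p M w = 0} \<Longrightarrow> d dvd p"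
    by (rule poly_ideal_generator[of p0 "{p. pact p M w = 0}"])
      (use p0 in \<open>auto simp: pact_diff pact_mult\<close>)
  show ?thesis
  proof (rule that[of d])
    show "d \<noteq> 0" using d(2) by auto
    have "d dvd p0" using d p0 by auto
    then have "degree d \<le> degree p0" using p0 by (intro dvd_imp_degree_le) auto
    then show "degree d \<le> DIM(complex^'n^'n)" using p0(2) by linarith
  qed (use d in auto)
qed

text \<open>The minimal annihilator of w divides both P and the minimal polynomial of M, and r
  agrees with the Hermite polynomial to its order. So F(M) w depends only on the part of the
  spectrum that w sees; every later evaluation of \<open>mat_fun\<close> rests on this.\<close>

theorem mat_fun_on_vector:
  assumes "P \<noteq> 0" "pact P M w = 0" "\<And>l j. j < order l P \<Longrightarrow> poly ((pderiv ^^ j) r) l = (deriv ^^ j) f l"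
  shows "mat_fun f M *v w = pact r M w"
proof -
  obtain d where d: "d \<noteq> 0" "pact d M w = 0" "\<And>p. pact p M w = 0 \<Longrightarrow> d dvd p"
    using ex_min_annihilator[of M w] by metis
  have "d dvd hermite_poly f M - r"
  proof (rule poly_dvd_if_pderivs)
    fix l j assume j: "j < order l d"
    have "d dvd P" "d dvd min_poly M" using d(3)[OF assms(2)] d(3)[OF pact_min_poly] by auto
    then have "order l d \<le> order l P" "order l d \<le> eig_index M l"
      using dvd_imp_order_le[of P d l] dvd_imp_order_le[of "min_poly M" d l] assms(1) min_poly_nonzero[of M]
      by (auto simp: eig_index_def)
    then show "poly ((pderiv ^^ j) (hermite_poly f M - r)) l = 0"
      using j by (simp add: pderiv_funpow_diff hermite_poly_agrees assms(3))
  qed (rule d)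
  then have "pact (hermite_poly f M - r) M w = 0" using d(2) by (rule pact_dvd)
  then show ?thesis by (simp add: mat_fun_def pact_def[symmetric] pact_diff)
qed

lemmas [simp del] = transpose_matrix_vector

subsection \<open>Generalized eigenspaces\<close>

definition geig :: "complex^'n^'n \<Rightarrow> complex \<Rightarrow> (complex^'n) set" where
  "geig M l = {w. \<exists>k. pact ([:- l, 1:] ^ k) M w = 0}"

lemma geigI: "pact ([:- l, 1:] ^ k) M w = 0 \<Longrightarrow> w \<in> geig M l"
  by (auto simp: geig_def)

lemma pact_commute: "pact p M (pact q M w) = pact q M (pact p M w)"
  by (metis mult.commute pact_mult)

lemma pact_matrix_commute: "pact p M (M *v w) = M *v pact p M w"
  using pact_intertwine[of M M M p w] by simp

text \<open>Modulo X - l the polynomial q is the nonzero constant q(l), hence a unit. Inserting the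
  resulting identity into the one for exponent k raises the exponent.\<close>

lemma bezout_power:
  assumes "poly q l \<noteq> 0"
  shows "\<exists>a b. a * [:- l, 1:] ^ k + b * q = (1 :: complex poly)"
proof (induct k)
  case 0
  show ?case by (intro exI[of _ 1] exI[of _ 0]) simp
next
  case (Suc k)
  then obtain a b where ab: "a * [:- l, 1:] ^ k + b * q = 1" by blast
  have "[:- l, 1:] dvd q - [:poly q l:]" by (simp add: poly_eq_0_iff_dvd[symmetric])
  then obtain s where s: "q - [:poly q l:] = [:- l, 1:] * s" by (auto elim: dvdE)
  define c where "c = [:inverse (poly q l):]"
  have "c * [:poly q l:] = 1" using assms by (simp add: c_def one_pCons)
  moreover have "[:poly q l:] = q - [:- l, 1:] * s" using s by (simp add: algebra_simps)
  ultimately have c: "c * q - (c * s) * [:- l, 1:] = 1" by (simp only: algebra_simps)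
  have alg: "a * Y * (c * q - (c * s) * X) + b * q = (- (a * c * s)) * (X * Y) + (a * Y * c + b) * q"
    for X Y :: "complex poly" by (simp add: algebra_simps)
  have "1 = a * [:- l, 1:] ^ k * (c * q - (c * s) * [:- l, 1:]) + b * q" using ab c by simp
  also have "\<dots> = (- (a * c * s)) * [:- l, 1:] ^ Suc k + (a * [:- l, 1:] ^ k * c + b) * q"
    unfolding power_Suc by (rule alg)
  finally show ?case by metis
qed

lemma pact_coprime_0:
  assumes "poly q l \<noteq> 0" "pact q M w = 0" "pact ([:- l, 1:] ^ k) M w = 0"
  shows "w = 0"
proof -
  obtain a b where ab: "a * [:- l, 1:] ^ k + b * q = 1" using bezout_power[OF assms(1)] by blast
  have "w = pact (a * [:- l, 1:] ^ k + b * q) M w" by (simp only: ab pact_1)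
  also have "\<dots> = 0" by (simp only: pact_add pact_mult assms pact_vec_0) simp
  finally show ?thesis .
qed

lemma pact_power_order:
  assumes "P \<noteq> 0" "pact P M w = 0" "w \<in> geig M l"
  shows "pact ([:- l, 1:] ^ order l P) M w = 0"
proof -
  obtain k where k: "pact ([:- l, 1:] ^ k) M w = 0" using assms by (auto simp: geig_def)
  obtain s where s: "P = [:- l, 1:] ^ order l P * s" "\<not> [:- l, 1:] dvd s"
    using order_decomp[OF assms(1)] by blast
  show ?thesis
  proof (rule pact_coprime_0)
    show "poly s l \<noteq> 0" using s by (simp add: poly_eq_0_iff_dvd)
    show "pact s M (pact ([:- l, 1:] ^ order l P) M w) = 0"
      using assms(2) s(1) by (metis pact_commute pact_mult)
    show "pact ([:- l, 1:] ^ k) M (pact ([:- l, 1:] ^ order l P) M w) = 0"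
      using k by (metis pact_commute pact_vec_0)
  qed
qed

lemma geig_eig_index: "w \<in> geig M l \<longleftrightarrow> pact ([:- l, 1:] ^ eig_index M l) M w = 0"
  using pact_power_order[OF min_poly_nonzero pact_min_poly] geigI unfolding eig_index_def by metis

lemma less_eig_indexI:
  assumes "w \<in> geig M l" "pact ([:- l, 1:] ^ k) M w \<noteq> 0"
  shows "k < eig_index M l"
proof (rule ccontr)
  assume "\<not> k < eig_index M l"
  then have "[:- l, 1:] ^ eig_index M l dvd [:- l, 1:] ^ k" by (simp add: le_imp_power_dvd)
  then show False using assms geig_eig_index pact_dvd by metis
qed

text \<open>Supplies the top of a Jordan chain of maximal length: the minimal polynomial with one
  factor X - l removed cannot annihilate every vector.\<close>

lemma eig_index_attained:
  assumes "eig_index M l = Suc k"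
  obtains z where "pact ([:- l, 1:] ^ Suc k) M z = 0" "pact ([:- l, 1:] ^ k) M z \<noteq> 0"
proof -
  obtain s where s: "min_poly M = [:- l, 1:] ^ Suc k * s" 
    using order_decomp[OF min_poly_nonzero[of M], of l] assms by (auto simp: eig_index_def)
  have snz: "s \<noteq> 0" using s min_poly_nonzero[of M] by auto
  have "\<not> min_poly M dvd [:- l, 1:] ^ k * s"
  proof
    assume "min_poly M dvd [:- l, 1:] ^ k * s"
    then have "degree (min_poly M) \<le> degree ([:- l, 1:] ^ k * s)"
      by (rule dvd_imp_degree_le) (use snz in auto)
    moreover have "degree ([:- l, 1:] ^ j * s) = j + degree s" for j
      by (subst degree_mult_eq) (use snz in \<open>auto simp: degree_linear_power\<close>)
    ultimately show False using s by (simp del: power_Suc)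
  qed
  then obtain w where w: "pact ([:- l, 1:] ^ k * s) M w \<noteq> 0" using min_poly_dvd by blast
  show ?thesis
    by (rule that[of "pact s M w"]) (use w s pact_min_poly[of M w] in \<open>simp_all add: pact_mult del: power_Suc\<close>)
qed

lemma geig_add: "v \<in> geig M l \<Longrightarrow> w \<in> geig M l \<Longrightarrow> v + w \<in> geig M l"
  by (simp add: geig_eig_index pact_vec_add)

lemma geig_smult: "w \<in> geig M l \<Longrightarrow> c *s w \<in> geig M l"
  by (simp add: geig_eig_index pact_vec_smult)

lemma geig_matrix: "w \<in> geig M l \<Longrightarrow> M *v w \<in> geig M l"
  by (simp add: geig_eig_index pact_matrix_commute)

lemma geig_commuting:
  assumes "\<And>v. X *v (M *v v) = M *v (X *v v)" "w \<in> geig M l"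
  shows "X *v w \<in> geig M l"
  using assms(2) pact_intertwine[of X M M, OF assms(1)] by (metis geig_eig_index matrix_vector_mult_0_right)

lemma geig_0: "0 \<in> geig M l"
  by (simp add: geig_eig_index)

text \<open>The primary decomposition in the form of an induction rule, so that direct sums and
  projections need not be mentioned. Bezout splits off the summand for one root of an annihilator,
  and the rest has an annihilator of smaller degree.\<close>

lemma geig_span:
  fixes M :: "complex^'n^'n"
  assumes geig: "\<And>l w. w \<in> geig M l \<Longrightarrow> Q w" and add: "\<And>v w. Q v \<Longrightarrow> Q w \<Longrightarrow> Q (v + w)"
  shows "Q w"
proof -
  have "Q w" if "P \<noteq> 0" "pact P M w = 0" for P w
    using that
  proof (induct "degree P" arbitrary: P w rule: less_induct)
    case less
    show ?case
    proof (cases "degree P = 0")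
      case True
      then obtain c where "P = [:c:]" by (auto elim: degree_eq_zeroE)
      with less have "w = 0" by auto
      then show ?thesis using geig[OF geig_0] by blast
    next
      case False
      then obtain l where l: "poly P l = 0"
        using Fundamental_Theorem_Algebra.fundamental_theorem_of_algebra[of P]
        by (auto simp: constant_degree)
      obtain s where s: "P = [:- l, 1:] ^ order l P * s" "\<not> [:- l, 1:] dvd s"
        using order_decomp[OF less(2)] by blast
      have snz: "s \<noteq> 0" using s less(2) by auto
      have "order l P > 0" using l less(2) by (simp add: order_gt_0_iff)
      moreover have "degree P = order l P + degree s"
        by (subst s(1), subst degree_mult_eq) (use snz in \<open>auto simp: degree_linear_power\<close>)
      ultimately have dless: "degree s < degree P" by simp
      have "poly s l \<noteq> 0" using s(2) by (simp add: poly_eq_0_iff_dvd)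
      then obtain a b where ab: "a * [:- l, 1:] ^ order l P + b * s = 1"
        using bezout_power by blast
      have P0: "pact ([:- l, 1:] ^ order l P) M (pact s M w) = 0" using less(3) s(1) by (metis pact_mult)
      have "w = pact (a * [:- l, 1:] ^ order l P + b * s) M w" by (simp only: ab pact_1)
      also have "\<dots> = pact (a * [:- l, 1:] ^ order l P) M w + pact (b * s) M w" by (simp only: pact_add)
      finally have w: "w = pact (a * [:- l, 1:] ^ order l P) M w + pact (b * s) M w" .
      have "pact (b * s) M w \<in> geig M l"
        using P0 by (intro geigI[of _ "order l P"]) (metis pact_commute pact_mult pact_vec_0)
      moreover have "pact s M (pact (a * [:- l, 1:] ^ order l P) M w) = 0"
        using P0 by (metis pact_commute pact_mult pact_vec_0)
      ultimately show ?thesis using add geig less(1)[OF dless snz] w by metis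
    qed
  qed
  then show ?thesis using min_poly_nonzero pact_min_poly by blast
qed

subsection \<open>Transposition\<close>

lemma scalar_product_add_left: "scalar_product (x + y) z = scalar_product x z + scalar_product (y :: 'a::comm_ring_1^'n) z"
  and scalar_product_add_right: "scalar_product z (x + y) = scalar_product z x + scalar_product z (y :: 'a::comm_ring_1^'n)"
  and scalar_product_smult_left: "scalar_product (c *s x) z = c * scalar_product (x :: 'a::comm_ring_1^'n) z"
  and scalar_product_smult_right: "scalar_product z (c *s x) = c * scalar_product z (x :: 'a::comm_ring_1^'n)"
  and scalar_product_diff_right: "scalar_product z (x - y) = scalar_product z x - scalar_product z (y :: 'a::comm_ring_1^'n)"
  and scalar_product_diff_left: "scalar_product (x - y) z = scalar_product x z - scalar_product (y :: 'a::comm_ring_1^'n) z"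
  and scalar_product_zero_left [simp]: "scalar_product 0 (z :: 'a::comm_ring_1^'n) = 0"
  and scalar_product_zero_right [simp]: "scalar_product z (0 :: 'a::comm_ring_1^'n) = 0"
  and scalar_product_commute: "scalar_product x (y :: 'a::comm_ring_1^'n) = scalar_product y x"
  by (simp_all add: scalar_product_def algebra_simps sum.distrib sum_subtractf sum_distrib_left)

lemma scalar_product_axis [simp]: "scalar_product (axis i 1) (x :: 'a::comm_ring_1^'n) = x $ i"
  "scalar_product x (axis i 1) = x $ i"
  by (simp_all add: scalar_product_def axis_def if_distrib[of "\<lambda>y. y * _"] if_distrib[of "\<lambda>y. _ * y"] cong: if_cong)

lemma scalar_product_ext: "(\<And>z. scalar_product z x = scalar_product z y) \<Longrightarrow> x = (y :: 'a::comm_ring_1^'n)"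
  by (metis scalar_product_axis(1) vec_eq_iff)

lemma scalar_product_transpose: "scalar_product x (transpose M *v y) = scalar_product (M *v x) (y :: 'a::comm_ring_1^'n)"
proof -
  have "scalar_product x (transpose M *v y) = (\<Sum>i\<in>UNIV. \<Sum>j\<in>UNIV. x $ i * M $ j $ i * y $ j)"
    by (simp add: scalar_product_def matrix_vector_mult_def transpose_def sum_distrib_left mult.assoc)
  also have "\<dots> = (\<Sum>j\<in>UNIV. \<Sum>i\<in>UNIV. x $ i * M $ j $ i * y $ j)" by (rule sum.swap)
  also have "\<dots> = scalar_product (M *v x) y"
    by (simp add: scalar_product_def matrix_vector_mult_def sum_distrib_right sum_distrib_left mult_ac)
  finally show ?thesis .
qed

lemma scalar_product_pact: "scalar_product x (pact p (transpose M) y) = scalar_product (pact p M x) y"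
proof (induct p arbitrary: x)
  case (pCons a p)
  then show ?case
    by (simp add: pact_pCons scalar_product_add_left scalar_product_add_right scalar_product_smult_left
        scalar_product_smult_right scalar_product_transpose pact_matrix_commute)
qed simp

lemma pact_transpose_0: "(\<And>w. pact p M w = 0) \<Longrightarrow> pact p (transpose M) w = 0"
  by (rule scalar_product_ext) (simp add: scalar_product_pact)

lemma geig_transpose: "w \<in> geig (transpose M) l \<Longrightarrow> pact ([:- l, 1:] ^ eig_index M l) (transpose M) w = 0"
  unfolding eig_index_def by (rule pact_power_order[OF min_poly_nonzero pact_transpose_0[OF pact_min_poly]])

text \<open>In a Bezout identity for the powers of X - l and X - m, one summand kills x, while the
  other can be moved across the pairing and kills y. The pairing is bilinear without conjugation, so
  it matches M with its transpose.\<close>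

lemma geig_orthogonal:
  assumes "x \<in> geig M l" "y \<in> geig (transpose M) m" "l \<noteq> m"
  shows "scalar_product x y = 0"
proof -
  obtain j k where jk: "pact ([:- l, 1:] ^ k) M x = 0" "pact ([:- m, 1:] ^ j) (transpose M) y = 0"
    using assms by (auto simp: geig_def)
  have "poly ([:- m, 1:] ^ j) l \<noteq> 0" using assms by simp
  then obtain a b where ab: "a * [:- l, 1:] ^ k + b * [:- m, 1:] ^ j = 1" using bezout_power by blast
  have "scalar_product x y = scalar_product (pact (a * [:- l, 1:] ^ k + b * [:- m, 1:] ^ j) M x) y"
    by (simp only: ab pact_1)
  also have "\<dots> = scalar_product (pact ([:- m, 1:] ^ j) M (pact b M x)) y"
    by (simp only: pact_add pact_mult jk pact_vec_0 pact_commute[of b]) simp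
  also have "\<dots> = 0" by (simp add: scalar_product_pact[symmetric] jk)
  finally show ?thesis .
qed

text \<open>A vector orthogonal to the matching generalized eigenspace of the transpose is
  orthogonal to all of them, hence to everything.\<close>

lemma geig_dual_nonzero:
  assumes "x \<in> geig M l" "x \<noteq> 0"
  shows "\<exists>y\<in>geig (transpose M) l. scalar_product x y \<noteq> 0"
proof (rule ccontr)
  assume *: "\<not> (\<exists>y\<in>geig (transpose M) l. scalar_product x y \<noteq> 0)"
  have "scalar_product x y = 0" for y
  proof (rule geig_span[of "transpose M" "\<lambda>y. scalar_product x y = 0"])
    fix m w assume "w \<in> geig (transpose M) m"
    then show "scalar_product x w = 0" using * geig_orthogonal[OF assms(1), of w m] by (cases "m = l") auto
  qed (simp add: scalar_product_add_right)
  then have "x = 0" by (intro scalar_product_ext) (simp add: scalar_product_commute[of _ x])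
  with assms show False by simp
qed

text \<open>The minimal polynomial of M annihilates X w under M', so one Hermite polynomial serves
  both sides; invertibility of X does not enter.\<close>

lemma mat_fun_intertwine:
  assumes "\<And>v. X *v (M *v v) = M' *v (X *v v)"
  shows "mat_fun f M' *v (X *v w) = X *v (mat_fun f M *v w)"
proof -
  have "mat_fun f M' *v (X *v w) = pact (hermite_poly f M) M' (X *v w)"
    by (rule mat_fun_on_vector[of "min_poly M"])
      (simp_all add: min_poly_nonzero pact_intertwine[OF assms, symmetric] pact_min_poly
        hermite_poly_agrees eig_index_def)
  also have "\<dots> = X *v pact (hermite_poly f M) M w" by (rule pact_intertwine[OF assms, symmetric])
  finally show ?thesis by (simp add: mat_fun_def pact_def)
qed

lemma mat_fun_transpose: "mat_fun f (transpose M) = transpose (mat_fun f M)"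
proof -
  have "mat_fun f (transpose M) *v w = transpose (mat_fun f M) *v w" for w
  proof (rule scalar_product_ext)
    fix z
    have "mat_fun f (transpose M) *v w = pact (hermite_poly f M) (transpose M) w"
      by (rule mat_fun_on_vector[of "min_poly M"])
        (simp_all add: min_poly_nonzero pact_transpose_0 pact_min_poly hermite_poly_agrees eig_index_def)
    then show "scalar_product z (mat_fun f (transpose M) *v w) = scalar_product z (transpose (mat_fun f M) *v w)"
      by (simp add: scalar_product_pact scalar_product_transpose) (simp add: mat_fun_def pact_def)
  qed
  then show ?thesis by (simp add: matrix_eq)
qed

subsection \<open>Real matrices and conjugation\<close>

definition vcnj :: "complex^'n \<Rightarrow> complex^'n" where
  "vcnj v = (\<chi> i. cnj (v $ i))"

lemma vcnj_simps [simp]: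
  "vcnj (vcnj v) = v" "vcnj 0 = 0" "vcnj v = 0 \<longleftrightarrow> v = 0" "vcnj (cvec x) = cvec x"
  by (auto simp: vcnj_def cvec_def vec_eq_iff)

lemma vcnj_diff: "vcnj (v - w) = vcnj v - vcnj w"
  and vcnj_smult: "vcnj (c *s v) = cnj c *s vcnj v"
  by (auto simp: vcnj_def vec_eq_iff)

lemma scalar_product_vcnj: "scalar_product (vcnj x) (vcnj y) = cnj (scalar_product x y)"
  by (simp add: scalar_product_def vcnj_def)

lemma cmat_nth [simp]: "cmat A $ i $ j = complex_of_real (A $ i $ j)"
  by (simp add: cmat_def map_matrix_def)

lemma cmat_vcnj: "cmat A *v vcnj w = vcnj (cmat A *v w)"
  by (simp add: vec_eq_iff vcnj_def matrix_vector_mult_def)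

lemma cmat_cvec: "cmat A *v cvec x = cvec (A *v x)"
  by (simp add: vec_eq_iff cvec_def matrix_vector_mult_def)

lemma cmat_transpose: "cmat (transpose A) = transpose (cmat A)"
  by (simp add: vec_eq_iff transpose_def)

lemma cvec_eq_iff [simp]: "cvec x = cvec y \<longleftrightarrow> x = y" "cvec x = 0 \<longleftrightarrow> x = 0"
  by (auto simp: vec_eq_iff cvec_def)

lemma cvec_smult: "cvec (c *s x) = of_real c *s cvec x"
  and cvec_diff: "cvec (x - y) = cvec x - cvec y"
  by (simp_all add: vec_eq_iff cvec_def)

lemma scalar_product_cvec: "scalar_product (cvec x) (cvec y) = of_real (scalar_product x y)"
  by (simp add: scalar_product_def cvec_def)

lemma pact_vcnj:
  fixes A :: "real^'n^'n"
  shows "pact ([:- cnj l, 1:] ^ k) (cmat A) (vcnj w) = vcnj (pact ([:- l, 1:] ^ k) (cmat A) w)"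
proof (induct k arbitrary: w)
  case (Suc k)
  have "pact ([:- l, 1:] ^ Suc k) M w = pact ([:- l, 1:] ^ k) M (M *v w - l *s w)" for l w and M :: "complex^'n^'n"
    unfolding power_Suc2 pact_mult pact_linear_factor ..
  moreover have "cmat A *v vcnj w - cnj l *s vcnj w = vcnj (cmat A *v w - l *s w)"
    by (simp add: cmat_vcnj vcnj_diff vcnj_smult)
  ultimately show ?case using Suc by (simp del: power_Suc)
qed simp

lemma geig_vcnj: "w \<in> geig (cmat A) l \<Longrightarrow> vcnj w \<in> geig (cmat A) (cnj l)"
  unfolding geig_def by (auto simp: pact_vcnj)

lemma eig_index_cnj: "eig_index (cmat A) (cnj l) = eig_index (cmat A) l"
proof -
  have "eig_index (cmat A) l \<le> eig_index (cmat A) (cnj l)" for l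
  proof (cases "eig_index (cmat A) l")
    case (Suc k)
    then obtain z where z: "pact ([:- l, 1:] ^ Suc k) (cmat A) z = 0" "pact ([:- l, 1:] ^ k) (cmat A) z \<noteq> 0"
      by (rule eig_index_attained)
    then have "k < eig_index (cmat A) (cnj l)"
      by (intro less_eig_indexI[of "vcnj z"] geig_vcnj geigI[OF z(1)]) (simp add: pact_vcnj)
    with Suc show ?thesis by simp
  qed simp
  from this[of l] this[of "cnj l"] show ?thesis by simp
qed

subsection \<open>The derivative of a matrix polynomial\<close>

lemma bounded_bilinear_matrix_mult: "bounded_bilinear ((**) :: complex^'n^'m \<Rightarrow> complex^'k^'n \<Rightarrow> complex^'k^'m)"
  unfolding bilinear_conv_bounded_bilinear[symmetric] bilinear_def
  by (auto intro!: linearI simp: vec_eq_iff matrix_matrix_mult_def sum.distrib algebra_simps scaleR_sum_right)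

lemma bounded_bilinear_matrix_vector_mult: "bounded_bilinear ((*v) :: complex^'n^'m \<Rightarrow> complex^'n \<Rightarrow> complex^'m)"
  unfolding bilinear_conv_bounded_bilinear[symmetric] bilinear_def
  by (auto intro!: linearI simp: vec_eq_iff matrix_vector_mult_def sum.distrib algebra_simps scaleR_sum_right)

lemma cmat_add: "cmat (A + B) = cmat A + cmat B"
  and cmat_scaleR: "cmat (c *\<^sub>R A) = c *\<^sub>R cmat A"
  by (simp_all add: vec_eq_iff) (simp add: scaleR_conv_of_real)

lemma cmat_mult: "cmat (A ** B) = cmat A ** cmat B"
  by (simp add: vec_eq_iff matrix_matrix_mult_def)

lemma bounded_linear_cmat: "bounded_linear (cmat :: real^'n^'n \<Rightarrow> _)"
  unfolding linear_conv_bounded_linear[symmetric] by (auto intro!: linearI simp: cmat_add cmat_scaleR)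

lemma bounded_linear_scaled_matrix: "bounded_linear (map_matrix (\<lambda>x :: complex. c * x) :: complex^'n^'m \<Rightarrow> _)"
  unfolding linear_conv_bounded_linear[symmetric]
  by (auto intro!: linearI simp: vec_eq_iff map_matrix_def algebra_simps)

definition mat_poly_deriv :: "complex poly \<Rightarrow> real^'n^'n \<Rightarrow> real^'n^'n \<Rightarrow> complex^'n^'n" where
  "mat_poly_deriv p A E = (\<Sum>k\<le>degree p. map_matrix (\<lambda>x. coeff p k * x)
     (\<Sum>i<k. mat_power (cmat A) i ** cmat E ** mat_power (cmat A) (k - Suc i)))"

lemma mat_power_has_derivative:
  fixes A :: "real^'n^'n"
  shows "((\<lambda>M. mat_power (cmat M) k) has_derivative
     (\<lambda>E. \<Sum>i<k. mat_power (cmat A) i ** cmat E ** mat_power (cmat A) (k - Suc i))) (at A)"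
proof (induct k)
  case (Suc k)
  have "((\<lambda>M. cmat M ** mat_power (cmat M) k) has_derivative
    (\<lambda>E. cmat A ** (\<Sum>i<k. mat_power (cmat A) i ** cmat E ** mat_power (cmat A) (k - Suc i))
       + cmat E ** mat_power (cmat A) k)) (at A)"
    by (rule bounded_bilinear.FDERIV[OF bounded_bilinear_matrix_mult
          bounded_linear_imp_has_derivative[OF bounded_linear_cmat] Suc])
  also have "(\<lambda>E. cmat A ** (\<Sum>i<k. mat_power (cmat A) i ** cmat E ** mat_power (cmat A) (k - Suc i))
       + cmat E ** mat_power (cmat A) k)
     = (\<lambda>E. \<Sum>i<Suc k. mat_power (cmat A) i ** cmat E ** mat_power (cmat A) (Suc k - Suc i))"
    by (simp add: sum.lessThan_Suc_shift bounded_bilinear.sum_right[OF bounded_bilinear_matrix_mult]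
        matrix_mul_assoc fun_eq_iff del: sum.lessThan_Suc)
  finally show ?case by simp
qed simp

lemma mat_poly_has_derivative:
  fixes A :: "real^'n^'n"
  shows "((\<lambda>M. mat_poly p (cmat M)) has_derivative mat_poly_deriv p A) (at A)"
  unfolding mat_poly_def mat_poly_deriv_def
  by (intro has_derivative_sum bounded_linear.has_derivative[OF bounded_linear_scaled_matrix]
      mat_power_has_derivative)

lemma cmat_outer: "cmat (outer x y) *v w = scalar_product (cvec y) w *s cvec x"
  by (simp add: vec_eq_iff matrix_vector_mult_def outer_def scalar_product_def cvec_def sum_distrib_right sum_distrib_left mult_ac)

lemma scalar_product_sum_right: "scalar_product x (\<Sum>k\<in>S. g k) = (\<Sum>k\<in>S. scalar_product x (g k :: complex^'n))"
  by (induct S rule: infinite_finite_induct) (simp_all add: scalar_product_add_right)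

text \<open>On rank one matrices each term of the Leibniz sum factors into two scalar products, and
  reversing the index, i to k - 1 - i, exchanges their roles.\<close>

lemma mat_poly_deriv_symmetric:
  "scalar_product (cvec u) (mat_poly_deriv p A (outer a b) *v cvec v)
   = scalar_product (cvec b) (mat_poly_deriv p A (outer v u) *v cvec a)"
proof -
  let ?P = "mat_power (cmat A)"
  have *: "scalar_product (cvec u) (mat_poly_deriv p A (outer a b) *v cvec v)
    = (\<Sum>k\<le>degree p. coeff p k * (\<Sum>i<k. scalar_product (cvec b) (?P (k - Suc i) *v cvec v)
        * scalar_product (cvec u) (?P i *v cvec a)))" for u v a b
    by (simp add: mat_poly_deriv_def sum_matrix_vector scaled_matrix_vector scalar_product_sum_right
        scalar_product_smult_right matrix_vector_smult cmat_outer matrix_vector_mul_assoc[symmetric])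
  show ?thesis
    unfolding *
  proof (rule sum.cong[OF refl])
    fix k
    have "(\<Sum>i<k. scalar_product (cvec b) (?P (k - Suc i) *v cvec v) * scalar_product (cvec u) (?P i *v cvec a))
      = (\<Sum>i<k. scalar_product (cvec b) (?P i *v cvec v) * scalar_product (cvec u) (?P (k - Suc i) *v cvec a))"
      by (subst sum.nat_diff_reindex[symmetric]) (auto intro!: sum.cong simp: Suc_diff_Suc)
    then show "coeff p k * (\<Sum>i<k. scalar_product (cvec b) (?P (k - Suc i) *v cvec v) * scalar_product (cvec u) (?P i *v cvec a))
      = coeff p k * (\<Sum>i<k. scalar_product (cvec u) (?P (k - Suc i) *v cvec a) * scalar_product (cvec b) (?P i *v cvec v))"
      by (simp add: mult.commute)
  qed
qed

subsection \<open>Rank one perturbations\<close>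

text \<open>Perturbations have to be real, so the complex rank one matrix x y^T is accompanied by
  its conjugate. For a non-real eigenvalue the two summands act on different generalized
  eigenspaces.\<close>

definition re_outer :: "complex^'n \<Rightarrow> complex^'n \<Rightarrow> real^'n^'n" where
  "re_outer x y = (\<chi> i j. 2 * Re (x $ i * y $ j))"

lemma cmat_re_outer:
  "cmat (re_outer x y) *v w = scalar_product y w *s x + scalar_product (vcnj y) w *s vcnj x"
proof -
  have *: "complex_of_real (2 * Re z) = z + cnj z" for z by (simp add: complex_add_cnj)
  have "cmat (re_outer x y) $ i $ j = x $ i * y $ j + cnj (x $ i) * cnj (y $ j)" for i j
    by (simp only: cmat_nth re_outer_def vec_lambda_beta * complex_cnj_mult)
  then show ?thesis
    by (simp add: vec_eq_iff matrix_vector_mult_def scalar_product_def vcnj_def sum_distrib_right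
        distrib_right distrib_left sum.distrib sum_distrib_left mult_ac)
qed

lemma inner_outer: "outer x y \<bullet> D = scalar_product x (D *v y)"
  by (simp add: inner_vec_def outer_def scalar_product_def matrix_vector_mult_def sum_distrib_left mult_ac)

lemma inner_re_outer: "re_outer x y \<bullet> D = 2 * Re (scalar_product x (cmat D *v y))"
  by (simp add: inner_vec_def re_outer_def scalar_product_def matrix_vector_mult_def sum_distrib_left
      mult_ac sum_distrib_right) (intro sum.cong refl, simp add: algebra_simps)

lemma cmat_line: "cmat (A + t *\<^sub>R E) *v w = cmat A *v w + of_real t *s (cmat E *v w)"
  by (simp add: vec_eq_iff matrix_vector_mult_def algebra_simps sum.distrib sum_distrib_left)

lemma cmat_line_diff: "cmat (A - t *\<^sub>R E) *v w = cmat A *v w - of_real t *s (cmat E *v w)"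
  using cmat_line[of A "- t" E w] by (simp add: vec_eq_iff)

lemma scaleR_eq_smult: "t *\<^sub>R (v :: complex^'n) = complex_of_real t *s v"
  by (simp add: vec_eq_iff) (simp add: scaleR_conv_of_real)

text \<open>One-sided limits suffice to identify a derivative that is known to exist, and the
  perturbation that splits a Jordan block has real eigenvalues only for t > 0.\<close>

lemma vector_derivative_quotient:
  assumes "(g has_vector_derivative d) (at 0)" "g 0 = 0"
  shows "((\<lambda>t. (1 / t) *\<^sub>R g t) \<longlongrightarrow> d) (at_right 0)"
proof -
  have "(g has_vector_derivative d) (at_right 0)"
    using assms(1) by (rule has_vector_derivative_at_within)
  then have "((\<lambda>t. (1 / norm (t - 0)) *\<^sub>R (g t - (g 0 + (t - 0) *\<^sub>R d))) \<longlongrightarrow> 0) (at_right 0)"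
    unfolding has_vector_derivative_def has_derivative_within by blast
  then have "((\<lambda>t. (1 / t) *\<^sub>R g t - d) \<longlongrightarrow> 0) (at_right 0)"
    by (rule Lim_transform_eventually)
      (auto simp: eventually_at_filter assms(2) scaleR_diff_right intro!: always_eventually)
  then show ?thesis by (simp add: LIM_zero_iff)
qed

subsection \<open>Comparison with an interpolating polynomial\<close>

text \<open>The condition \<open>agree\<close> makes f and q coincide as functions of A and no more;
  each kind of eigenvalue adds its own conditions on higher derivatives of q. The map
  \<open>LG\<close> below is the K of the overview.\<close>

locale interpolation =
  fixes A :: "real^'n^'n" and f :: "complex \<Rightarrow> complex" and q :: "complex poly"
    and L :: "real^'n^'n \<Rightarrow> complex^'n^'n"
  assumes der: "((\<lambda>M. mat_fun f (cmat M)) has_derivative L) (at A)"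
    and agree: "j < eig_index (cmat A) l \<Longrightarrow> poly ((pderiv ^^ j) q) l = (deriv ^^ j) f l"
begin

definition G :: "real^'n^'n \<Rightarrow> complex^'n^'n" where
  "G M = mat_fun f (cmat M) - mat_poly q (cmat M)"

definition LG :: "real^'n^'n \<Rightarrow> complex^'n^'n" where
  "LG E = L E - mat_poly_deriv q A E"

lemma G_vector:
  assumes "P \<noteq> 0" "pact P (cmat M) w = 0"
    "\<And>l j. j < order l P \<Longrightarrow> poly ((pderiv ^^ j) r) l = (deriv ^^ j) f l"
  shows "G M *v w = pact (r - q) (cmat M) w"
  by (simp add: G_def matrix_vector_mult_diff_rdistrib mat_fun_on_vector[OF assms] pact_diff)
    (simp add: pact_def)

lemma G_zero:
  assumes "\<And>p. pact p (cmat M) w = pact p (cmat A) w"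
  shows "G M *v w = 0"
  by (subst G_vector[of "min_poly (cmat A)" M w q])
    (simp_all add: min_poly_nonzero assms pact_min_poly agree eig_index_def)

lemma G_A: "G A = 0"
  by (simp add: matrix_eq G_zero)

lemma G_has_derivative: "(G has_derivative LG) (at A)"
  unfolding G_def[abs_def] LG_def[abs_def] by (intro has_derivative_diff der mat_poly_has_derivative)

lemma linear_LG: "linear LG"
  using G_has_derivative by (rule has_derivative_linear)

lemma G_curve:
  assumes "(c has_vector_derivative E) (at 0)" "c 0 = A"
  shows "((\<lambda>t. G (c t)) has_vector_derivative LG E) (at 0)"
proof -
  have "((\<lambda>t. G (c t)) has_derivative (\<lambda>t. LG (t *\<^sub>R E))) (at 0)"
    by (rule has_derivative_compose[of c "\<lambda>t. t *\<^sub>R E" 0 UNIV G LG])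
      (use assms G_has_derivative in \<open>auto simp: has_vector_derivative_def\<close>)
  then show ?thesis by (simp add: has_vector_derivative_def linear_scale[OF linear_LG])
qed

lemma LG_eqI:
  assumes "((\<lambda>t. (1 / t) *\<^sub>R (G (A + t *\<^sub>R E) *v w)) \<longlongrightarrow> a) (at_right 0)"
  shows "LG E *v w = a"
proof -
  have "((\<lambda>t. A + t *\<^sub>R E) has_vector_derivative E) (at 0)"
    by (auto intro!: derivative_eq_intros simp: has_vector_derivative_def)
  then have "((\<lambda>t. G (A + t *\<^sub>R E)) has_vector_derivative LG E) (at 0)"
    by (intro G_curve) simp_all
  then have "((\<lambda>t. (1 / t) *\<^sub>R G (A + t *\<^sub>R E)) \<longlongrightarrow> LG E) (at_right 0)"
    by (rule vector_derivative_quotient) (simp add: G_A)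
  then have "((\<lambda>t. ((1 / t) *\<^sub>R G (A + t *\<^sub>R E)) *v w) \<longlongrightarrow> LG E *v w) (at_right 0)"
    by (rule bounded_linear.tendsto[OF bounded_bilinear.bounded_linear_left[OF bounded_bilinear_matrix_vector_mult]])
  then have "((\<lambda>t. (1 / t) *\<^sub>R (G (A + t *\<^sub>R E) *v w)) \<longlongrightarrow> LG E *v w) (at_right 0)"
    by (simp add: bounded_bilinear.scaleR_left[OF bounded_bilinear_matrix_vector_mult])
  from tendsto_unique[OF _ this assms] show ?thesis by simp
qed

text \<open>\<open>G\<close> vanishes on the matrices similar to A because it is equivariant and
  \<open>G A = 0\<close>. The commutator is the velocity of a curve in this similarity
  class.\<close>

lemma LG_commutator: "LG (A ** outer x y - outer x y ** A) = 0"
proof -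
  let ?X = "outer x y"
  define c where "c = scalar_product y x"
  \<comment> \<open>Sherman-Morrison: 1 + t X has inverse 1 - s X since X^2 = c X. The curve M below
    is the product (1 - s X) A (1 + t X), multiplied out.\<close>
  define s where "s t = t / (1 + c * t)" for t
  define M where "M t = A + t *\<^sub>R (A ** ?X) - s t *\<^sub>R (?X ** A) - (s t * t) *\<^sub>R (?X ** A ** ?X)" for t
  have "(M has_vector_derivative (A ** ?X - ?X ** A)) (at 0)"
    unfolding M_def[abs_def] s_def[abs_def]
    by (auto intro!: derivative_eq_intros simp: has_vector_derivative_def scaleR_diff_right)
  moreover have M0: "M 0 = A" by (simp add: M_def s_def)
  ultimately have 1: "((\<lambda>t. G (M t)) has_vector_derivative LG (A ** ?X - ?X ** A)) (at 0)"
    by (rule G_curve)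
  have "((\<lambda>t. 1 + c * t) \<longlongrightarrow> 1 + c * 0) (at 0)" by (intro tendsto_intros)
  then have "eventually (\<lambda>t. 1 + c * t \<noteq> 0) (at 0)" by (rule tendsto_imp_eventually_ne) simp
  moreover have "1 + c * 0 \<noteq> 0" by simp
  ultimately have "eventually (\<lambda>t. 1 + c * t \<noteq> 0) (nhds 0)" by (simp add: eventually_nhds_conv_at)
  then have "eventually (\<lambda>t. G (M t) = 0) (nhds 0)"
  proof eventually_elim
    case (elim t)
    let ?y = "cvec y" and ?x = "cvec x" and ?A = "cmat A" and ?t = "complex_of_real t"
      and ?s = "complex_of_real (s t)" and ?c = "complex_of_real c"
    define P where "P = cmat (mat 1 + t *\<^sub>R ?X)"
    have P: "P *v w = w + (?t * scalar_product ?y w) *s ?x" for w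
    proof -
      have "cmat (mat 1 :: real^'n^'n) = mat 1" by (simp add: vec_eq_iff mat_def)
      then show ?thesis by (simp add: P_def cmat_line cmat_outer)
    qed
    have yx: "scalar_product ?y ?x = ?c" by (simp add: scalar_product_cvec c_def)
    have st: "?t * (1 - ?s * ?c) - ?s = 0"
    proof -
      have "t * (1 - s t * c) - s t = 0" using elim by (simp add: s_def field_simps)
      then have "complex_of_real (t * (1 - s t * c) - s t) = 0" by simp
      then show ?thesis by simp
    qed
    have Mw: "cmat (M t) *v w = ?A *v w + (?t * scalar_product ?y w) *s (?A *v ?x)
        - (?s * (scalar_product ?y (?A *v w) + ?t * scalar_product ?y w * scalar_product ?y (?A *v ?x))) *s ?x" for w
    proof -
      have "cmat (M t) *v w = ?A *v w + ?t *s (cmat (A ** ?X) *v w) - ?s *s (cmat (?X ** A) *v w)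
         - (?s * ?t) *s (cmat (?X ** A ** ?X) *v w)"
        by (simp add: M_def cmat_line cmat_line_diff)
      also have "\<dots> = ?A *v w + ?t *s (scalar_product ?y w *s (?A *v ?x)) - ?s *s (scalar_product ?y (?A *v w) *s ?x)
         - (?s * ?t) *s ((scalar_product ?y w * scalar_product ?y (?A *v ?x)) *s ?x)"
        by (simp add: cmat_mult matrix_vector_mul_assoc[symmetric] cmat_outer matrix_vector_smult
            scalar_product_smult_right)
      finally show ?thesis by (simp add: vec_eq_iff algebra_simps)
    qed
    have tw: "P *v (cmat (M t) *v w) = ?A *v (P *v w)" for w
    proof -
      let ?a = "scalar_product ?y (?A *v w) + ?t * scalar_product ?y w * scalar_product ?y (?A *v ?x)"
      have 1: "scalar_product ?y (cmat (M t) *v w) = (1 - ?s * ?c) * ?a"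
        unfolding Mw by (simp add: scalar_product_add_right scalar_product_diff_right scalar_product_smult_right yx
            algebra_simps)
      have "P *v (cmat (M t) *v w) = ?A *v w + (?t * scalar_product ?y w) *s (?A *v ?x)
          + ((?t * (1 - ?s * ?c) - ?s) * ?a) *s ?x"
        unfolding P 1 unfolding Mw by (simp add: vec_eq_iff algebra_simps)
      also have "\<dots> = ?A *v (P *v w)" unfolding st
        by (simp add: P matrix_vector_right_distrib matrix_vector_smult)
      finally show ?thesis .
    qed
    \<comment> \<open>Injectivity of 1 + t X takes the place of the explicit inverse when the
      intertwining relation is used to cancel P.\<close>
    have inj: "w = 0" if "P *v w = 0" for w
    proof -
      have "0 = scalar_product ?y (P *v w)" using that by simp
      also have "\<dots> = (1 + ?c * ?t) * scalar_product ?y w"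
        by (simp add: P scalar_product_add_right scalar_product_smult_right yx algebra_simps)
      finally have "scalar_product ?y w = 0 \<or> 1 + ?c * ?t = 0" by auto
      moreover have "complex_of_real (1 + c * t) \<noteq> 0" using elim of_real_eq_0_iff by blast
      ultimately show ?thesis using that by (auto simp: P)
    qed
    have "G (M t) *v w = 0" for w
    proof (rule inj)
      have "P *v (G (M t) *v w) = G A *v (P *v w)"
        using mat_fun_intertwine[of P "cmat (M t)" ?A f w, OF tw] pact_intertwine[of P "cmat (M t)" ?A q w, OF tw]
        by (simp add: G_def matrix_vector_mult_diff_rdistrib matrix_vector_mult_diff_distrib pact_def)
      then show "P *v (G (M t) *v w) = 0" by (simp add: G_A)
    qed
    then show ?case by (simp add: matrix_eq)
  qed
  then have "((\<lambda>t. G (M t)) has_vector_derivative 0) (at 0) \<longleftrightarrow> ((\<lambda>_. 0) has_vector_derivative 0) (at (0 :: real))"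
    using has_vector_derivative_cong_ev[where f = "\<lambda>t. G (M t)" and g = "\<lambda>_. 0" and S = UNIV and x = 0 and f' = 0]
    by (simp add: G_A M0)
  then have "((\<lambda>t. G (M t)) has_vector_derivative 0) (at 0)" by simp
  from vector_derivative_unique_at[OF 1 this] show ?thesis .
qed

text \<open>The kernel of \<open>LG\<close> contains all commutators with \<open>A\<close>, so a matrix \<open>D\<close> orthogonal
  to the kernel commutes with the transpose of \<open>A\<close>, hence respects the generalized eigenspaces.\<close>

lemma LG_zero:
  assumes "\<And>D l x y. (\<And>E. LG E = 0 \<Longrightarrow> E \<bullet> D = 0) \<Longrightarrow>
      (\<And>w. transpose (cmat A) *v (cmat D *v w) = cmat D *v (transpose (cmat A) *v w)) \<Longrightarrow>
      x \<in> geig (cmat A) l \<Longrightarrow> y \<in> geig (transpose (cmat A)) l \<Longrightarrow> scalar_product x (cmat D *v y) = 0"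
  shows "LG E = 0"
proof (rule ccontr)
  assume "LG E \<noteq> 0"
  have sub: "subspace {E. LG E = 0}"
    using linear_LG by (auto simp: subspace_def linear_add linear_scale linear_0)
  then have "span {E. LG E = 0} \<noteq> UNIV" using \<open>LG E \<noteq> 0\<close> by (auto simp: span_eq_iff[THEN iffD2])
  then obtain D where "D \<noteq> 0" and D: "\<And>E. LG E = 0 \<Longrightarrow> E \<bullet> D = 0"
    using span_not_UNIV_orthogonal[of "{E. LG E = 0}"] span_eq_iff[THEN iffD2, OF sub]
    by (auto simp: inner_commute)
  have "transpose A *v (D *v y) = D *v (transpose A *v y)" for y
  proof (rule scalar_product_ext)
    fix x
    have "A ** outer x y - outer x y ** A = outer (A *v x) y - outer x (transpose A *v y)"
      by (simp add: vec_eq_iff outer_def matrix_matrix_mult_def matrix_vector_mult_def transpose_def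
          sum_distrib_left sum_distrib_right mult_ac)
    then have "(outer (A *v x) y - outer x (transpose A *v y)) \<bullet> D = 0" using D LG_commutator by metis
    then show "scalar_product x (transpose A *v (D *v y)) = scalar_product x (D *v (transpose A *v y))"
      by (simp add: inner_diff_left inner_outer scalar_product_transpose)
  qed
  then have "transpose A ** D = D ** transpose A" by (simp add: matrix_eq matrix_vector_mul_assoc)
  then have "cmat (transpose A ** D) *v w = cmat (D ** transpose A) *v w" for w by simp
  then have comm: "transpose (cmat A) *v (cmat D *v w) = cmat D *v (transpose (cmat A) *v w)" for w
    by (simp add: cmat_mult cmat_transpose matrix_vector_mul_assoc)
  have xy: "scalar_product x (cmat D *v y) = 0" for x y
  proof (rule geig_span[of "cmat A" "\<lambda>x. scalar_product x (cmat D *v y) = 0"])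
    fix l x assume x: "x \<in> geig (cmat A) l"
    show "scalar_product x (cmat D *v y) = 0"
    proof (rule geig_span[of "transpose (cmat A)" "\<lambda>y. scalar_product x (cmat D *v y) = 0"])
      fix m y assume y: "y \<in> geig (transpose (cmat A)) m"
      show "scalar_product x (cmat D *v y) = 0"
      proof (cases "m = l")
        case False
        have "cmat D *v y \<in> geig (transpose (cmat A)) m" by (rule geig_commuting[OF comm[symmetric] y])
        then show ?thesis using geig_orthogonal[OF x] False by metis
      qed (use assms[OF D comm x] y in auto)
    qed (simp add: matrix_vector_right_distrib scalar_product_add_right)
  qed (simp add: scalar_product_add_left)
  have "cmat D = 0" by (simp add: matrix_eq) (metis scalar_product_ext scalar_product_zero_right xy)
  then have "D = 0" by (simp add: vec_eq_iff)
  with \<open>D \<noteq> 0\<close> show False by blast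
qed

end

subsection \<open>Semisimple eigenvalues\<close>

lemma tendsto_smult_zero:
  fixes v :: "complex^'n"
  assumes "(g \<longlongrightarrow> 0) F"
  shows "((\<lambda>t. g t *s v) \<longlongrightarrow> 0) F"
  by (rule vec_tendstoI) (use tendsto_mult_left_zero[OF assms] in simp)

definition vre :: "complex^'n \<Rightarrow> real^'n" where "vre v = (\<chi> i. Re (v $ i))"
definition vim :: "complex^'n \<Rightarrow> real^'n" where "vim v = (\<chi> i. Im (v $ i))"

lemma vre_vim: "v = cvec (vre v) + \<i> *s cvec (vim v)"
  by (simp add: vec_eq_iff cvec_def vre_def vim_def complex_eq)

lemma cvec_vre: "cvec (vre v) = (1 / 2) *s (v + vcnj v)"
  and cvec_vim: "cvec (vim v) = (- \<i> / 2) *s (v + (- 1) *s vcnj v)"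
  by (simp_all add: vec_eq_iff cvec_def vre_def vim_def vcnj_def complex_eq_iff)

lemma geig_real_parts:
  assumes "v \<in> geig (cmat A) (complex_of_real m)"
  shows "cvec (vre v) \<in> geig (cmat A) (of_real m)" "cvec (vim v) \<in> geig (cmat A) (of_real m)"
  unfolding cvec_vre cvec_vim by (intro geig_add geig_smult; use geig_vcnj[OF assms] assms in simp)+

lemma cvec_add: "cvec (x + y) = cvec x + cvec y"
  by (simp add: vec_eq_iff cvec_def)

text \<open>For a real eigenvalue the real and imaginary parts of a dual vector stay in the
  generalized eigenspace, and one of them must pair nontrivially with x.\<close>

lemma geig_dual_nonzero_real:
  assumes "cvec x \<in> geig (cmat A) (complex_of_real m)" "x \<noteq> 0"
  shows "\<exists>y. cvec y \<in> geig (cmat (transpose A)) (of_real m) \<and> scalar_product x y \<noteq> 0"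
proof -
  obtain y where y: "y \<in> geig (transpose (cmat A)) (of_real m)" "scalar_product (cvec x) y \<noteq> 0"
    using geig_dual_nonzero[OF assms(1)] assms(2) by auto
  have "scalar_product (cvec x) y = of_real (scalar_product x (vre y)) + \<i> * of_real (scalar_product x (vim y))"
    by (subst vre_vim[of y])
      (simp add: scalar_product_add_right scalar_product_smult_right scalar_product_cvec)
  then have "scalar_product x (vre y) \<noteq> 0 \<or> scalar_product x (vim y) \<noteq> 0" using y(2) by auto
  then show ?thesis using geig_real_parts[of y "transpose A" m] y(1) by (auto simp: cmat_transpose)
qed

lemma scaleR_smult_assoc: "t *\<^sub>R (c *s (v :: complex^'n)) = (t *\<^sub>R c) *s v"
  by (simp add: vec_eq_iff)

lemma order_linear_factor: "order a [:- m, 1:] = (if a = m then 1 else 0)" for m :: complex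
  using order_power_n_n[of m 1] by (auto intro!: order_0I)

text \<open>An eigenvector is annihilated by X - l, so a constant interpolates; no regularity of f
  at l enters.\<close>

lemma mat_fun_eigenvector:
  assumes "M *v x = l *s x"
  shows "mat_fun f M *v x = f l *s x"
proof -
  have "pact [:- l, 1:] M x = 0" unfolding pact_linear_factor assms by simp
  then have "mat_fun f M *v x = pact [:f l:] M x"
    by (rule mat_fun_on_vector[rotated]) (auto simp: order_linear_factor split: if_splits)
  then show ?thesis by simp
qed

lemma geig_index_1:
  assumes "eig_index M l = 1" "x \<in> geig M l"
  shows "M *v x = l *s x"
  using assms geig_eig_index[of x M l] by (simp add: pact_linear_factor)

lemma geig_transpose_index_1:
  assumes "eig_index M l = 1" "y \<in> geig (transpose M) l"
  shows "transpose M *v y = l *s y"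
  using geig_transpose[OF assms(2)] assms(1) by (simp add: pact_linear_factor)

context interpolation
begin

text \<open>On an A-invariant subspace killed by E the matrices A + t E all act like A. This leaves
  only a few complementary directions to check for each test perturbation.\<close>

lemma LG_invariant:
  assumes "\<And>v. v \<in> U \<Longrightarrow> cmat A *v v \<in> U" "\<And>v w. v \<in> U \<Longrightarrow> w \<in> U \<Longrightarrow> v + w \<in> U"
    "\<And>c v. v \<in> U \<Longrightarrow> c *s v \<in> U" "\<And>v. v \<in> U \<Longrightarrow> cmat E *v v = 0" "w \<in> U"
  shows "LG E *v w = 0"
proof (rule LG_eqI)
  have "G (A + t *\<^sub>R E) *v w = 0" for t
    by (rule G_zero, rule pact_cong_invariant[of U]) (use assms in \<open>auto simp: cmat_line\<close>)
  then show "((\<lambda>t. (1 / t) *\<^sub>R (G (A + t *\<^sub>R E) *v w)) \<longlongrightarrow> 0) (at_right 0)" by simp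
qed

lemma G_eigenvector:
  assumes "cmat M *v x = l *s x"
  shows "G M *v x = (f l - poly q l) *s x"
  unfolding G_def matrix_vector_mult_diff_rdistrib mat_fun_eigenvector[OF assms] pact_def[symmetric]
    pact_eigen[OF assms] by (simp add: vec.scale_left_diff_distrib)

lemma LG_eigenvector:
  assumes "cmat A *v x = l *s x" "cmat E *v x = c *s x"
    "((\<lambda>t. f (l + of_real t * c) - poly q (l + of_real t * c)) has_vector_derivative 0) (at 0)"
    "f l = poly q l"
  shows "LG E *v x = 0"
proof (rule LG_eqI)
  have "G (A + t *\<^sub>R E) *v x = (f (l + of_real t * c) - poly q (l + of_real t * c)) *s x" for t
    by (rule G_eigenvector) (simp add: cmat_line assms(1,2) vec_eq_iff algebra_simps)
  moreover have "((\<lambda>t. ((1 / t) *\<^sub>R (f (l + of_real t * c) - poly q (l + of_real t * c))) *s x) \<longlongrightarrow> 0) (at_right 0)"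
    by (rule tendsto_smult_zero, rule vector_derivative_quotient[OF assms(3)]) (simp add: assms(4))
  ultimately show "((\<lambda>t. (1 / t) *\<^sub>R (G (A + t *\<^sub>R E) *v x)) \<longlongrightarrow> 0) (at_right 0)"
    by (simp only: scaleR_smult_assoc)
qed

text \<open>If x and y pair nontrivially, the perturbation x y^T moves the eigenvalue along the real
  axis in the direction x and leaves the invariant hyperplane orthogonal to y alone. Thus only the
  derivative of f - q along the reals is felt.\<close>

lemma orthogonal_semisimple_real:
  assumes idx: "eig_index (cmat A) (complex_of_real m) = 1"
    and d: "((\<lambda>t. f (of_real (m + t)) - poly q (of_real (m + t))) has_vector_derivative 0) (at 0)"
    and D: "\<And>E. LG E = 0 \<Longrightarrow> E \<bullet> D = 0"
    and "x \<in> geig (cmat A) (of_real m)" "y \<in> geig (transpose (cmat A)) (of_real m)"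
  shows "scalar_product x (cmat D *v y) = 0"
proof -
  let ?V = "\<lambda>x. cvec x \<in> geig (cmat A) (of_real m)"
  let ?W = "\<lambda>y. cvec y \<in> geig (cmat (transpose A)) (of_real m)"
  have fq: "f (of_real m) = poly q (of_real m)"
    using agree[of 0 "of_real m"] idx by simp
  have LG0: "LG (outer x y) = 0" if V: "?V x" and W: "?W y" and xy: "scalar_product x y \<noteq> 0" for x y
  proof -
    let ?x = "cvec x" and ?y = "cvec y" and ?c = "scalar_product y x"
    have ex: "cmat A *v ?x = of_real m *s ?x" using geig_index_1[OF idx V] .
    have ey: "transpose (cmat A) *v ?y = of_real m *s ?y"
      using geig_transpose_index_1[OF idx] W by (simp add: cmat_transpose)
    have c: "scalar_product ?y ?x = of_real ?c" by (simp add: scalar_product_cvec)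
    have c0: "?c \<noteq> 0" using xy by (simp add: scalar_product_commute)
    have U: "LG (outer x y) *v w = 0" if "scalar_product ?y w = 0" for w
    proof (rule LG_invariant[of "{w. scalar_product ?y w = 0}"])
      fix v assume "v \<in> {w. scalar_product ?y w = 0}"
      then show "cmat A *v v \<in> {w. scalar_product ?y w = 0}" "cmat (outer x y) *v v = 0"
        using scalar_product_transpose[of v "cmat A" ?y]
        by (auto simp: cmat_outer ey scalar_product_smult_right scalar_product_commute[of _ ?y])
    qed (use that in \<open>auto simp: scalar_product_add_right scalar_product_smult_right\<close>)
    have dc: "((\<lambda>t. f (of_real m + of_real t * of_real ?c) - poly q (of_real m + of_real t * of_real ?c))
        has_vector_derivative 0) (at 0)"
    proof -
      have "((\<lambda>t. t * ?c) has_vector_derivative ?c) (at 0)"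
        by (auto intro!: derivative_eq_intros simp: has_vector_derivative_def)
      from vector_diff_chain_at[OF this, of "\<lambda>t. f (of_real (m + t)) - poly q (of_real (m + t))" 0] d
      show ?thesis by (simp add: o_def)
    qed
    have X: "LG (outer x y) *v ?x = 0"
      by (rule LG_eigenvector[OF ex _ dc fq]) (simp add: cmat_outer c)
    have "LG (outer x y) *v w = 0" for w
    proof -
      let ?a = "scalar_product ?y w / of_real ?c"
      have "w = (w - ?a *s ?x) + ?a *s ?x" by simp
      then have "LG (outer x y) *v w = LG (outer x y) *v (w - ?a *s ?x) + ?a *s (LG (outer x y) *v ?x)"
        by (metis matrix_vector_right_distrib matrix_vector_smult)
      then show ?thesis using U[of "w - ?a *s ?x"] X c0
        by (simp add: scalar_product_diff_right scalar_product_smult_right c)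
    qed
    then show ?thesis by (simp add: matrix_eq)
  qed
  have B1: "scalar_product x (D *v y) = 0" if "?V x" "?W y" "scalar_product x y \<noteq> 0" for x y
    using D[OF LG0[OF that]] by (simp add: inner_outer)
  \<comment> \<open>A degenerate pair is reached by linearity: y is the difference of y + z and z,
    both of which pair nontrivially with x.\<close>
  have B: "scalar_product x (D *v y) = 0" if V: "?V x" and W: "?W y" for x y
  proof (cases "scalar_product x y = 0 \<and> x \<noteq> 0")
    case True
    then obtain z where z: "?W z" "scalar_product x z \<noteq> 0" using geig_dual_nonzero_real[OF V] by blast
    have "?W (y + z)" using geig_add[OF W z(1)] by (simp add: cvec_add)
    moreover have "scalar_product x (y + z) \<noteq> 0" using z True by (simp add: scalar_product_add_right)
    ultimately show ?thesis using B1[OF V, of "y + z"] B1[OF V z]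
      by (simp add: matrix_vector_right_distrib scalar_product_add_right)
  qed (use B1 V W in auto)
  have Bc: "scalar_product (cvec x) (cmat D *v cvec y) = 0" if "?V x" "?W y" for x y
    using B[OF that] by (simp add: cmat_cvec scalar_product_cvec)
  have y: "y \<in> geig (cmat (transpose A)) (of_real m)" using assms by (simp add: cmat_transpose)
  show ?thesis
    by (subst vre_vim[of x], subst vre_vim[of y])
      (simp add: matrix_vector_right_distrib matrix_vector_smult scalar_product_add_left scalar_product_add_right
        scalar_product_smult_left scalar_product_smult_right Bc geig_real_parts[OF y] geig_real_parts[OF assms(4)])
qed

text \<open>The real inner product sees only the real part of the pairing; replacing x by
  \<open>\<i> *s x\<close> yields the imaginary part.\<close>

lemma orthogonal_re_outer:
  assumes D: "\<And>E. LG E = 0 \<Longrightarrow> E \<bullet> D = 0"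
    and "LG (re_outer x y) = 0" "LG (re_outer (\<i> *s x) y) = 0"
  shows "scalar_product x (cmat D *v y) = 0"
  using D[OF assms(2)] D[OF assms(3)]
  by (simp add: inner_re_outer scalar_product_smult_left complex_eq_iff)

text \<open>Here the eigenvalue moves in the direction of the complex number y^T x, which can point
  anywhere, so the full complex derivative of f is required, at l and at its conjugate.\<close>

lemma orthogonal_semisimple_nonreal:
  assumes idx: "eig_index (cmat A) l = 1" and nr: "cnj l \<noteq> l"
    and d: "f field_differentiable at l" "f field_differentiable at (cnj l)"
    and q: "poly (pderiv q) l = deriv f l" "poly (pderiv q) (cnj l) = deriv f (cnj l)"
    and D: "\<And>E. LG E = 0 \<Longrightarrow> E \<bullet> D = 0"
    and "x \<in> geig (cmat A) l" "y \<in> geig (transpose (cmat A)) l"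
  shows "scalar_product x (cmat D *v y) = 0"
proof -
  have LG0: "LG (re_outer x y) = 0" if V: "x \<in> geig (cmat A) l" and W: "y \<in> geig (transpose (cmat A)) l"
    and xy: "scalar_product x y \<noteq> 0" for x y
  proof -
    let ?c = "scalar_product y x" and ?E = "re_outer x y"
    have ex: "cmat A *v x = l *s x" using geig_index_1[OF idx V] .
    have ex': "cmat A *v vcnj x = cnj l *s vcnj x" by (simp add: cmat_vcnj ex vcnj_smult)
    have ey: "transpose (cmat A) *v y = l *s y" using geig_transpose_index_1[OF idx W] .
    have ey': "transpose (cmat A) *v vcnj y = cnj l *s vcnj y"
      using ey by (metis cmat_transpose cmat_vcnj vcnj_smult)
    have V': "vcnj x \<in> geig (cmat A) (cnj l)" by (rule geig_vcnj[OF V])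
    have W': "vcnj y \<in> geig (transpose (cmat A)) (cnj l)"
      using geig_vcnj[of y "transpose A" l] W by (simp add: cmat_transpose)
    have o: "scalar_product (vcnj y) x = 0" "scalar_product y (vcnj x) = 0"
      using geig_orthogonal[OF V W'] geig_orthogonal[OF V' W] nr by (auto simp: scalar_product_commute)
    have c0: "?c \<noteq> 0" using xy by (simp add: scalar_product_commute)
    have U: "LG ?E *v w = 0" if "scalar_product y w = 0" "scalar_product (vcnj y) w = 0" for w
    proof (rule LG_invariant[of "{w. scalar_product y w = 0 \<and> scalar_product (vcnj y) w = 0}"])
      fix v assume "v \<in> {w. scalar_product y w = 0 \<and> scalar_product (vcnj y) w = 0}"
      then show "cmat A *v v \<in> {w. scalar_product y w = 0 \<and> scalar_product (vcnj y) w = 0}" "cmat ?E *v v = 0"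
        using scalar_product_transpose[of v "cmat A" y] scalar_product_transpose[of v "cmat A" "vcnj y"]
        by (auto simp: cmat_re_outer ey ey' scalar_product_smult_right
            scalar_product_commute[of _ y] scalar_product_commute[of _ "vcnj y"])
    qed (use that in \<open>auto simp: scalar_product_add_right scalar_product_smult_right\<close>)
    have dc: "((\<lambda>t. f (m + of_real t * c) - poly q (m + of_real t * c)) has_vector_derivative 0) (at 0)"
      if "f field_differentiable at m" "poly (pderiv q) m = deriv f m" for m c
    proof -
      have "(f has_field_derivative deriv f m) (at m)"
        using that by (simp add: DERIV_deriv_iff_field_differentiable)
      then have "((\<lambda>z. f z - poly q z) has_field_derivative deriv f m - poly (pderiv q) m) (at m)"
        by (intro derivative_intros poly_DERIV)
      then have g: "((\<lambda>z. f z - poly q z) has_field_derivative 0) (at (m + of_real 0 * c))"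
        using that by simp
      have h: "((\<lambda>t. m + of_real t * c) has_vector_derivative c) (at 0)"
        by (auto intro!: derivative_eq_intros simp: has_vector_derivative_def scaleR_conv_of_real)
      show ?thesis using field_vector_diff_chain_at[OF h g] by (simp add: o_def)
    qed
    have fq: "f l = poly q l" "f (cnj l) = poly q (cnj l)"
      using agree[of 0 l] agree[of 0 "cnj l"] idx by (simp_all add: eig_index_cnj)
    have X: "LG ?E *v x = 0"
      by (rule LG_eigenvector[OF ex _ dc[OF d(1) q(1)] fq(1), of _ ?c]) (simp add: cmat_re_outer o)
    have X': "LG ?E *v vcnj x = 0"
      by (rule LG_eigenvector[OF ex' _ dc[OF d(2) q(2)] fq(2), of _ "cnj ?c"])
        (simp add: cmat_re_outer o scalar_product_vcnj)
    have "LG ?E *v w = 0" for w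
    proof -
      let ?a = "scalar_product y w / ?c" and ?b = "scalar_product (vcnj y) w / cnj ?c"
      let ?w = "w - ?a *s x - ?b *s vcnj x"
      have "w = ?w + ?a *s x + ?b *s vcnj x" by simp
      then have "LG ?E *v w = LG ?E *v ?w + ?a *s (LG ?E *v x) + ?b *s (LG ?E *v vcnj x)"
        by (metis matrix_vector_right_distrib matrix_vector_smult)
      then show ?thesis using U[of ?w] X X' c0
        by (simp add: scalar_product_diff_right scalar_product_smult_right o scalar_product_vcnj)
    qed
    then show ?thesis by (simp add: matrix_eq)
  qed
  have B1: "scalar_product x (cmat D *v y) = 0"
    if "x \<in> geig (cmat A) l" "y \<in> geig (transpose (cmat A)) l" "scalar_product x y \<noteq> 0" for x y
    by (rule orthogonal_re_outer[OF D]) (use that in \<open>auto intro!: LG0 geig_smult simp: scalar_product_smult_left\<close>)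
  show ?thesis
  proof (cases "scalar_product x y = 0 \<and> x \<noteq> 0")
    case True
    then obtain z where z: "z \<in> geig (transpose (cmat A)) l" "scalar_product x z \<noteq> 0"
      using geig_dual_nonzero assms(8) by blast
    moreover have "scalar_product x (y + z) \<noteq> 0" using z True by (simp add: scalar_product_add_right)
    ultimately show ?thesis using B1[OF assms(8), of "y + z"] B1[OF assms(8) z] geig_add[OF assms(9) z(1)]
      by (simp add: matrix_vector_right_distrib scalar_product_add_right)
  qed (use B1 assms in auto)
qed

end

subsection \<open>Real eigenvalues of index two\<close>

lemma cvec_0 [simp]: "cvec 0 = 0"
  by (simp add: vec_eq_iff cvec_def)

lemma pact_jordan:
  assumes "M *v z = l *s z + x" "M *v x = l *s x"
  shows "pact p M z = poly p l *s z + poly (pderiv p) l *s x"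
  by (induct p)
    (simp_all add: pact_pCons pderiv_pCons matrix_vector_right_distrib matrix_vector_smult assms,
      simp add: vec_eq_iff algebra_simps)

text \<open>The linear Hermite interpolant at a double node. \<open>deriv\<close> is total, so the
  formula presupposes no differentiability; that comes separately from f being defined on the
  spectrum.\<close>

lemma mat_fun_jordan:
  assumes "M *v z = l *s z + x" "M *v x = l *s x"
  shows "mat_fun f M *v z = f l *s z + deriv f l *s x"
proof -
  let ?r = "[:f l - l * deriv f l, deriv f l:]"
  have "pact ([:- l, 1:] ^ 2) M z = 0"
    unfolding power2_eq_square pact_mult pact_linear_factor
    by (simp add: assms matrix_vector_smult matrix_vector_mult_diff_distrib matrix_vector_right_distrib)
  then have "mat_fun f M *v z = pact ?r M z"
  proof (rule mat_fun_on_vector[rotated])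
    fix a j assume j: "j < order a ([:- l, 1:] ^ 2)"
    have "order a ([:- l, 1:] ^ 2) = 2 * order a [:- l, 1:]"
      unfolding power2_eq_square by (subst order_mult) auto
    then have "a = l" "j = 0 \<or> j = 1" using j by (auto simp: order_linear_factor split: if_splits)
    then show "poly ((pderiv ^^ j) ?r) a = (deriv ^^ j) f a" by (auto simp: pderiv_pCons)
  qed simp
  also have "\<dots> = f l *s z + deriv f l *s x"
    unfolding pact_jordan[OF assms] by (simp add: pderiv_pCons)
  finally show ?thesis .
qed

text \<open>The source of regularity for f: matrix entries along a line are differentiable, and for
  suitable lines they are expressions in f alone.\<close>

lemma mat_fun_line_derivative:
  fixes A :: "real^'n^'n"
  assumes "((\<lambda>M. mat_fun f (cmat M)) has_derivative L) (at A)"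
  shows "((\<lambda>t. scalar_product y (mat_fun f (cmat (A + t *\<^sub>R E)) *v w)) has_vector_derivative
    scalar_product y (L E *v w)) (at 0)"
proof -
  have lin: "L (t *\<^sub>R E) = t *\<^sub>R L E" for t
    using has_derivative_linear[OF assms] by (rule linear_scale)
  have "((\<lambda>t. A + t *\<^sub>R E) has_derivative (\<lambda>t. t *\<^sub>R E)) (at 0)"
    by (auto intro!: derivative_eq_intros)
  then have "((\<lambda>t. mat_fun f (cmat (A + t *\<^sub>R E))) has_derivative (\<lambda>t. L (t *\<^sub>R E))) (at 0)"
    by (rule has_derivative_compose) (use assms in simp)
  then have d: "((\<lambda>t. mat_fun f (cmat (A + t *\<^sub>R E))) has_vector_derivative L E) (at 0)"
    by (simp add: has_vector_derivative_def lin)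
  have "bounded_linear (\<lambda>X :: complex^'n^'n. scalar_product y (X *v w))"
    unfolding linear_conv_bounded_linear[symmetric]
  proof (rule linearI)
    fix r and X :: "complex^'n^'n"
    show "scalar_product y ((r *\<^sub>R X) *v w) = r *\<^sub>R scalar_product y (X *v w)"
      unfolding bounded_bilinear.scaleR_left[OF bounded_bilinear_matrix_vector_mult] scaleR_eq_smult
        scalar_product_smult_right by (simp add: scaleR_conv_of_real)
  qed (simp add: matrix_vector_mult_add_rdistrib scalar_product_add_right)
  from bounded_linear.has_vector_derivative[OF this d] show ?thesis .
qed

text \<open>Two Jordan chains of length two, headed by z for A and by y for the transpose,
  normalized so that (y, y') becomes the basis dual to (x, z).\<close>

definition jordan_pair :: "real^'n^'n \<Rightarrow> real \<Rightarrow> real^'n \<Rightarrow> real^'n \<Rightarrow> bool" where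
  "jordan_pair A m z y \<longleftrightarrow>
     A *v (A *v z - m *s z) = m *s (A *v z - m *s z) \<and>
     transpose A *v (transpose A *v y - m *s y) = m *s (transpose A *v y - m *s y) \<and>
     scalar_product y (A *v z - m *s z) = 1 \<and> scalar_product y z = 0"

locale jordan =
  fixes A :: "real^'n^'n" and m :: real and z y :: "real^'n"
  assumes pair: "jordan_pair A m z y"
begin

definition x where "x = A *v z - m *s z"
definition y' where "y' = transpose A *v y - m *s y"
text \<open>On the block spanned by x and z, P is the identity and shifts the eigenvalue to m + t. R
  sends x to z and z to 0, so A + t R has the eigenvalues m + sqrt t and m - sqrt t there.\<close>

definition P where "P = outer x y + outer z y'"
definition R where "R = outer z y"

lemma real_relations:
  "A *v z = m *s z + x" "A *v x = m *s x" "transpose A *v y = m *s y + y'" "transpose A *v y' = m *s y'"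
  "scalar_product y x = 1" "scalar_product y z = 0" "scalar_product y' z = 1" "scalar_product y' x = 0"
proof -
  show Az: "A *v z = m *s z + x" and Ax: "A *v x = m *s x" and "transpose A *v y = m *s y + y'"
    "transpose A *v y' = m *s y'" and yx: "scalar_product y x = 1" and yz: "scalar_product y z = 0"
    using pair by (simp_all add: jordan_pair_def x_def y'_def)
  have "scalar_product y' w = scalar_product y (A *v w) - m * scalar_product y w" for w
    using scalar_product_transpose[of w A y] scalar_product_commute[of w "transpose A *v y"]
      scalar_product_commute[of "A *v w" y]
    by (simp add: y'_def scalar_product_diff_left scalar_product_smult_left)
  then show "scalar_product y' z = 1" "scalar_product y' x = 0"
    by (simp_all add: Az Ax scalar_product_add_right scalar_product_smult_right yx yz)
qed

lemma complex_relations: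
  "cmat A *v cvec z = of_real m *s cvec z + cvec x" "cmat A *v cvec x = of_real m *s cvec x"
  "transpose (cmat A) *v cvec y = of_real m *s cvec y + cvec y'"
  "transpose (cmat A) *v cvec y' = of_real m *s cvec y'"
  by (simp_all add: cmat_cvec cmat_transpose[symmetric] real_relations cvec_add cvec_smult)

lemma complex_products:
  "scalar_product (cvec y) (cvec x) = 1" "scalar_product (cvec y) (cvec z) = 0"
  "scalar_product (cvec y') (cvec z) = 1" "scalar_product (cvec y') (cvec x) = 0"
  by (simp_all add: scalar_product_cvec real_relations)

lemma cmat_P: "cmat P *v w = scalar_product (cvec y) w *s cvec x + scalar_product (cvec y') w *s cvec z"
  by (simp add: P_def cmat_add matrix_vector_mult_add_rdistrib cmat_outer)

lemma line_P:
  "cmat (A + t *\<^sub>R P) *v cvec z = (of_real (m + t)) *s cvec z + cvec x"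
  "cmat (A + t *\<^sub>R P) *v cvec x = (of_real (m + t)) *s cvec x"
  unfolding cmat_line cmat_P complex_relations complex_products
  by (simp_all add: vec_eq_iff algebra_simps)

lemma line_R:
  assumes "s\<^sup>2 = t"
  shows "cmat (A + t *\<^sub>R R) *v (cvec x + of_real s *s cvec z) = of_real (m + s) *s (cvec x + of_real s *s cvec z)"
  unfolding cmat_line R_def cmat_outer matrix_vector_right_distrib matrix_vector_smult complex_relations
    scalar_product_add_right scalar_product_smult_right complex_products assms[symmetric]
  by (simp add: vec_eq_iff algebra_simps power2_eq_square)

text \<open>Stated for an arbitrary H acting on eigenvectors through h, because it is applied both
  to the function of the matrix and to the difference \<open>G\<close>. The vectors x and z are
  recovered from the eigenvectors x + s z and x - s z with s = sqrt t.\<close>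

lemma mat_fun_line_R:
  assumes H: "\<And>w l. cmat (A + t *\<^sub>R R) *v w = l *s w \<Longrightarrow> H *v w = h l *s w" and t: "t > 0"
  shows "H *v cvec z = ((h (of_real (m + sqrt t)) - h (of_real (m - sqrt t))) / (2 * of_real (sqrt t))) *s cvec x
      + ((h (of_real (m + sqrt t)) + h (of_real (m - sqrt t))) / 2) *s cvec z"
    and "H *v cvec x = ((h (of_real (m + sqrt t)) + h (of_real (m - sqrt t))) / 2) *s cvec x
      + (of_real (sqrt t) * (h (of_real (m + sqrt t)) - h (of_real (m - sqrt t))) / 2) *s cvec z"
proof -
  define s where "s = complex_of_real (sqrt t)"
  define a b where "a = h (of_real (m + sqrt t))" and "b = h (of_real (m - sqrt t))"
  have s0: "s \<noteq> 0" using t by (simp add: s_def)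
  have 1: "H *v (cvec x + s *s cvec z) = a *s (cvec x + s *s cvec z)"
    unfolding a_def s_def by (rule H, rule line_R) (use t in simp)
  have 2: "H *v (cvec x - s *s cvec z) = b *s (cvec x - s *s cvec z)"
  proof -
    have "cmat (A + t *\<^sub>R R) *v (cvec x + of_real (- sqrt t) *s cvec z)
        = of_real (m - sqrt t) *s (cvec x + of_real (- sqrt t) *s cvec z)"
      using line_R[of "- sqrt t" t] t by simp
    then have "H *v (cvec x + of_real (- sqrt t) *s cvec z) = b *s (cvec x + of_real (- sqrt t) *s cvec z)"
      unfolding b_def by (rule H)
    then show ?thesis by (simp add: s_def)
  qed
  have "H *v cvec x = H *v ((1 / 2) *s ((cvec x + s *s cvec z) + (cvec x - s *s cvec z)))"
    by (rule arg_cong[where f = "(*v) H"]) (simp add: vec_eq_iff)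
  also have "\<dots> = (1 / 2) *s (a *s (cvec x + s *s cvec z) + b *s (cvec x - s *s cvec z))"
    by (simp only: matrix_vector_smult matrix_vector_right_distrib[of H "cvec x + s *s cvec z"] 1 2)
  finally show "H *v cvec x = ((h (of_real (m + sqrt t)) + h (of_real (m - sqrt t))) / 2) *s cvec x
      + (of_real (sqrt t) * (h (of_real (m + sqrt t)) - h (of_real (m - sqrt t))) / 2) *s cvec z"
    unfolding a_def[symmetric] b_def[symmetric] s_def[symmetric]
    by (simp add: vec_eq_iff add_divide_distrib diff_divide_distrib algebra_simps)
  have "H *v cvec z = H *v ((1 / (2 * s)) *s ((cvec x + s *s cvec z) - (cvec x - s *s cvec z)))"
    using s0 by (intro arg_cong[where f = "(*v) H"]) (simp add: vec_eq_iff)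
  also have "\<dots> = (1 / (2 * s)) *s (a *s (cvec x + s *s cvec z) - b *s (cvec x - s *s cvec z))"
    by (simp only: matrix_vector_smult matrix_vector_mult_diff_distrib[of H "cvec x + s *s cvec z"] 1 2)
  finally show "H *v cvec z = ((h (of_real (m + sqrt t)) - h (of_real (m - sqrt t))) / (2 * of_real (sqrt t))) *s cvec x
      + ((h (of_real (m + sqrt t)) + h (of_real (m - sqrt t))) / 2) *s cvec z"
    unfolding a_def[symmetric] b_def[symmetric] s_def[symmetric]
    using s0 by (simp add: vec_eq_iff add_divide_distrib diff_divide_distrib algebra_simps)
qed

text \<open>The off-diagonal entry of the function at the shifted block is \<open>deriv f\<close> at
  m + t, so differentiability of the matrix function passes to \<open>deriv f\<close> along the
  reals.\<close>

lemma second_derivative: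
  assumes "((\<lambda>M. mat_fun f (cmat M)) has_derivative L) (at A)"
  shows "((\<lambda>t. deriv f (of_real (m + t))) has_vector_derivative scalar_product (cvec y) (L P *v cvec z)) (at 0)"
proof -
  have "scalar_product (cvec y) (mat_fun f (cmat (A + t *\<^sub>R P)) *v cvec z) = deriv f (of_real (m + t))" for t
    unfolding mat_fun_jordan[OF line_P]
    by (simp add: scalar_product_add_right scalar_product_smult_right complex_products)
  then show ?thesis using mat_fun_line_derivative[OF assms, of "cvec y" P "cvec z"] by simp
qed

text \<open>The same off-diagonal entry along R is the symmetric difference quotient of f with step
  sqrt t for t > 0, and \<open>deriv f\<close> at m for t = 0.\<close>

lemma odd_difference_quotient:
  assumes "((\<lambda>M. mat_fun f (cmat M)) has_derivative L) (at A)"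
  shows "((\<lambda>t. (1 / t) *\<^sub>R ((f (of_real (m + sqrt t)) - f (of_real (m - sqrt t))) / (2 * of_real (sqrt t))
     - deriv f (of_real m))) \<longlongrightarrow> scalar_product (cvec y) (L R *v cvec z)) (at_right 0)"
proof -
  let ?g = "\<lambda>t. scalar_product (cvec y) (mat_fun f (cmat (A + t *\<^sub>R R)) *v cvec z)"
  have g: "?g t = (f (of_real (m + sqrt t)) - f (of_real (m - sqrt t))) / (2 * of_real (sqrt t))" if "t > 0" for t
    using mat_fun_line_R(1)[of t "mat_fun f (cmat (A + t *\<^sub>R R))" f, OF mat_fun_eigenvector that]
    by (simp add: scalar_product_add_right scalar_product_smult_right complex_products)
  have g0: "?g 0 = deriv f (of_real m)"
    using mat_fun_jordan[OF complex_relations(1,2), of f]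
    by (simp add: scalar_product_add_right scalar_product_smult_right complex_products)
  have "((\<lambda>t. ?g t - ?g 0) has_vector_derivative scalar_product (cvec y) (L R *v cvec z)) (at 0)"
    using has_vector_derivative_diff[OF mat_fun_line_derivative[OF assms, of "cvec y" R "cvec z"] has_vector_derivative_const]
    by simp
  from vector_derivative_quotient[OF this]
  have "((\<lambda>t. (1 / t) *\<^sub>R (?g t - ?g 0)) \<longlongrightarrow> scalar_product (cvec y) (L R *v cvec z)) (at_right 0)" by simp
  then show ?thesis
    by (rule Lim_transform_eventually) (simp only: g0, simp add: eventually_at_filter g)
qed

end

lemma ex_jordan_pair:
  assumes "eig_index (cmat A) (complex_of_real m) = 2"
  shows "\<exists>z. cvec z \<in> geig (cmat A) (of_real m) \<and> A *v z - m *s z \<noteq> 0"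
proof -
  have "eig_index (cmat A) (complex_of_real m) = Suc 1" using assms by simp
  then obtain w where w: "pact ([:- of_real m, 1:] ^ Suc 1) (cmat A) w = 0"
    "pact ([:- of_real m, 1:] ^ 1) (cmat A) w \<noteq> 0" by (rule eig_index_attained)
  then have wg: "w \<in> geig (cmat A) (of_real m)" by (blast intro: geigI)
  have "cmat A *v w - of_real m *s w \<noteq> 0" using w(2) by (simp add: pact_linear_factor)
  moreover have "cmat A *v (cvec a + \<i> *s cvec b) - of_real m *s (cvec a + \<i> *s cvec b)
      = cvec (A *v a - m *s a) + \<i> *s cvec (A *v b - m *s b)" for a b
    by (simp add: matrix_vector_right_distrib matrix_vector_smult cmat_cvec cvec_diff cvec_smult)
  from this[of "vre w" "vim w", folded vre_vim]
  have "cmat A *v w - of_real m *s w = cvec (A *v vre w - m *s vre w) + \<i> *s cvec (A *v vim w - m *s vim w)" .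
  ultimately have "A *v vre w - m *s vre w \<noteq> 0 \<or> A *v vim w - m *s vim w \<noteq> 0" by auto
  then show ?thesis using geig_real_parts[OF wg] by blast
qed

lemma geig_index_2:
  assumes "eig_index (cmat A) (complex_of_real m) = 2"
  shows "cvec z \<in> geig (cmat A) (of_real m) \<Longrightarrow> A *v (A *v z - m *s z) = m *s (A *v z - m *s z)"
    and "cvec z \<in> geig (transpose (cmat A)) (of_real m) \<Longrightarrow>
      transpose A *v (transpose A *v z - m *s z) = m *s (transpose A *v z - m *s z)"
proof -
  have *: "A *v (A *v z - m *s z) = m *s (A *v z - m *s z)"
    if "pact ([:- complex_of_real m, 1:] ^ 2) (cmat A) (cvec z) = 0" for A :: "real^'n^'n" and z
  proof -
    have "cmat A *v (cmat A *v cvec z - of_real m *s cvec z) - of_real m *s (cmat A *v cvec z - of_real m *s cvec z) = 0"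
      using that by (simp only: power2_eq_square pact_mult pact_linear_factor)
    then have "cvec (A *v (A *v z - m *s z) - m *s (A *v z - m *s z)) = 0"
      by (simp only: cmat_cvec cvec_smult[symmetric] cvec_diff[symmetric])
    then show ?thesis by simp
  qed
  show "cvec z \<in> geig (cmat A) (of_real m) \<Longrightarrow> A *v (A *v z - m *s z) = m *s (A *v z - m *s z)"
    using *[of A z] geig_eig_index[of "cvec z" "cmat A"] assms by simp
  assume "cvec z \<in> geig (transpose (cmat A)) (of_real m)"
  from geig_transpose[OF this] have "pact ([:- complex_of_real m, 1:] ^ 2) (cmat (transpose A)) (cvec z) = 0"
    using assms by (simp add: cmat_transpose)
  then show "transpose A *v (transpose A *v z - m *s z) = m *s (transpose A *v z - m *s z)" by (rule *)
qed

lemma ex_normalized_jordan_pair: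
  assumes idx: "eig_index (cmat A) (complex_of_real m) = 2"
    and V: "cvec z \<in> geig (cmat A) (of_real m)" and W: "cvec y \<in> geig (cmat (transpose A)) (of_real m)"
    and nz: "scalar_product y (A *v z - m *s z) \<noteq> 0"
  obtains w a c where "jordan_pair A m z w" "y = c *s w + a *s (transpose A *v w - m *s w)"
proof -
  define N where "N z = A *v z - m *s z" for z
  define c where "c = scalar_product y (N z)"
  define u where "u = transpose A *v y - m *s y"
  define a where "a = scalar_product y z"
  \<comment> \<open>Since u pairs to c with z and to 0 with N z, subtracting (a / c) u removes the
    pairing with z, and dividing by c normalizes the pairing with N z to 1.\<close>
  define w where "w = (1 / c) *s (y - (a / c) *s u)"
  have Nz: "A *v N z = m *s N z" unfolding N_def by (rule geig_index_2(1)[OF idx V])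
  have u: "transpose A *v u = m *s u"
    unfolding u_def by (rule geig_index_2(2)[OF idx]) (use W in \<open>simp add: cmat_transpose\<close>)
  have ud: "scalar_product u v = scalar_product y (N v)" for v
    using scalar_product_transpose[of v A y] scalar_product_commute[of v "transpose A *v y"]
      scalar_product_commute[of "A *v v" y]
    by (simp add: u_def N_def scalar_product_diff_left scalar_product_diff_right scalar_product_smult_left
        scalar_product_smult_right)
  have uN: "scalar_product u (N z) = 0" unfolding ud by (simp add: N_def[of "N z"] Nz)
  have c0: "c \<noteq> 0" using nz by (simp add: c_def N_def)
  have wN: "transpose A *v w - m *s w = (1 / c) *s u"
  proof -
    have "transpose A *v w - m *s w = (1 / c) *s ((transpose A *v y - m *s y) - (a / c) *s (transpose A *v u - m *s u))"
      by (simp add: w_def vector_scalar_commute matrix_vector_mult_diff_distrib)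
    then show ?thesis by (simp add: u u_def[symmetric])
  qed
  show ?thesis
  proof (rule that)
    show "jordan_pair A m z w"
      unfolding jordan_pair_def wN
      using Nz u uN c0
      by (simp add: N_def[symmetric] vector_scalar_commute w_def scalar_product_smult_left scalar_product_diff_left
          c_def[symmetric] a_def[symmetric] ud)
    show "y = c *s w + a *s (transpose A *v w - m *s w)"
      unfolding wN using c0 by (simp add: w_def vec_eq_iff)
  qed
qed

context interpolation
begin

text \<open>H0 and H1 make \<open>LG\<close> vanish on the shift P of a block. H2 and H3 control the
  even and the odd part of f - q at m + sqrt t and m - sqrt t, which is what the splitting R
  needs.\<close>

lemma orthogonal_index_2:
  assumes idx: "eig_index (cmat A) (complex_of_real m) = 2"
    and H0: "((\<lambda>t. f (of_real (m + t)) - poly q (of_real (m + t))) has_vector_derivative 0) (at 0)"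
    and H1: "((\<lambda>t. deriv f (of_real (m + t)) - poly (pderiv q) (of_real (m + t))) has_vector_derivative 0) (at 0)"
    and H2: "((\<lambda>t. (1 / t) *\<^sub>R ((f (of_real (m + sqrt t)) - poly q (of_real (m + sqrt t)))
        + (f (of_real (m - sqrt t)) - poly q (of_real (m - sqrt t))))) \<longlongrightarrow> 0) (at_right 0)"
    and H3: "((\<lambda>t. (1 / t) *\<^sub>R (((f (of_real (m + sqrt t)) - poly q (of_real (m + sqrt t)))
        - (f (of_real (m - sqrt t)) - poly q (of_real (m - sqrt t)))) / (2 * of_real (sqrt t)))) \<longlongrightarrow> 0) (at_right 0)"
    and D: "\<And>E. LG E = 0 \<Longrightarrow> E \<bullet> D = 0"
    and comm: "\<And>w. transpose (cmat A) *v (cmat D *v w) = cmat D *v (transpose (cmat A) *v w)"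
    and vw: "v \<in> geig (cmat A) (of_real m)" "w \<in> geig (transpose (cmat A)) (of_real m)"
  shows "scalar_product v (cmat D *v w) = 0"
proof -
  let ?V = "\<lambda>x. cvec x \<in> geig (cmat A) (of_real m)"
  let ?W = "\<lambda>y. cvec y \<in> geig (cmat (transpose A)) (of_real m)"
  let ?h = "\<lambda>w. f w - poly q w"
  have commr: "transpose A *v (D *v w) = D *v (transpose A *v w)" for w
  proof -
    have "cvec (transpose A *v (D *v w)) = cvec (D *v (transpose A *v w))"
      using comm[of "cvec w"] by (simp add: cmat_cvec cmat_transpose[symmetric])
    then show ?thesis by simp
  qed
  have fq: "f (of_real m) = poly q (of_real m)" "deriv f (of_real m) = poly (pderiv q) (of_real m)"
    using agree[of 0 "of_real m"] agree[of 1 "of_real m"] idx by simp_all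
  have pairs: "scalar_product z (D *v y) = 0 \<and> scalar_product z (D *v (transpose A *v y - m *s y)) = 0"
    if jp: "jordan_pair A m z y" for z y
  proof -
    interpret jordan A m z y by unfold_locales (rule jp)
    have U: "LG E *v w = 0" if w: "scalar_product (cvec y) w = 0" "scalar_product (cvec y') w = 0"
      and E: "\<And>w. scalar_product (cvec y) w = 0 \<Longrightarrow> scalar_product (cvec y') w = 0 \<Longrightarrow> cmat E *v w = 0" for E w
    proof (rule LG_invariant[of "{w. scalar_product (cvec y) w = 0 \<and> scalar_product (cvec y') w = 0}"])
      fix v assume v: "v \<in> {w. scalar_product (cvec y) w = 0 \<and> scalar_product (cvec y') w = 0}"
      then show "cmat E *v v = 0" by (auto intro: E)
      show "cmat A *v v \<in> {w. scalar_product (cvec y) w = 0 \<and> scalar_product (cvec y') w = 0}"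
        using v scalar_product_transpose[of v "cmat A" "cvec y"] scalar_product_transpose[of v "cmat A" "cvec y'"]
        by (simp add: complex_relations scalar_product_add_right scalar_product_smult_right
            scalar_product_commute[of _ "cvec y"] scalar_product_commute[of _ "cvec y'"])
    qed (use w in \<open>auto simp: scalar_product_add_right scalar_product_smult_right\<close>)
    have zeroI: "LG E = 0"
      if E: "\<And>w. scalar_product (cvec y) w = 0 \<Longrightarrow> scalar_product (cvec y') w = 0 \<Longrightarrow> cmat E *v w = 0"
        and X: "LG E *v cvec x = 0" and Z: "LG E *v cvec z = 0" for E
    proof -
      have "LG E *v w = 0" for w
      proof -
        let ?a = "scalar_product (cvec y) w" and ?b = "scalar_product (cvec y') w"
        let ?w = "w - ?a *s cvec x - ?b *s cvec z"
        have "w = ?w + ?a *s cvec x + ?b *s cvec z" by simp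
        then have "LG E *v w = LG E *v ?w + ?a *s (LG E *v cvec x) + ?b *s (LG E *v cvec z)"
          by (metis matrix_vector_right_distrib matrix_vector_smult)
        moreover have "LG E *v ?w = 0"
          by (rule U[OF _ _ E])
            (simp_all add: scalar_product_diff_right scalar_product_smult_right complex_products)
        ultimately show ?thesis by (simp add: X Z)
      qed
      then show ?thesis by (simp add: matrix_eq)
    qed
    have "LG P = 0"
    proof (rule zeroI)
      show "LG P *v cvec x = 0"
        by (rule LG_eigenvector[of _ "of_real m" _ 1])
          (use H0 fq complex_relations in \<open>simp_all add: cmat_P complex_products\<close>)
      have "G (A + t *\<^sub>R P) *v cvec z = ?h (of_real (m + t)) *s cvec z
          + (deriv f (of_real (m + t)) - poly (pderiv q) (of_real (m + t))) *s cvec x" for t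
        unfolding G_def matrix_vector_mult_diff_rdistrib mat_fun_jordan[OF line_P] pact_def[symmetric] pact_jordan[OF line_P]
        by (simp add: vec_eq_iff algebra_simps)
      moreover have "((\<lambda>t. ((1 / t) *\<^sub>R ?h (of_real (m + t))) *s cvec z
         + ((1 / t) *\<^sub>R (deriv f (of_real (m + t)) - poly (pderiv q) (of_real (m + t)))) *s cvec x) \<longlongrightarrow> 0 + 0) (at_right 0)"
        by (intro tendsto_add tendsto_smult_zero vector_derivative_quotient H0 H1) (use fq in simp_all)
      ultimately have lim: "((\<lambda>t. (1 / t) *\<^sub>R (G (A + t *\<^sub>R P) *v cvec z)) \<longlongrightarrow> 0) (at_right 0)"
        by (simp only: scaleR_smult_assoc scaleR_add_right add_0)
      show "LG P *v cvec z = 0" by (rule LG_eqI[OF lim])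
    qed (simp add: cmat_P)
    have "LG R = 0"
    proof (rule zeroI)
      let ?s = "\<lambda>t. of_real (sqrt t) :: complex"
      let ?p = "\<lambda>t. ?h (of_real (m + sqrt t))" and ?n = "\<lambda>t. ?h (of_real (m - sqrt t))"
      have ev: "cmat (A + t *\<^sub>R R) *v w = l *s w \<Longrightarrow> G (A + t *\<^sub>R R) *v w = ?h l *s w" for t w l
        by (rule G_eigenvector)
      have half: "((\<lambda>t. (1 / 2) * ((1 / t) *\<^sub>R (?p t + ?n t))) \<longlongrightarrow> 0) (at_right 0)"
        using tendsto_mult_left[OF H2, of "1 / 2"] by simp
      \<comment> \<open>The coefficient of z in the image of x is t times the coefficient of x in
        the image of z, so H3 covers it too.\<close>
      have root: "((\<lambda>t. (of_real t :: complex) * ((1 / t) *\<^sub>R ((?p t - ?n t) / (2 * ?s t)))) \<longlongrightarrow> 0) (at_right 0)"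
      proof -
        have "((\<lambda>t. of_real t :: complex) \<longlongrightarrow> of_real 0) (at_right 0)" by (intro tendsto_intros)
        from tendsto_mult[OF this H3] show ?thesis by simp
      qed
      have "((\<lambda>t. ((1 / t) *\<^sub>R ((?p t - ?n t) / (2 * ?s t))) *s cvec x
           + ((1 / 2) * ((1 / t) *\<^sub>R (?p t + ?n t))) *s cvec z) \<longlongrightarrow> 0 + 0) (at_right 0)"
        by (intro tendsto_add tendsto_smult_zero H3 half)
      then have limz: "((\<lambda>t. (1 / t) *\<^sub>R (G (A + t *\<^sub>R R) *v cvec z)) \<longlongrightarrow> 0 + 0) (at_right 0)"
      proof (rule Lim_transform_eventually)
        show "eventually (\<lambda>t. ((1 / t) *\<^sub>R ((?p t - ?n t) / (2 * ?s t))) *s cvec x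
           + ((1 / 2) * ((1 / t) *\<^sub>R (?p t + ?n t))) *s cvec z = (1 / t) *\<^sub>R (G (A + t *\<^sub>R R) *v cvec z)) (at_right 0)"
          unfolding eventually_at_filter
        proof (intro always_eventually allI impI)
          fix t :: real assume "t \<in> {0<..}"
          then have t: "t > 0" by simp
          have gz: "G (A + t *\<^sub>R R) *v cvec z = ((?p t - ?n t) / (2 * ?s t)) *s cvec x + ((?p t + ?n t) / 2) *s cvec z"
            by (rule mat_fun_line_R(1)[OF _ t]) (rule ev)
          show "((1 / t) *\<^sub>R ((?p t - ?n t) / (2 * ?s t))) *s cvec x
           + ((1 / 2) * ((1 / t) *\<^sub>R (?p t + ?n t))) *s cvec z = (1 / t) *\<^sub>R (G (A + t *\<^sub>R R) *v cvec z)"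
            unfolding gz scaleR_eq_smult scaleR_conv_of_real[where 'a = complex]
            using t by (simp add: vec_eq_iff field_simps)
        qed
      qed
      show "LG R *v cvec z = 0" using LG_eqI[OF limz] by simp
      have "((\<lambda>t. ((1 / 2) * ((1 / t) *\<^sub>R (?p t + ?n t))) *s cvec x
           + (of_real t * ((1 / t) *\<^sub>R ((?p t - ?n t) / (2 * ?s t)))) *s cvec z) \<longlongrightarrow> 0 + 0) (at_right 0)"
        by (intro tendsto_add tendsto_smult_zero root half)
      then have limx: "((\<lambda>t. (1 / t) *\<^sub>R (G (A + t *\<^sub>R R) *v cvec x)) \<longlongrightarrow> 0 + 0) (at_right 0)"
      proof (rule Lim_transform_eventually)
        show "eventually (\<lambda>t. ((1 / 2) * ((1 / t) *\<^sub>R (?p t + ?n t))) *s cvec x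
           + (of_real t * ((1 / t) *\<^sub>R ((?p t - ?n t) / (2 * ?s t)))) *s cvec z
             = (1 / t) *\<^sub>R (G (A + t *\<^sub>R R) *v cvec x)) (at_right 0)"
          unfolding eventually_at_filter
        proof (intro always_eventually allI impI)
          fix t :: real assume "t \<in> {0<..}"
          then have t: "t > 0" by simp
          have ss: "complex_of_real t = ?s t * ?s t" using t by (simp flip: of_real_mult)
          have gx: "G (A + t *\<^sub>R R) *v cvec x = ((?p t + ?n t) / 2) *s cvec x + (?s t * (?p t - ?n t) / 2) *s cvec z"
            by (rule mat_fun_line_R(2)[OF _ t]) (rule ev)
          have "?s t \<noteq> 0" using t by simp
          then show "((1 / 2) * ((1 / t) *\<^sub>R (?p t + ?n t))) *s cvec x
           + (of_real t * ((1 / t) *\<^sub>R ((?p t - ?n t) / (2 * ?s t)))) *s cvec z = (1 / t) *\<^sub>R (G (A + t *\<^sub>R R) *v cvec x)"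
            unfolding gx scaleR_eq_smult scaleR_conv_of_real[where 'a = complex] of_real_divide of_real_1 ss
            by (simp add: vec_eq_iff field_simps)
        qed
      qed
      show "LG R *v cvec x = 0" using LG_eqI[OF limx] by simp
    qed (simp add: R_def cmat_outer)
    have 1: "scalar_product z (D *v y) = 0" using D[OF \<open>LG R = 0\<close>] by (simp add: R_def inner_outer)
    have 2: "scalar_product x (D *v y) + scalar_product z (D *v y') = 0"
      using D[OF \<open>LG P = 0\<close>] by (simp add: P_def inner_add_left inner_outer)
    \<comment> \<open>P kills only the sum of two pairings. Commutation of D with the transpose,
      together with the vanishing just obtained from R, makes the two equal, hence both
      zero.\<close>
    have "scalar_product x (D *v y) = scalar_product (A *v z) (D *v y) - m * scalar_product z (D *v y)"
      by (simp add: x_def scalar_product_diff_left scalar_product_smult_left)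
    also have "scalar_product (A *v z) (D *v y) = scalar_product z (D *v (transpose A *v y))"
      by (simp add: scalar_product_transpose[symmetric] commr)
    also have "D *v (transpose A *v y) = m *s (D *v y) + D *v y'"
      by (simp add: real_relations matrix_vector_right_distrib matrix_vector_mult_scaleR vector_scalar_commute)
    finally have "scalar_product x (D *v y) = scalar_product z (D *v y')"
      by (simp add: scalar_product_add_right scalar_product_smult_right)
    with 1 2 show ?thesis by (simp add: y'_def)
  qed
  define N where "N z = A *v z - m *s z" for z
  have Nadd: "N (z + w) = N z + N w" for z w
    by (simp add: N_def matrix_vector_right_distrib vec.scale_right_distrib vec_eq_iff algebra_simps)
  \<comment> \<open>From normalized pairs to all pairs in three stages: first y pairs nontrivially
    with N z, then only N z is nonzero, then z is arbitrary. Each degenerate case is a difference of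
    two from the preceding stage.\<close>
  have B1: "scalar_product z (D *v y) = 0" if V: "?V z" and W: "?W y" and nz: "scalar_product y (N z) \<noteq> 0" for z y
  proof -
    obtain w a c where w: "jordan_pair A m z w" "y = c *s w + a *s (transpose A *v w - m *s w)"
      by (rule ex_normalized_jordan_pair[OF idx V W nz[unfolded N_def]])
    have "D *v (c *s w + a *s v) = c *s (D *v w) + a *s (D *v v)" for v
      by (simp add: matrix_vector_right_distrib vector_scalar_commute)
    then have "D *v y = c *s (D *v w) + a *s (D *v (transpose A *v w - m *s w))" using w(2) by metis
    then show ?thesis using pairs[OF w(1)] by (simp add: scalar_product_add_right scalar_product_smult_right)
  qed
  have B2: "scalar_product z (D *v y) = 0" if V: "?V z" and W: "?W y" and nz: "N z \<noteq> 0" for z y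
  proof (cases "scalar_product y (N z) = 0")
    case True
    have "cvec (N z) \<in> geig (cmat A) (of_real m)"
    proof -
      have "cvec (N z) = cmat A *v cvec z + (- of_real m) *s cvec z"
        by (simp add: N_def cvec_diff cvec_smult cmat_cvec)
      then show ?thesis using V by (simp only:) (intro geig_add geig_smult geig_matrix)
    qed
    then obtain w where w: "?W w" "scalar_product (N z) w \<noteq> 0"
      using geig_dual_nonzero_real nz by blast
    then have "?W (y + w)" "scalar_product (y + w) (N z) \<noteq> 0" "scalar_product w (N z) \<noteq> 0"
      using True geig_add[OF W w(1)]
      by (simp_all add: cvec_add scalar_product_add_left scalar_product_commute[of w])
    then show ?thesis using B1[OF V, of "y + w"] B1[OF V, of w] w(1)
      by (simp add: matrix_vector_right_distrib scalar_product_add_right)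
  qed (rule B1[OF V W])
  obtain z0 where z0: "?V z0" "N z0 \<noteq> 0" using ex_jordan_pair[OF idx] by (auto simp: N_def)
  have B: "scalar_product z (D *v y) = 0" if V: "?V z" and W: "?W y" for z y
  proof (cases "N z = 0")
    case True
    then have "N (z + z0) \<noteq> 0" "?V (z + z0)" using z0 geig_add[OF V z0(1)] by (simp_all add: Nadd cvec_add)
    then show ?thesis using B2[of "z + z0" y] B2[of z0 y] z0 W
      by (simp add: scalar_product_add_left)
  qed (rule B2[OF V W])
  have Bc: "scalar_product (cvec x) (cmat D *v cvec y) = 0" if "?V x" "?W y" for x y
    using B[OF that] by (simp add: cmat_cvec scalar_product_cvec)
  have w: "w \<in> geig (cmat (transpose A)) (of_real m)" using vw by (simp add: cmat_transpose)
  show ?thesis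
    by (subst vre_vim[of v], subst vre_vim[of w])
      (simp add: matrix_vector_right_distrib matrix_vector_smult scalar_product_add_left scalar_product_add_right
        scalar_product_smult_left scalar_product_smult_right Bc geig_real_parts[OF w] geig_real_parts[OF vw(1)])
qed

end

subsection \<open>Newton interpolation with bounds\<close>

lemma norm_smult: "norm (c *s (v :: complex^'n)) = norm c * norm v"
  by (simp add: norm_vec_def norm_mult L2_set_right_distrib)

abbreviation root_poly :: "complex list \<Rightarrow> complex poly" where
  "root_poly xs \<equiv> (\<Prod>x\<leftarrow>xs. [:- x, 1:])"

lemma monic_root_poly: "lead_coeff (p :: complex poly) = 1 \<Longrightarrow> \<exists>xs. p = root_poly xs \<and> length xs = degree p"
proof (induct "degree p" arbitrary: p)
  case 0
  then obtain c where "p = [:c:]" by (metis degree_eq_zeroE)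
  with 0 show ?case by (intro exI[of _ "[]"]) (simp add: one_pCons)
next
  case (Suc n)
  then obtain a where a: "poly p a = 0"
    using Fundamental_Theorem_Algebra.fundamental_theorem_of_algebra[of p] by (auto simp: constant_degree)
  then obtain r where r: "p = [:- a, 1:] * r" by (auto simp: poly_eq_0_iff_dvd elim: dvdE)
  have r0: "r \<noteq> 0" using r Suc(3) by auto
  have "degree p = Suc (degree r)" unfolding r by (subst degree_mult_eq) (use r0 in auto)
  moreover have "lead_coeff r = 1" using Suc(3) unfolding r lead_coeff_mult by simp
  ultimately obtain xs where "r = root_poly xs" "length xs = degree r" using Suc by auto
  then show ?case using r \<open>degree p = Suc (degree r)\<close> by (intro exI[of _ "a # xs"]) simp
qed

text \<open>Maximum principle: on the boundary circle the distance to a is at least R / 2 and the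
  numerator at most 2 C, whence 4 C / R.\<close>

lemma difference_quotient_bound:
  fixes g :: "complex \<Rightarrow> complex"
  assumes "open S" "cball c R \<subseteq> S" "g holomorphic_on S" "\<And>z. z \<in> cball c R \<Longrightarrow> norm (g z) \<le> C"
    "R > 0" "a \<in> cball c (R / 2)" "z \<in> cball c R"
  shows "norm (if z = a then deriv g a else (g z - g a) / (z - a)) \<le> 4 * C / R"
proof -
  let ?F = "\<lambda>z. if z = a then deriv g a else (g z - g a) / (z - a)"
  have hol: "?F holomorphic_on S" by (rule pole_lemma_open) (use assms in auto)
  have aR: "a \<in> cball c R" using assms(5,6) by auto
  show ?thesis
  proof (rule maximum_modulus_frontier[of ?F "cball c R"])
    show "?F holomorphic_on interior (cball c R)"
      by (rule holomorphic_on_subset[OF hol]) (use assms(2) interior_subset in blast)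
    show "continuous_on (closure (cball c R)) ?F"
      using holomorphic_on_imp_continuous_on[OF hol] assms(2) by (auto intro: continuous_on_subset)
    fix w assume "w \<in> frontier (cball c R)"
    then have w: "dist c w = R" using assms(5) by (simp add: frontier_cball sphere_def)
    have "R \<le> dist c a + dist a w" using dist_triangle[of c w a] w by simp
    then have d: "R / 2 \<le> norm (w - a)" using assms(6) by (simp add: dist_norm norm_minus_commute[of a w])
    then have wa: "w \<noteq> a" using assms(5) by auto
    have "norm (g w - g a) \<le> C + C"
      using norm_triangle_ineq4[of "g w" "g a"] assms(4)[of w] assms(4)[OF aR] w by (simp add: add_mono order_trans)
    moreover have "C \<ge> 0" using assms(4)[OF aR] norm_ge_zero order_trans by blast
    ultimately have "norm (g w - g a) / norm (w - a) \<le> (C + C) / (R / 2)"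
      using d assms(5) by (intro frac_le) auto
    then show "norm (?F w) \<le> 4 * C / R" using wa by (simp add: norm_divide)
  qed (use assms in auto)
qed

text \<open>The nodes will be eigenvalues of A + t E, which move with t and may collide, so B must
  depend only on their number. Each induction step removes a node by passing to the difference
  quotient, again holomorphic on S with a controlled bound.\<close>

lemma newton_interpolation_bound:
  fixes c :: complex
  assumes "R > 0" "K \<ge> 0" "C \<ge> 0"
  shows "\<exists>B\<ge>0. \<forall>g S xs. open S \<longrightarrow> cball c R \<subseteq> S \<longrightarrow> g holomorphic_on S \<longrightarrow>
    (\<forall>z\<in>cball c R. norm (g z) \<le> C) \<longrightarrow> length xs \<le> n \<longrightarrow> set xs \<subseteq> cball c (R / 2) \<longrightarrow>
    (\<exists>p k. k holomorphic_on S \<and> (\<forall>z\<in>S. g z = poly p z + poly (root_poly xs) z * k z) \<and>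
      (\<forall>(M :: complex^'n^'n) w. (\<forall>v. norm (M *v v) \<le> K * norm v) \<longrightarrow> norm (pact p M w) \<le> B * norm w))"
  using assms(3)
proof (induct n arbitrary: C)
  case 0
  show ?case
  proof (intro exI[of _ "0 :: real"] conjI allI impI)
    fix g :: "complex \<Rightarrow> complex" and S and xs :: "complex list"
    assume "g holomorphic_on S" "length xs \<le> 0"
    then show "\<exists>p k. k holomorphic_on S \<and> (\<forall>z\<in>S. g z = poly p z + poly (root_poly xs) z * k z) \<and>
      (\<forall>(M :: complex^'n^'n) w. (\<forall>v. norm (M *v v) \<le> K * norm v) \<longrightarrow> norm (pact p M w) \<le> 0 * norm w)"
      by (intro exI[of _ 0] exI[of _ g]) simp
  qed simp
next
  case (Suc n)
  have "0 \<le> 4 * C / R" using Suc(2) assms(1) by simp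
  from Suc(1)[OF this] obtain B where B: "B \<ge> 0"
    "\<And>g S xs. open S \<Longrightarrow> cball c R \<subseteq> S \<Longrightarrow> g holomorphic_on S \<Longrightarrow>
      (\<forall>z\<in>cball c R. norm (g z) \<le> 4 * C / R) \<Longrightarrow> length xs \<le> n \<Longrightarrow> set xs \<subseteq> cball c (R / 2) \<Longrightarrow>
      \<exists>p k. k holomorphic_on S \<and> (\<forall>z\<in>S. g z = poly p z + poly (root_poly xs) z * k z) \<and>
      (\<forall>(M :: complex^'n^'n) w. (\<forall>v. norm (M *v v) \<le> K * norm v) \<longrightarrow> norm (pact p M w) \<le> B * norm w)"
    by metis
  \<comment> \<open>Read off from the Newton form g(a) + (X - a) p, with K bounding the matrix and
    norm c + R bounding the node a.\<close>
  define B' where "B' = C + (K + (norm c + R)) * B"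
  have B': "B' \<ge> 0" using B(1) Suc(2) assms by (simp add: B'_def)
  show ?case
  proof (intro exI[of _ B'] conjI allI impI B')
    fix g :: "complex \<Rightarrow> complex" and S and xs :: "complex list"
    assume S: "open S" "cball c R \<subseteq> S" and g: "g holomorphic_on S"
      and bd: "\<forall>z\<in>cball c R. norm (g z) \<le> C" and len: "length xs \<le> Suc n" and xs: "set xs \<subseteq> cball c (R / 2)"
    show "\<exists>p k. k holomorphic_on S \<and> (\<forall>z\<in>S. g z = poly p z + poly (root_poly xs) z * k z) \<and>
      (\<forall>(M :: complex^'n^'n) w. (\<forall>v. norm (M *v v) \<le> K * norm v) \<longrightarrow> norm (pact p M w) \<le> B' * norm w)"
    proof (cases xs)
      case Nil
      then show ?thesis using g B' by (intro exI[of _ 0] exI[of _ g]) simp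
    next
      case (Cons a ys)
      let ?F = "\<lambda>z. if z = a then deriv g a else (g z - g a) / (z - a)"
      have a: "a \<in> cball c (R / 2)" using xs Cons by simp
      have aS: "a \<in> cball c R" using a assms(1) by auto
      have "\<forall>z\<in>cball c R. norm (?F z) \<le> 4 * C / R"
        using difference_quotient_bound[OF S g _ assms(1) a, of C] bd by blast
      moreover have "?F holomorphic_on S" by (rule pole_lemma_open[OF g S(1)])
      ultimately obtain p k where pk: "k holomorphic_on S" "\<forall>z\<in>S. ?F z = poly p z + poly (root_poly ys) z * k z"
        "\<forall>(M :: complex^'n^'n) w. (\<forall>v. norm (M *v v) \<le> K * norm v) \<longrightarrow> norm (pact p M w) \<le> B * norm w"
        using B(2)[OF S, of ?F ys] len xs Cons by auto
      let ?p = "[:g a:] + [:- a, 1:] * p"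
      show ?thesis
      proof (intro exI[of _ ?p] exI[of _ k] conjI pk(1) ballI allI impI)
        fix z assume z: "z \<in> S"
        have "g z = g a + (z - a) * ?F z" by simp
        also have "?F z = poly p z + poly (root_poly ys) z * k z" using pk(2) z by blast
        finally show "g z = poly ?p z + poly (root_poly xs) z * k z"
          by (simp add: Cons algebra_simps)
      next
        fix M :: "complex^'n^'n" and w
        assume M: "\<forall>v. norm (M *v v) \<le> K * norm v"
        have 1: "norm (pact p M w) \<le> B * norm w" using pk(3) M by blast
        have na: "norm a \<le> norm c + R"
          using aS norm_triangle_ineq[of c "a - c"] by (simp add: dist_norm norm_minus_commute)
        have "pact ?p M w = g a *s w + (M *v pact p M w - a *s pact p M w)"
          unfolding pact_add pact_mult pact_linear_factor pact_const ..
        then have "norm (pact ?p M w) \<le> norm (g a *s w) + (norm (M *v pact p M w) + norm (a *s pact p M w))"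
          using norm_triangle_ineq[of "g a *s w"] norm_triangle_ineq4[of "M *v pact p M w" "a *s pact p M w"]
          by (smt (verit))
        also have "norm (g a *s w) \<le> C * norm w" using bd aS by (simp add: norm_smult mult_right_mono)
        also have "norm (M *v pact p M w) \<le> K * (B * norm w)"
          using M 1 assms(2) by (meson mult_left_mono order_trans)
        also have "norm (a *s pact p M w) \<le> (norm c + R) * (B * norm w)"
          unfolding norm_smult by (intro mult_mono na 1) (use assms in auto)
        finally show "norm (pact ?p M w) \<le> B' * norm w" by (simp add: B'_def algebra_simps)
      qed
    qed
  qed
qed

lemma newton_interpolation:
  fixes c :: complex
  assumes "R > 0" "K \<ge> 0" "C \<ge> 0"
  obtains B where "B \<ge> 0"
    "\<And>g S xs. open S \<Longrightarrow> cball c R \<subseteq> S \<Longrightarrow> g holomorphic_on S \<Longrightarrow>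
      (\<And>z. z \<in> cball c R \<Longrightarrow> norm (g z) \<le> C) \<Longrightarrow> length xs \<le> n \<Longrightarrow> set xs \<subseteq> cball c (R / 2) \<Longrightarrow>
      \<exists>p k. k holomorphic_on S \<and> (\<forall>z\<in>S. g z = poly p z + poly (root_poly xs) z * k z) \<and>
      (\<forall>(M :: complex^'n^'n) w. (\<forall>v. norm (M *v v) \<le> K * norm v) \<longrightarrow> norm (pact p M w) \<le> B * norm w)"
proof -
  from newton_interpolation_bound[OF assms, where n = n and c = c and 'n = 'n]
  show ?thesis
    by (elim exE conjE) (rule that; blast)
qed

lemma deriv_poly: "deriv (poly p) = poly (pderiv p)" for p :: "complex poly"
  by (rule ext) (intro DERIV_imp_deriv poly_DERIV)

lemma higher_deriv_poly: "(deriv ^^ j) (poly p) = poly ((pderiv ^^ j) p)" for p :: "complex poly"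
  by (induct j) (simp_all add: deriv_poly)

lemma holomorphic_on_poly: "poly p holomorphic_on S" for p :: "complex poly"
  unfolding holomorphic_on_def field_differentiable_def
  by (blast intro: has_field_derivative_at_within poly_DERIV)

lemma interpolant_derivatives:
  assumes S: "open S" "l \<in> S" and "f holomorphic_on S" "k holomorphic_on S"
    and eq: "\<And>z. z \<in> S \<Longrightarrow> f z = poly r z + poly d z * k z" and j: "j < order l d"
  shows "poly ((pderiv ^^ j) r) l = (deriv ^^ j) f l"
proof -
  have [simp]: "(deriv ^^ i) (poly d) l = 0" if "i \<le> j" for i
    using order_1[of l d] that j unfolding power_dvd_iff_pderivs higher_deriv_poly by auto
  have h: "(\<lambda>z. poly d z * k z) holomorphic_on S"
    by (intro holomorphic_on_mult holomorphic_on_poly assms)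
  have "(deriv ^^ j) f l = (deriv ^^ j) (\<lambda>z. poly r z + poly d z * k z) l"
    by (rule higher_deriv_transform_within_open[OF _ _ S])
      (use assms h eq in \<open>auto intro!: holomorphic_on_add holomorphic_on_poly\<close>)
  also have "\<dots> = (deriv ^^ j) (poly r) l + (deriv ^^ j) (\<lambda>z. poly d z * k z) l"
    by (rule higher_deriv_add[OF holomorphic_on_poly h S])
  also have "(deriv ^^ j) (\<lambda>z. poly d z * k z) l = 0"
    by (subst higher_deriv_mult[OF holomorphic_on_poly assms(4) S]) simp
  finally show ?thesis by (simp add: higher_deriv_poly)
qed

lemma order_root_poly_pos: "0 < order l (root_poly xs) \<Longrightarrow> l \<in> set xs"
proof (induct xs)
  case (Cons a xs)
  have "root_poly xs \<noteq> 0" by (induct xs) (auto simp: no_zero_divisors simp del: mult_pCons_left)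
  then have "order l (root_poly (a # xs)) = order l [:- a, 1:] + order l (root_poly xs)"
    unfolding list.map prod_list.Cons by (intro order_mult no_zero_divisors) auto
  then show ?case using Cons by (auto simp: order_linear_factor split: if_splits)
qed simp

lemma root_poly_replicate: "root_poly (replicate n l) = [:- l, 1:] ^ n"
  by (induct n) simp_all

subsection \<open>Eigenvalues near which the function is holomorphic\<close>

lemma pact_bounded: "\<exists>B\<ge>0. \<forall>w. norm (pact p (M :: complex^'n^'n) w) \<le> B * norm w"
proof -
  have "bounded_linear (\<lambda>w. pact p M w)"
    unfolding pact_def by (rule bounded_bilinear.bounded_linear_right[OF bounded_bilinear_matrix_vector_mult])
  from bounded_linear.nonneg_bounded[OF this] show ?thesis by (auto simp: mult.commute)
qed

lemma matrix_bounded: "\<exists>B\<ge>0. \<forall>w. norm ((M :: complex^'n^'n) *v w) \<le> B * norm w"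
  using pact_bounded[of "[:0, 1:]" M] by (simp add: pact_pCons)

text \<open>A Lipschitz bound in t, uniform in v. On the generalized eigenspace the unperturbed
  power vanishes for j equal to the index, so the perturbed one is O(t) there.\<close>

lemma pact_perturbation:
  fixes A E :: "real^'n^'n"
  shows "\<exists>C\<ge>0. \<forall>t v. 0 \<le> t \<and> t \<le> 1 \<longrightarrow>
    norm (pact ([:- l, 1:] ^ j) (cmat (A + t *\<^sub>R E)) v - pact ([:- l, 1:] ^ j) (cmat A) v) \<le> C * t * norm v"
proof (induct j)
  case 0
  show ?case by (intro exI[of _ 0]) simp
next
  case (Suc j)
  then obtain C where C: "C \<ge> 0" "\<And>t v. 0 \<le> t \<Longrightarrow> t \<le> 1 \<Longrightarrow>
    norm (pact ([:- l, 1:] ^ j) (cmat (A + t *\<^sub>R E)) v - pact ([:- l, 1:] ^ j) (cmat A) v) \<le> C * t * norm v" by blast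
  obtain a where a: "a \<ge> 0" "\<And>w. norm (pact [:- l, 1:] (cmat A) w) \<le> a * norm w" using pact_bounded by blast
  obtain b where b: "b \<ge> 0" "\<And>w. norm (pact ([:- l, 1:] ^ j) (cmat A) w) \<le> b * norm w" using pact_bounded by blast
  obtain e where e: "e \<ge> 0" "\<And>w. norm (cmat E *v w) \<le> e * norm w" using matrix_bounded by blast
  show ?case
  proof (intro exI[of _ "a * C + e * (b + C)"] conjI allI impI)
    show "0 \<le> a * C + e * (b + C)" using a b C e by simp
    fix t v assume t: "0 \<le> t \<and> t \<le> (1 :: real)"
    let ?x = "pact ([:- l, 1:] ^ j) (cmat (A + t *\<^sub>R E)) v" and ?y = "pact ([:- l, 1:] ^ j) (cmat A) v"
    have xy: "norm (?x - ?y) \<le> C * t * norm v" using C(2) t by blast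
    have "C * t * norm v \<le> C * norm v" using C(1) t by (simp add: mult_left_le mult_right_mono)
    then have x: "norm ?x \<le> (b + C) * norm v"
      using xy b(2)[of v] norm_triangle_ineq[of ?y "?x - ?y"] by (simp add: algebra_simps)
    have "pact ([:- l, 1:] ^ Suc j) (cmat (A + t *\<^sub>R E)) v - pact ([:- l, 1:] ^ Suc j) (cmat A) v
      = pact [:- l, 1:] (cmat A) (?x - ?y) + of_real t *s (cmat E *v ?x)"
      unfolding power_Suc pact_mult pact_linear_factor cmat_line matrix_vector_mult_diff_distrib
      by (simp add: vec_eq_iff algebra_simps)
    then have "norm (pact ([:- l, 1:] ^ Suc j) (cmat (A + t *\<^sub>R E)) v - pact ([:- l, 1:] ^ Suc j) (cmat A) v)
      \<le> norm (pact [:- l, 1:] (cmat A) (?x - ?y)) + t * norm (cmat E *v ?x)"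
      using norm_triangle_ineq[of "pact [:- l, 1:] (cmat A) (?x - ?y)" "of_real t *s (cmat E *v ?x)"] t
      by (simp add: norm_smult)
    also have "norm (pact [:- l, 1:] (cmat A) (?x - ?y)) \<le> a * (C * t * norm v)"
      using a xy by (meson mult_left_mono order_trans)
    also have "t * norm (cmat E *v ?x) \<le> t * (e * ((b + C) * norm v))"
      using e x t by (meson mult_left_mono order_trans)
    finally show "norm (pact ([:- l, 1:] ^ Suc j) (cmat (A + t *\<^sub>R E)) v - pact ([:- l, 1:] ^ Suc j) (cmat A) v)
      \<le> (a * C + e * (b + C)) * t * norm v"
      by (simp add: algebra_simps)
  qed
qed

context interpolation
begin

text \<open>Agreement to order 2 m at l, with m the index, gives f - q = (z - l)^(2 m) g. On the
  generalized eigenspace, which E preserves, each of the two factors (A + t E - l)^m is O(t), so the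
  difference is O(t^2) once g is replaced by interpolants that stay bounded.\<close>

lemma LG_holomorphic:
  assumes r: "r > 0" and hol: "f holomorphic_on ball l r"
    and ag: "\<And>j. j < 2 * eig_index (cmat A) l \<Longrightarrow> poly ((pderiv ^^ j) q) l = (deriv ^^ j) f l"
    and E: "\<And>v. v \<in> geig (cmat A) l \<Longrightarrow> cmat E *v v \<in> geig (cmat A) l"
    and w: "w \<in> geig (cmat A) l"
  shows "LG E *v w = 0"
proof (cases "eig_index (cmat A) l = 0")
  case True
  then show ?thesis using w by (simp add: geig_eig_index)
next
  case False
  define m where "m = eig_index (cmat A) l"
  define R where "R = r / 2"
  let ?V = "geig (cmat A) l" and ?S = "ball l r" and ?X = "[:- l, 1:]"
  let ?M = "\<lambda>t. A + t *\<^sub>R E"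
  have R: "R > 0" and RS: "cball l R \<subseteq> ?S" and lS: "l \<in> ?S" using r by (auto simp: R_def)
  have m: "m > 0" using False by (simp add: m_def)
  have Xm: "pact (?X ^ m) (cmat A) v = 0" if "v \<in> ?V" for v using that by (simp add: geig_eig_index m_def)
  \<comment> \<open>The quotient g comes from Newton interpolation at 2 m copies of l; the
    interpolant p obtained there differs from q by a multiple of X^(2 m), which is absorbed into
    g.\<close>
  have "\<exists>g. g holomorphic_on ?S \<and> (\<forall>z\<in>?S. f z = poly q z + poly (?X ^ (2 * m)) z * g z)"
  proof -
    have "continuous_on (cball l R) f"
      using holomorphic_on_imp_continuous_on[OF hol] RS continuous_on_subset by blast
    then have "bounded (f ` cball l R)" by (simp add: compact_continuous_image compact_imp_bounded)
    then obtain C where C: "\<forall>z\<in>cball l R. norm (f z) \<le> C" by (auto simp: bounded_iff)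
    then have "C \<ge> 0" using R norm_ge_zero order_trans by (metis centre_in_cball less_imp_le)
    note C0 = this
    obtain B where B: "\<And>g S xs. open S \<Longrightarrow> cball l R \<subseteq> S \<Longrightarrow> g holomorphic_on S \<Longrightarrow>
      (\<And>z. z \<in> cball l R \<Longrightarrow> norm (g z) \<le> C) \<Longrightarrow> length xs \<le> 2 * m \<Longrightarrow> set xs \<subseteq> cball l (R / 2) \<Longrightarrow>
      \<exists>p k. k holomorphic_on S \<and> (\<forall>z\<in>S. g z = poly p z + poly (root_poly xs) z * k z) \<and>
      (\<forall>(M :: complex^'n^'n) w. (\<forall>v. norm (M *v v) \<le> 0 * norm v) \<longrightarrow> norm (pact p M w) \<le> B * norm w)"
      by (rule newton_interpolation[OF R order_refl C0, where n = "2 * m" and c = l]) blast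
    have "set (replicate (2 * m) l) \<subseteq> cball l (R / 2)" using R by auto
    with B[OF open_ball RS hol, of "replicate (2 * m) l"] C
    obtain p k where pk: "k holomorphic_on ?S"
      "\<forall>z\<in>?S. f z = poly p z + poly (root_poly (replicate (2 * m) l)) z * k z" by auto
    then have pk2: "\<forall>z\<in>?S. f z = poly p z + poly (?X ^ (2 * m)) z * k z" by (simp only: root_poly_replicate)
    have "?X ^ (2 * m) dvd q - p"
      unfolding power_dvd_iff_pderivs
    proof (intro allI impI)
      fix j assume j: "j < 2 * m"
      have "poly ((pderiv ^^ j) p) l = (deriv ^^ j) f l"
        by (rule interpolant_derivatives[OF open_ball lS hol pk(1), of _ "?X ^ (2 * m)"])
          (use pk2 j in \<open>auto simp: order_power_n_n\<close>)
      then show "poly ((pderiv ^^ j) (q - p)) l = 0" using ag j by (simp add: pderiv_funpow_diff m_def)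
    qed
    then obtain s where s: "q - p = ?X ^ (2 * m) * s" by (auto elim: dvdE)
    have "poly p z = poly q z - poly (?X ^ (2 * m)) z * poly s z" for z
      using arg_cong[OF s, of "\<lambda>p. poly p z"] by (simp add: algebra_simps)
    then have "\<forall>z\<in>?S. f z = poly q z + poly (?X ^ (2 * m)) z * (k z - poly s z)"
      using pk2 by (simp add: algebra_simps)
    then show ?thesis by (intro exI[of _ "\<lambda>z. k z - poly s z"]) (auto intro: holomorphic_on_diff pk holomorphic_on_poly)
  qed
  then obtain g where g: "g holomorphic_on ?S" "\<And>z. z \<in> ?S \<Longrightarrow> f z = poly q z + poly (?X ^ (2 * m)) z * g z" by blast
  have "continuous_on (cball l R) g"
    using holomorphic_on_imp_continuous_on[OF g(1)] RS continuous_on_subset by blast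
  then have "bounded (g ` cball l R)" by (simp add: compact_continuous_image compact_imp_bounded)
  then obtain C where C: "\<forall>z\<in>cball l R. norm (g z) \<le> C" by (auto simp: bounded_iff)
  then have C0: "C \<ge> 0" using R norm_ge_zero order_trans by (metis centre_in_cball less_imp_le)
  obtain a where a: "a \<ge> 0" "\<And>w. norm (cmat A *v w) \<le> a * norm w" using matrix_bounded by blast
  obtain e where e: "e \<ge> 0" "\<And>w. norm (cmat E *v w) \<le> e * norm w" using matrix_bounded by blast
  have "a + e \<ge> 0" using a e by simp
  note ae = this
  obtain B where B: "B \<ge> 0" "\<And>g S xs. open S \<Longrightarrow> cball l R \<subseteq> S \<Longrightarrow> g holomorphic_on S \<Longrightarrow>
    (\<And>z. z \<in> cball l R \<Longrightarrow> norm (g z) \<le> C) \<Longrightarrow> length xs \<le> DIM(complex^'n^'n) \<Longrightarrow> set xs \<subseteq> cball l (R / 2) \<Longrightarrow>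
    \<exists>p k. k holomorphic_on S \<and> (\<forall>z\<in>S. g z = poly p z + poly (root_poly xs) z * k z) \<and>
      (\<forall>(M :: complex^'n^'n) w. (\<forall>v. norm (M *v v) \<le> (a + e) * norm v) \<longrightarrow> norm (pact p M w) \<le> B * norm w)"
    by (rule newton_interpolation[OF R ae C0, where n = "DIM(complex^'n^'n)" and c = l]) blast
  obtain P where P: "P \<ge> 0" "\<And>t v. 0 \<le> t \<Longrightarrow> t \<le> 1 \<Longrightarrow>
    norm (pact (?X ^ m) (cmat (?M t)) v - pact (?X ^ m) (cmat A) v) \<le> P * t * norm v"
    using pact_perturbation[of l m A E] by blast
  have Ym: "norm (pact (?X ^ m) (cmat (?M t)) v) \<le> P * t * norm v" if "0 \<le> t" "t \<le> 1" "v \<in> ?V" for t v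
    using P(2)[OF that(1,2), of v] Xm[OF that(3)] by simp
  have MV: "cmat (?M t) *v v \<in> ?V" if "v \<in> ?V" for t v
    unfolding cmat_line by (intro geig_add geig_smult geig_matrix E that)
  have pV: "pact p (cmat (?M t)) v \<in> ?V" if "v \<in> ?V" for p t v
    by (rule pact_invariant) (use that MV geig_add geig_smult in auto)
  have small: "eventually (\<lambda>t. 0 < t \<and> t \<le> 1 \<and> P * t \<le> (R / 2) ^ m) (at_right 0)"
  proof -
    have "((\<lambda>t. P * t) \<longlongrightarrow> P * 0) (at_right 0)" by (intro tendsto_intros)
    then have "eventually (\<lambda>t. P * t < (R / 2) ^ m) (at_right 0)"
      by (rule order_tendstoD) (use R in simp)
    moreover have "eventually (\<lambda>t. t \<in> {0<..<1 :: real}) (at_right 0)" by (rule eventually_at_right_real) simp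
    ultimately show ?thesis by eventually_elim auto
  qed
  have bound: "norm ((1 / t) *\<^sub>R (G (?M t) *v w)) \<le> B * P * P * norm w * t"
    if t: "0 < t" "t \<le> 1" "P * t \<le> (R / 2) ^ m" for t
  proof -
    let ?N = "cmat (?M t)"
    obtain d where d: "d \<noteq> 0" "pact d ?N w = 0" "\<And>p. pact p ?N w = 0 \<Longrightarrow> d dvd p"
      "degree d \<le> DIM(complex^'n^'n)" "lead_coeff d = 1" using ex_min_annihilator[of ?N w] by metis
    obtain xs where xs: "d = root_poly xs" "length xs = degree d" using monic_root_poly d(5) by blast
    \<comment> \<open>Localizes the perturbed eigenvalues: a root x of d has an eigenvector z in the
      generalized eigenspace, and |x - l|^m |z| is the norm of the perturbed power applied to z, at
      most P t |z|.\<close>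
    have "x \<in> cball l (R / 2)" if x: "x \<in> set xs" for x
    proof -
      have "poly d x = 0" using x unfolding xs(1) by (induct xs) auto
      then obtain s where s: "d = [:- x, 1:] * s" by (auto simp: poly_eq_0_iff_dvd elim: dvdE)
      have s0: "s \<noteq> 0" using s d(1) by auto
      define z where "z = pact s ?N w"
      have "z \<noteq> 0"
      proof
        assume "z = 0"
        then have "d dvd s" using d(3) z_def by simp
        from dvd_imp_degree_le[OF this s0] show False
          unfolding s by (subst (asm) degree_mult_eq) (use s0 in auto)
      qed
      have "pact [:- x, 1:] ?N z = 0" using d(2) unfolding s z_def by (simp only: pact_mult)
      then have "?N *v z = x *s z" by (simp add: pact_linear_factor)
      from pact_eigen[OF this] have "pact (?X ^ m) ?N z = (x - l) ^ m *s z" by simp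
      moreover have "z \<in> ?V" unfolding z_def by (rule pV[OF w])
      ultimately have "norm (x - l) ^ m * norm z \<le> P * t * norm z"
        using Ym[of t z] t by (simp add: norm_smult norm_power)
      then have "norm (x - l) ^ m \<le> (R / 2) ^ m" using \<open>z \<noteq> 0\<close> t(3) by simp
      then have "norm (x - l) \<le> R / 2" using m R by (simp add: power_mono_iff)
      then show ?thesis by (simp add: dist_norm norm_minus_commute)
    qed
    then have sub: "set xs \<subseteq> cball l (R / 2)" by blast
    from B(2)[OF open_ball RS g(1) _ _ this] C obtain p k where k: "k holomorphic_on ?S"
      and gz: "\<And>z. z \<in> ?S \<Longrightarrow> g z = poly p z + poly d z * k z"
      and pb: "\<And>(M :: complex^'n^'n) w. (\<forall>v. norm (M *v v) \<le> (a + e) * norm v) \<Longrightarrow> norm (pact p M w) \<le> B * norm w"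
      using d(4) xs by auto
    \<comment> \<open>Because p interpolates g at the roots of d, the polynomial q + X^(2 m) p
      interpolates f there and may be used to evaluate the function at w.\<close>
    have "G (?M t) *v w = pact (q + ?X ^ (2 * m) * p - q) ?N w"
    proof (rule G_vector[OF d(1,2)])
      fix x j assume j: "j < order x d"
      then have "x \<in> set xs" unfolding xs(1) by (intro order_root_poly_pos) simp
      then have "x \<in> cball l R" using sub R by (auto simp: subset_iff)
      then have xS: "x \<in> ?S" using RS by blast
      show "poly ((pderiv ^^ j) (q + ?X ^ (2 * m) * p)) x = (deriv ^^ j) f x"
      proof (rule interpolant_derivatives[OF open_ball xS hol _ _ j])
        show "(\<lambda>z. poly (?X ^ (2 * m)) z * k z) holomorphic_on ?S"
          by (intro holomorphic_on_mult holomorphic_on_poly k)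
        fix z assume "z \<in> ?S"
        then show "f z = poly (q + ?X ^ (2 * m) * p) z + poly d z * (poly (?X ^ (2 * m)) z * k z)"
          using g(2) gz by (simp add: algebra_simps)
      qed
    qed
    also have "q + ?X ^ (2 * m) * p - q = p * (?X ^ m * ?X ^ m)"
      by (simp only: mult_2 power_add) (simp add: mult.commute)
    also have "pact \<dots> ?N w = pact p ?N (pact (?X ^ m) ?N (pact (?X ^ m) ?N w))" by (simp only: pact_mult)
    finally have Gw: "G (?M t) *v w = pact p ?N (pact (?X ^ m) ?N (pact (?X ^ m) ?N w))" .
    have Nb: "\<forall>v. norm (?N *v v) \<le> (a + e) * norm v"
    proof
      fix v
      have "norm (?N *v v) \<le> norm (cmat A *v v) + t * norm (cmat E *v v)"
        unfolding cmat_line using norm_triangle_ineq[of "cmat A *v v" "of_real t *s (cmat E *v v)"] t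
        by (simp add: norm_smult)
      also have "t * norm (cmat E *v v) \<le> 1 * norm (cmat E *v v)" using t by (intro mult_right_mono) auto
      finally show "norm (?N *v v) \<le> (a + e) * norm v" using a(2)[of v] e(2)[of v] by (simp add: algebra_simps)
    qed
    have "norm (G (?M t) *v w) \<le> B * norm (pact (?X ^ m) ?N (pact (?X ^ m) ?N w))"
      unfolding Gw by (rule pb[OF Nb])
    also have "\<dots> \<le> B * (P * t * (P * t * norm w))"
    proof (intro mult_left_mono B(1))
      have "norm (pact (?X ^ m) ?N (pact (?X ^ m) ?N w)) \<le> P * t * norm (pact (?X ^ m) ?N w)"
        by (rule Ym) (use t pV w in auto)
      also have "\<dots> \<le> P * t * (P * t * norm w)"
        by (intro mult_left_mono Ym) (use t w P in auto)
      finally show "norm (pact (?X ^ m) ?N (pact (?X ^ m) ?N w)) \<le> P * t * (P * t * norm w)" .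
    qed
    finally have "norm (G (?M t) *v w) / t \<le> B * (P * t * (P * t * norm w)) / t" using t by (intro divide_right_mono) auto
    also have "\<dots> = B * P * P * norm w * t" using t by simp
    finally show ?thesis using t by simp
  qed
  have "((\<lambda>t. (1 / t) *\<^sub>R (G (?M t) *v w)) \<longlongrightarrow> 0) (at_right 0)"
  proof (rule Lim_null_comparison)
    show "eventually (\<lambda>t. norm ((1 / t) *\<^sub>R (G (?M t) *v w)) \<le> B * P * P * norm w * t) (at_right 0)"
      using small by eventually_elim (use bound in blast)
    have "((\<lambda>t. B * P * P * norm w * t) \<longlongrightarrow> B * P * P * norm w * 0) (at_right 0)" by (intro tendsto_intros)
    then show "((\<lambda>t. B * P * P * norm w * t) \<longlongrightarrow> 0) (at_right 0)" by simp
  qed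
  then show ?thesis by (rule LG_eqI)
qed

text \<open>The matrix \<open>re_outer x y\<close> preserves every generalized eigenspace of A and
  vanishes on those for eigenvalues other than l and its conjugate. No nondegeneracy of the pair is
  required, and l may be real.\<close>

lemma orthogonal_holomorphic:
  assumes r: "r > 0" "f holomorphic_on ball l r" "f holomorphic_on ball (cnj l) r"
    and ag: "\<And>j. j < 2 * eig_index (cmat A) l \<Longrightarrow> poly ((pderiv ^^ j) q) l = (deriv ^^ j) f l"
      "\<And>j. j < 2 * eig_index (cmat A) l \<Longrightarrow> poly ((pderiv ^^ j) q) (cnj l) = (deriv ^^ j) f (cnj l)"
    and D: "\<And>E. LG E = 0 \<Longrightarrow> E \<bullet> D = 0"
    and xy: "x \<in> geig (cmat A) l" "y \<in> geig (transpose (cmat A)) l"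
  shows "scalar_product x (cmat D *v y) = 0"
proof -
  have LG0: "LG (re_outer x y) = 0" if V: "x \<in> geig (cmat A) l" and W: "y \<in> geig (transpose (cmat A)) l" for x y
  proof -
    have V': "vcnj x \<in> geig (cmat A) (cnj l)" by (rule geig_vcnj[OF V])
    have W': "vcnj y \<in> geig (transpose (cmat A)) (cnj l)"
      using geig_vcnj[of y "transpose A" l] W by (simp add: cmat_transpose)
    have o: "scalar_product y v = 0" if "v \<in> geig (cmat A) k" "k \<noteq> l" for v k
      using geig_orthogonal[OF that(1) W that(2)] by (simp add: scalar_product_commute)
    have o': "scalar_product (vcnj y) v = 0" if "v \<in> geig (cmat A) k" "k \<noteq> cnj l" for v k
      using geig_orthogonal[OF that(1) W' that(2)] by (simp add: scalar_product_commute)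
    have E: "cmat (re_outer x y) *v v \<in> geig (cmat A) k" if "v \<in> geig (cmat A) k" for v k
      unfolding cmat_re_outer using o[OF that] o'[OF that] V V'
      by (intro geig_add) (cases "k = l"; cases "k = cnj l"; auto intro: geig_smult geig_0)+
    have "LG (re_outer x y) *v w = 0" for w
    proof (rule geig_span[of "cmat A" "\<lambda>w. LG (re_outer x y) *v w = 0"])
      fix k w assume w: "w \<in> geig (cmat A) k"
      consider "k = l" | "k = cnj l" | "k \<noteq> l" "k \<noteq> cnj l" by blast
      then show "LG (re_outer x y) *v w = 0"
      proof cases
        case 1
        show ?thesis by (rule LG_holomorphic[OF r(1,2) ag(1) E]) (use w 1 in auto)
      next
        case 2
        show ?thesis by (rule LG_holomorphic[OF r(1,3) ag(2) E]) (use w 2 in \<open>auto simp: eig_index_cnj\<close>)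
      next
        case 3
        show ?thesis
          by (rule LG_invariant[of "geig (cmat A) k", OF geig_matrix geig_add geig_smult _ w])
            (use o[OF _ 3(1)] o'[OF _ 3(2)] in \<open>simp_all add: cmat_re_outer\<close>)
      qed
    qed (simp add: matrix_vector_right_distrib)
    then show ?thesis by (simp add: matrix_eq)
  qed
  show ?thesis by (rule orthogonal_re_outer[OF D]) (use xy in \<open>auto intro!: LG0 geig_smult\<close>)
qed

end

subsection \<open>Regularity of the scalar function at the eigenvalues\<close>

lemma derivs_exist_mono: "derivs_exist f k z \<Longrightarrow> j \<le> k \<Longrightarrow> derivs_exist f j z"
proof (induct k)
  case (Suc k)
  then show ?case
    by (cases "j = Suc k") (auto dest: eventually_nhds_x_imp_x)
qed simp

lemma derivs_exist_field_differentiable: "derivs_exist f k z \<Longrightarrow> 1 \<le> k \<Longrightarrow> f field_differentiable at z"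
  using derivs_exist_mono[of f k z 1] by simp

lemma field_differentiable_of_index:
  assumes "defined_on_spectrum f M" "w \<in> geig M l" "pact [:- l, 1:] M w \<noteq> 0"
  shows "f field_differentiable at l"
proof -
  have "1 < eig_index M l" by (rule less_eig_indexI[OF assms(2)]) (use assms(3) in simp)
  moreover have "l \<in> spectrum M" using calculation eig_index_pos_iff[of M l] by simp
  ultimately show ?thesis using assms(1) unfolding defined_on_spectrum_def
    by (intro derivs_exist_field_differentiable[of f "eig_index M l - 1"]) auto
qed

lemma jordan_in_geig:
  assumes "M *v z = l *s z + x" "M *v x = l *s x"
  shows "z \<in> geig M l" "pact [:- l, 1:] M z = x"
proof -
  show 1: "pact [:- l, 1:] M z = x" using assms(1) by (simp add: pact_linear_factor)
  have "pact [:- l, 1:] M x = 0" using assms(2) by (simp add: pact_linear_factor)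
  then show "z \<in> geig M l"
    by (intro geigI[of _ 2]) (simp only: power2_eq_square pact_mult 1)
qed

lemma holomorphic_ballI:
  assumes "eventually (\<lambda>z. f field_differentiable at z) (nhds l)"
  shows "\<exists>r>0. f holomorphic_on ball l r"
proof -
  obtain r where "r > 0" "\<forall>z. dist z l < r \<longrightarrow> f field_differentiable at z"
    using assms by (auto simp: eventually_nhds_metric)
  then show ?thesis
    by (intro exI[of _ r]) (auto simp: holomorphic_on_def dist_commute intro: field_differentiable_at_within)
qed

text \<open>Index three demands a second derivative at l, and \<open>derivs_exist\<close> then
  includes the first derivative throughout a complex neighbourhood.\<close>

lemma holomorphic_near_index_ge_3:
  assumes "defined_on_spectrum f M" "3 \<le> eig_index M l"
  shows "\<exists>r>0. f holomorphic_on ball l r"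
proof -
  have "l \<in> spectrum M" using assms(2) eig_index_pos_iff[of M l] by simp
  then have "derivs_exist f (eig_index M l - 1) l" using assms(1) by (simp add: defined_on_spectrum_def)
  then have "derivs_exist f (Suc (Suc 0)) l" by (rule derivs_exist_mono) (use assms(2) in simp)
  then have "eventually (\<lambda>z. derivs_exist f (Suc 0) z) (nhds l)" by simp
  then have "eventually (\<lambda>z. f field_differentiable at z) (nhds l)" by eventually_elim simp
  then show ?thesis by (rule holomorphic_ballI)
qed

text \<open>A nontrivial Jordan block of a non-real eigenvalue can be shifted, together with its
  conjugate, to any nearby point by a small real perturbation.\<close>

lemma holomorphic_near_nonreal_index_ge_2:
  fixes A :: "real^'n^'n"
  assumes ev: "eventually (\<lambda>M. defined_on_spectrum f (cmat M)) (nhds A)"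
    and nr: "cnj l \<noteq> l" and idx: "2 \<le> eig_index (cmat A) l"
  shows "\<exists>r>0. f holomorphic_on ball l r"
proof -
  let ?k = "eig_index (cmat A) l"
  obtain k where k: "?k = Suc (Suc k)" using idx by (metis add_2_eq_Suc le_Suc_ex)
  obtain z0 where z0: "pact ([:- l, 1:] ^ Suc (Suc k)) (cmat A) z0 = 0" "pact ([:- l, 1:] ^ Suc k) (cmat A) z0 \<noteq> 0"
    using eig_index_attained[OF k] by blast
  \<comment> \<open>The last two members of a longest Jordan chain: z is sent by A - l to the
    eigenvector x.\<close>
  define z where "z = pact ([:- l, 1:] ^ k) (cmat A) z0"
  define x where "x = pact [:- l, 1:] (cmat A) z"
  have "pact [:- l, 1:] (cmat A) x = 0" using z0(1) unfolding x_def z_def power_Suc pact_mult .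
  then have Ax: "cmat A *v x = l *s x" by (simp add: pact_linear_factor)
  have x0: "x \<noteq> 0" using z0(2) unfolding x_def z_def power_Suc pact_mult .
  have Az: "cmat A *v z = l *s z + x" by (simp add: x_def pact_linear_factor)
  have zg: "z \<in> geig (cmat A) l" by (rule jordan_in_geig[OF Az Ax])
  have xg: "x \<in> geig (cmat A) l" using Ax by (intro geigI[of _ 1]) (simp add: pact_linear_factor)
  have "poly ([:- cnj l, 1:] ^ ?k) l \<noteq> 0" using nr by auto
  then obtain a b where ab: "a * [:- l, 1:] ^ ?k + b * [:- cnj l, 1:] ^ ?k = 1" using bezout_power by blast
  \<comment> \<open>By Bezout this matrix is the identity on the generalized eigenspace of l and
    zero on that of its conjugate.\<close>
  define P where "P = mat_poly (b * [:- cnj l, 1:] ^ ?k) (cmat A)"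
  have P1: "P *v w = w" if "w \<in> geig (cmat A) l" for w
  proof -
    have "w = pact (a * [:- l, 1:] ^ ?k + b * [:- cnj l, 1:] ^ ?k) (cmat A) w" by (simp only: ab pact_1)
    also have "\<dots> = P *v w" using that
      by (simp add: pact_add pact_mult geig_eig_index) (simp add: P_def pact_def[symmetric] pact_mult)
    finally show ?thesis by simp
  qed
  have P2: "P *v w = 0" if "w \<in> geig (cmat A) (cnj l)" for w
    using that by (simp add: P_def pact_def[symmetric] pact_mult geig_eig_index eig_index_cnj)
  \<comment> \<open>c P plus its complex conjugate: a real matrix that acts as the scalar c at l,
    since the conjugate part vanishes there.\<close>
  define E :: "complex \<Rightarrow> real^'n^'n" where "E c = (\<chi> i j. 2 * Re (c * P $ i $ j))" for c
  have E: "cmat (E c) *v w = c *s w" if w: "w \<in> geig (cmat A) l" for c w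
  proof -
    have re: "complex_of_real (2 * Re z) = z + cnj z" for z by (simp add: complex_add_cnj)
    have "cmat (E c) *v w = c *s (P *v w) + vcnj (c *s (P *v vcnj w))"
      unfolding vec_eq_iff
    proof
      fix i
      have "(cmat (E c) *v w) $ i = (\<Sum>j\<in>UNIV. (c * P $ i $ j + cnj (c * P $ i $ j)) * w $ j)"
        by (simp only: matrix_vector_mult_def vec_lambda_beta cmat_nth E_def re)
      also have "\<dots> = (c *s (P *v w) + vcnj (c *s (P *v vcnj w))) $ i"
        by (simp add: matrix_vector_mult_def vcnj_def distrib_right sum.distrib sum_distrib_left mult.assoc)
      finally show "(cmat (E c) *v w) $ i = (c *s (P *v w) + vcnj (c *s (P *v vcnj w))) $ i" .
    qed
    then show ?thesis using P1[OF w] P2[OF geig_vcnj[OF w]] by simp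
  qed
  have E0: "A + E 0 = A" by (simp add: vec_eq_iff E_def)
  have "isCont (\<lambda>c. A + E c) 0"
    unfolding continuous_at E_def by (intro tendsto_add tendsto_const vec_tendstoI) (auto intro!: tendsto_eq_intros)
  then have "filterlim (\<lambda>c. A + E c) (nhds A) (nhds 0)"
    using tendsto_at_iff_tendsto_nhds[of "\<lambda>c. A + E c" 0] by (simp only: continuous_at E0)
  with ev have "eventually (\<lambda>c. defined_on_spectrum f (cmat (A + E c))) (nhds 0)"
    by (auto simp: filterlim_iff)
  then have "eventually (\<lambda>c. f field_differentiable at (l + c)) (nhds 0)"
  proof eventually_elim
    case (elim c)
    have M: "cmat (A + E c) *v w = cmat A *v w + c *s w" if "w \<in> geig (cmat A) l" for w
      using cmat_line[of A 1 "E c" w] E[OF that] by simp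
    have "cmat (A + E c) *v z = (l + c) *s z + x" "cmat (A + E c) *v x = (l + c) *s x"
      unfolding M[OF zg] M[OF xg] Az Ax by (simp_all add: vec_eq_iff algebra_simps)
    from jordan_in_geig[OF this] show ?case using field_differentiable_of_index[OF elim] x0 by metis
  qed
  then have "eventually (\<lambda>z. f field_differentiable at z) (nhds l)"
    unfolding eventually_nhds_metric by (auto simp: dist_norm) (metis add.commute diff_add_cancel diff_zero)
  then show ?thesis by (rule holomorphic_ballI)
qed

lemma real_derivative_index_1:
  assumes der: "((\<lambda>M. mat_fun f (cmat M)) has_derivative L) (at A)"
    and idx: "eig_index (cmat A) (complex_of_real m) = 1"
  shows "\<exists>d. ((\<lambda>t. f (of_real (m + t))) has_vector_derivative d) (at 0)"
proof -
  have "eig_index (cmat A) (complex_of_real m) = Suc 0" using idx by simp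
  then obtain w where w: "pact ([:- of_real m, 1:] ^ Suc 0) (cmat A) w = 0"
    "pact ([:- of_real m, 1:] ^ 0) (cmat A) w \<noteq> 0" by (rule eig_index_attained)
  then have wg: "w \<in> geig (cmat A) (of_real m)" by (blast intro: geigI)
  have "w \<noteq> 0" using w(2) by simp
  then have "vre w \<noteq> 0 \<or> vim w \<noteq> 0" using vre_vim[of w] by auto
  then obtain x where x: "cvec x \<in> geig (cmat A) (of_real m)" "x \<noteq> 0" using geig_real_parts[OF wg] by blast
  then obtain y where xy: "scalar_product x y \<noteq> 0" using geig_dual_nonzero_real by blast
  define c where "c = scalar_product y x"
  have c: "c \<noteq> 0" using xy by (simp add: c_def scalar_product_commute)
  \<comment> \<open>Dividing y by c makes the eigenvalue travel at unit speed, so its position at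
    time t is m + t.\<close>
  have "(1 / of_real c) * scalar_product (cvec y) (mat_fun f (cmat (A + t *\<^sub>R outer x ((1 / c) *s y))) *v cvec x)
      = f (of_real (m + t))" for t
  proof -
    have "cmat (A + t *\<^sub>R outer x ((1 / c) *s y)) *v cvec x = of_real (m + t) *s cvec x"
      unfolding cmat_line cmat_outer cvec_smult scalar_product_smult_left scalar_product_cvec c_def[symmetric]
        geig_index_1[OF idx x(1)]
      using c by (simp add: vec_eq_iff algebra_simps)
    from mat_fun_eigenvector[OF this] show ?thesis
      using c by (simp add: scalar_product_smult_right scalar_product_cvec c_def[symmetric])
  qed
  moreover have "((\<lambda>t. (1 / of_real c) * scalar_product (cvec y)
      (mat_fun f (cmat (A + t *\<^sub>R outer x ((1 / c) *s y))) *v cvec x)) has_vector_derivative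
      (1 / of_real c) * scalar_product (cvec y) (L (outer x ((1 / c) *s y)) *v cvec x)) (at 0)"
    by (rule bounded_linear.has_vector_derivative[OF bounded_linear_mult_right mat_fun_line_derivative[OF der]])
  ultimately show ?thesis by (simp only:) blast
qed

text \<open>For a polynomial, a is the second derivative at m and b a sixth of the third. For f they
  are only limits along the reals and need not come from such derivatives.\<close>

definition second_order_data :: "(complex \<Rightarrow> complex) \<Rightarrow> real \<Rightarrow> complex \<Rightarrow> complex \<Rightarrow> bool" where
  "second_order_data f m a b \<longleftrightarrow>
     eventually (\<lambda>t. f field_differentiable at (of_real (m + t))) (nhds 0) \<and>
     ((\<lambda>t. deriv f (of_real (m + t))) has_vector_derivative a) (at 0) \<and>
     ((\<lambda>t. (1 / t) *\<^sub>R ((f (of_real (m + sqrt t)) - f (of_real (m - sqrt t))) / (2 * of_real (sqrt t))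
        - deriv f (of_real m))) \<longlongrightarrow> b) (at_right 0)"

lemma second_order_data_index_2:
  assumes ev: "eventually (\<lambda>M. defined_on_spectrum f (cmat M)) (nhds A)"
    and der: "((\<lambda>M. mat_fun f (cmat M)) has_derivative L) (at A)"
    and idx: "eig_index (cmat A) (complex_of_real m) = 2"
  shows "\<exists>a b. second_order_data f m a b"
proof -
  obtain z where z: "cvec z \<in> geig (cmat A) (of_real m)" "A *v z - m *s z \<noteq> 0"
    using ex_jordan_pair[OF idx] by blast
  have "cvec (A *v z - m *s z) = cmat A *v cvec z + (- of_real m) *s cvec z"
    by (simp add: cvec_diff cvec_smult cmat_cvec)
  then have "cvec (A *v z - m *s z) \<in> geig (cmat A) (of_real m)"
    using z(1) by (simp only:) (intro geig_add geig_smult geig_matrix)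
  then obtain y where y: "cvec y \<in> geig (cmat (transpose A)) (of_real m)" "scalar_product (A *v z - m *s z) y \<noteq> 0"
    using geig_dual_nonzero_real z(2) by blast
  have "scalar_product y (A *v z - m *s z) \<noteq> 0"
    using y(2) scalar_product_commute[of y "A *v z - m *s z"] by simp
  then obtain w where "jordan_pair A m z w" using ex_normalized_jordan_pair[OF idx z(1) y(1)] by blast
  then interpret jordan A m z w by unfold_locales
  have "((\<lambda>t. A + t *\<^sub>R P) \<longlongrightarrow> A + 0 *\<^sub>R P) (nhds 0)"
    by (intro tendsto_intros filterlim_ident)
  then have "filterlim (\<lambda>t. A + t *\<^sub>R P) (nhds A) (nhds 0)" by simp
  with ev have "eventually (\<lambda>t. defined_on_spectrum f (cmat (A + t *\<^sub>R P))) (nhds 0)"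
    by (auto simp: filterlim_iff)
  then have "eventually (\<lambda>t. f field_differentiable at (of_real (m + t))) (nhds 0)"
  proof eventually_elim
    case (elim t)
    have "cvec x \<noteq> 0" using real_relations(5) by auto
    then show ?case using jordan_in_geig[OF line_P] field_differentiable_of_index[OF elim] by metis
  qed
  then show ?thesis
    using second_derivative[OF der] odd_difference_quotient[OF der] unfolding second_order_data_def by blast
qed

text \<open>The mean value inequality applied to h' = o(t) gives h = o(t^2). With t replaced by a
  square root this controls the even part of f - q.\<close>

lemma peano_second_order:
  fixes h h' :: "real \<Rightarrow> complex"
  assumes ev: "eventually (\<lambda>t. (h has_vector_derivative h' t) (at t)) (nhds 0)"
    and d: "(h' has_vector_derivative 0) (at 0)" and "h 0 = 0" "h' 0 = 0"
  shows "((\<lambda>t. (1 / t\<^sup>2) *\<^sub>R h t) \<longlongrightarrow> 0) (at 0)"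
proof (rule tendstoI)
  fix e :: real assume e: "e > 0"
  obtain r1 where r1: "r1 > 0" "\<And>t. dist t 0 < r1 \<Longrightarrow> (h has_vector_derivative h' t) (at t)"
    using ev by (auto simp: eventually_nhds_metric)
  have "(h' has_derivative (\<lambda>t. 0)) (at 0)" using d by (simp add: has_vector_derivative_def)
  then obtain r2 where r2: "r2 > 0" "\<And>t. norm t < r2 \<Longrightarrow> norm (h' t) \<le> e / 2 * norm t"
    unfolding has_derivative_at_alt using e assms(4) by (metis diff_zero half_gt_zero)
  have bd: "norm ((1 / t\<^sup>2) *\<^sub>R h t) < e" if t: "t \<noteq> 0" "norm t < min r1 r2" for t
  proof -
    have seg: "norm s \<le> norm t" if "s \<in> closed_segment 0 t" for s
      using that by (auto simp: closed_segment_eq_real_ivl split: if_splits)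
    have "norm (h t - h 0) \<le> (e / 2 * norm t) * norm (t - 0)"
    proof (rule differentiable_bound[of "closed_segment 0 t" h "\<lambda>s u. u *\<^sub>R h' s"])
      fix s assume s: "s \<in> closed_segment 0 t"
      then have sn: "norm s < r1" "norm s < r2" using seg[OF s] t by auto
      show "(h has_derivative (\<lambda>u. u *\<^sub>R h' s)) (at s within closed_segment 0 t)"
        using r1(2)[of s] sn unfolding has_vector_derivative_def by (auto intro: has_derivative_at_withinI)
      have "norm (h' s) \<le> e / 2 * norm t"
        using r2(2)[OF sn(2)] seg[OF s] e by (meson half_gt_zero less_imp_le mult_left_mono order_trans)
      then have "norm (u *\<^sub>R h' s) \<le> e / 2 * norm t * norm u" for u
        using mult_left_mono[of "norm (h' s)" "e / 2 * norm t" "\<bar>u\<bar>"] by (simp add: mult_ac)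
      then show "onorm (\<lambda>u. u *\<^sub>R h' s) \<le> e / 2 * norm t" by (rule onorm_le)
    qed auto
    then have "norm (h t) \<le> e / 2 * t\<^sup>2" by (simp add: assms(3) power2_eq_square mult.assoc flip: abs_mult)
    moreover have "0 < e * t\<^sup>2" using t e by simp
    ultimately have "norm (h t) < e * t\<^sup>2" by simp
    then show ?thesis using t e by (simp add: field_simps)
  qed
  show "eventually (\<lambda>t. dist ((1 / t\<^sup>2) *\<^sub>R h t) 0 < e) (at 0)"
    unfolding eventually_at using r1(1) r2(1) bd
    by (intro exI[of _ "min r1 r2"]) (auto simp: dist_norm)
qed

lemma pderiv_funpow_shift: "(pderiv ^^ j) (pcompose p [:c, 1:]) = pcompose ((pderiv ^^ j) p) [:c, 1:]"
  for c :: complex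
  by (induct j) (simp_all add: pderiv_pcompose pderiv_pCons)

text \<open>Expanding q around m, the even powers cancel and the cubic coefficient survives; it is
  the third derivative divided by 6.\<close>

lemma poly_odd_difference_quotient:
  "((\<lambda>t. (1 / t) *\<^sub>R ((poly q (of_real (m + sqrt t)) - poly q (of_real (m - sqrt t))) / (2 * of_real (sqrt t))
      - poly (pderiv q) (of_real m))) \<longlongrightarrow> poly ((pderiv ^^ 3) q) (complex_of_real m) / 6) (at_right 0)"
proof -
  let ?c = "complex_of_real m"
  obtain c0 c1 c2 c3 k where p: "pcompose q [:?c, 1:] = pCons c0 (pCons c1 (pCons c2 (pCons c3 k)))"
    by (metis pCons_cases)
  have q: "poly q (?c + s) = c0 + s * (c1 + s * (c2 + s * (c3 + s * poly k s)))" for s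
    using arg_cong[OF p, of "\<lambda>p. poly p s"] by (simp add: poly_pcompose)
  have j: "poly ((pderiv ^^ j) q) ?c = poly ((pderiv ^^ j) (pCons c0 (pCons c1 (pCons c2 (pCons c3 k))))) 0" for j
    using pderiv_funpow_shift[of j q ?c] by (simp add: p poly_pcompose)
  have q1: "poly (pderiv q) ?c = c1" using j[of 1] by (simp add: pderiv_pCons)
  have q3: "poly ((pderiv ^^ 3) q) ?c / 6 = c3"
    unfolding j by (simp add: numeral_3_eq_3 pderiv_pCons pderiv_add)
  have "((\<lambda>t. complex_of_real (sqrt t)) \<longlongrightarrow> of_real (sqrt 0)) (at_right 0)" by (intro tendsto_intros)
  then have s: "((\<lambda>t. complex_of_real (sqrt t)) \<longlongrightarrow> 0) (at_right 0)" by simp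
  have "((\<lambda>t. c3 + of_real (sqrt t) * (poly k (of_real (sqrt t)) - poly k (- of_real (sqrt t))) / 2) \<longlongrightarrow>
      c3 + 0 * (poly k 0 - poly k (- 0)) / 2) (at_right 0)"
    by (intro tendsto_add tendsto_const tendsto_divide tendsto_mult tendsto_diff s
        isCont_tendsto_compose[OF poly_isCont s] isCont_tendsto_compose[OF poly_isCont tendsto_minus[OF s]]) simp
  then have "((\<lambda>t. c3 + of_real (sqrt t) * (poly k (of_real (sqrt t)) - poly k (- of_real (sqrt t))) / 2) \<longlongrightarrow>
      c3) (at_right 0)" by simp
  then show ?thesis unfolding q3 q1
  proof (rule Lim_transform_eventually)
    show "eventually (\<lambda>t. c3 + of_real (sqrt t) * (poly k (of_real (sqrt t)) - poly k (- of_real (sqrt t))) / 2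
      = (1 / t) *\<^sub>R ((poly q (of_real (m + sqrt t)) - poly q (of_real (m - sqrt t))) / (2 * of_real (sqrt t)) - c1)) (at_right 0)"
      unfolding eventually_at_filter
    proof (intro always_eventually allI impI)
      fix t :: real assume "t \<in> {0<..}"
      then have t: "t > 0" by simp
      define s where "s = complex_of_real (sqrt t)"
      have s0: "s \<noteq> 0" using t by (simp add: s_def)
      have ss: "complex_of_real t = s * s" using t by (simp add: s_def flip: of_real_mult)
      have e: "complex_of_real (m + sqrt t) = ?c + s" "complex_of_real (m - sqrt t) = ?c + (- s)" by (simp_all add: s_def)
      show "c3 + of_real (sqrt t) * (poly k (of_real (sqrt t)) - poly k (- of_real (sqrt t))) / 2
        = (1 / t) *\<^sub>R ((poly q (of_real (m + sqrt t)) - poly q (of_real (m - sqrt t))) / (2 * of_real (sqrt t)) - c1)"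
        unfolding e q s_def[symmetric] scaleR_conv_of_real of_real_divide of_real_1 ss
        using s0 by (simp add: field_simps)
    qed
  qed
qed

subsection \<open>The interpolating polynomial\<close>

lemma order_power: "p \<noteq> 0 \<Longrightarrow> order l (p ^ n) = n * order l p" for p :: "complex poly"
  by (induct n) (simp_all add: order_mult)

context interpolation
begin

lemma orthogonal_second_order_data:
  assumes idx: "eig_index (cmat A) (complex_of_real m) = 2"
    and data: "second_order_data f m a b"
    and q2: "poly ((pderiv ^^ 2) q) (of_real m) = a" and q3: "poly ((pderiv ^^ 3) q) (of_real m) = 6 * b"
    and D: "\<And>E. LG E = 0 \<Longrightarrow> E \<bullet> D = 0"
    and comm: "\<And>w. transpose (cmat A) *v (cmat D *v w) = cmat D *v (transpose (cmat A) *v w)"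
    and vw: "v \<in> geig (cmat A) (of_real m)" "w \<in> geig (transpose (cmat A)) (of_real m)"
  shows "scalar_product v (cmat D *v w) = 0"
proof -
  let ?h = "\<lambda>t. f (of_real (m + t)) - poly q (of_real (m + t))"
  let ?h' = "\<lambda>t. deriv f (of_real (m + t)) - poly (pderiv q) (of_real (m + t))"
  have fq: "f (of_real m) = poly q (of_real m)" "deriv f (of_real m) = poly (pderiv q) (of_real m)"
    using agree[of 0 "of_real m"] agree[of 1 "of_real m"] idx by simp_all
  have poly_line: "((\<lambda>t. poly p (complex_of_real (m + t))) has_vector_derivative poly (pderiv p) (of_real (m + s))) (at s)"
    for p s
  proof -
    have "((\<lambda>t. complex_of_real (m + t)) has_vector_derivative 1) (at s)"
      by (auto intro!: derivative_eq_intros simp: has_vector_derivative_def scaleR_conv_of_real)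
    from field_vector_diff_chain_at[OF this poly_DERIV] show ?thesis by (simp add: o_def)
  qed
  have dh: "eventually (\<lambda>t. (?h has_vector_derivative ?h' t) (at t)) (nhds 0)"
  proof -
    have "eventually (\<lambda>t. f field_differentiable at (of_real (m + t))) (nhds 0)"
      using data by (simp add: second_order_data_def)
    then show ?thesis
    proof eventually_elim
      case (elim t)
      have "((\<lambda>t. complex_of_real (m + t)) has_vector_derivative 1) (at t)"
        by (auto intro!: derivative_eq_intros simp: has_vector_derivative_def scaleR_conv_of_real)
      moreover have "(f has_field_derivative deriv f (of_real (m + t))) (at (of_real (m + t)))"
        using elim by (simp only: DERIV_deriv_iff_field_differentiable)
      ultimately have "((\<lambda>t. f (of_real (m + t))) has_vector_derivative deriv f (of_real (m + t))) (at t)"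
        using field_vector_diff_chain_at[of "\<lambda>t. complex_of_real (m + t)" 1 t f] by (simp add: o_def)
      then show ?case by (intro has_vector_derivative_diff poly_line)
    qed
  qed
  have H0: "(?h has_vector_derivative 0) (at 0)"
    using eventually_nhds_x_imp_x[OF dh] fq by simp
  have "(?h' has_vector_derivative a - poly (pderiv (pderiv q)) (of_real (m + 0))) (at 0)"
    by (intro has_vector_derivative_diff poly_line) (use data in \<open>simp add: second_order_data_def\<close>)
  then have H1: "(?h' has_vector_derivative 0) (at 0)" using q2 by (simp add: numeral_2_eq_2)
  have P: "((\<lambda>t. (1 / t\<^sup>2) *\<^sub>R ?h t) \<longlongrightarrow> 0) (at 0)"
    by (rule peano_second_order[OF dh H1]) (use fq in simp_all)
  have lim: "filterlim (\<lambda>t. s * sqrt t) (at 0) (at_right 0)" if "s \<noteq> 0" for s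
  proof -
    have "((\<lambda>t. s * sqrt t) \<longlongrightarrow> s * sqrt 0) (at_right 0)" by (intro tendsto_intros)
    then show ?thesis using that by (auto simp: filterlim_at eventually_at_filter)
  qed
  have sq: "((\<lambda>t. (1 / (s * sqrt t)\<^sup>2) *\<^sub>R ?h (s * sqrt t)) \<longlongrightarrow> 0) (at_right 0)" if "s \<noteq> 0" for s
    by (rule filterlim_compose[OF P lim[OF that]])
  have H2: "((\<lambda>t. (1 / t) *\<^sub>R ((f (of_real (m + sqrt t)) - poly q (of_real (m + sqrt t)))
        + (f (of_real (m - sqrt t)) - poly q (of_real (m - sqrt t))))) \<longlongrightarrow> 0) (at_right 0)"
  proof -
    have "((\<lambda>t. (1 / (1 * sqrt t)\<^sup>2) *\<^sub>R ?h (1 * sqrt t) + (1 / (- 1 * sqrt t)\<^sup>2) *\<^sub>R ?h (- 1 * sqrt t)) \<longlongrightarrow> 0 + 0) (at_right 0)"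
      by (intro tendsto_add sq) simp_all
    then have "((\<lambda>t. (1 / t) *\<^sub>R ((f (of_real (m + sqrt t)) - poly q (of_real (m + sqrt t)))
        + (f (of_real (m - sqrt t)) - poly q (of_real (m - sqrt t))))) \<longlongrightarrow> 0 + 0) (at_right 0)"
      by (rule Lim_transform_eventually)
        (auto simp: eventually_at_filter scaleR_add_right intro!: always_eventually)
    then show ?thesis by simp
  qed
  \<comment> \<open>The Peano estimate is too weak here: with the denominator sqrt t it leaves o(1 /
    sqrt t). The odd part vanishes in the limit because the third derivative of q was matched to
    b.\<close>
  have H3: "((\<lambda>t. (1 / t) *\<^sub>R (((f (of_real (m + sqrt t)) - poly q (of_real (m + sqrt t)))
        - (f (of_real (m - sqrt t)) - poly q (of_real (m - sqrt t)))) / (2 * of_real (sqrt t)))) \<longlongrightarrow> 0) (at_right 0)"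
  proof -
    have "((\<lambda>t. (1 / t) *\<^sub>R ((f (of_real (m + sqrt t)) - f (of_real (m - sqrt t))) / (2 * of_real (sqrt t))
        - deriv f (of_real m))
      - (1 / t) *\<^sub>R ((poly q (of_real (m + sqrt t)) - poly q (of_real (m - sqrt t))) / (2 * of_real (sqrt t))
        - poly (pderiv q) (of_real m))) \<longlongrightarrow> b - poly ((pderiv ^^ 3) q) (complex_of_real m) / 6) (at_right 0)"
      by (intro tendsto_diff poly_odd_difference_quotient) (use data in \<open>simp add: second_order_data_def\<close>)
    also have "b - poly ((pderiv ^^ 3) q) (complex_of_real m) / 6 = 0" using q3 by simp
    finally show ?thesis
      by (rule Lim_transform_eventually)
        (rule always_eventually, simp add: fq(2) scaleR_conv_of_real diff_divide_distrib add_divide_distrib algebra_simps)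
  qed
  show ?thesis by (rule orthogonal_index_2[OF idx H0 H1 H2 H3 D comm vw])
qed

end

theorem frechet_eq_polynomial:
  fixes A :: "real^'n^'n"
  assumes ev: "eventually (\<lambda>M. defined_on_spectrum f (cmat M)) (nhds A)"
    and der: "((\<lambda>M. mat_fun f (cmat M)) has_derivative L) (at A)"
    and nonreal: "\<And>l. l \<in> spectrum (cmat A) \<Longrightarrow> l \<notin> \<real> \<Longrightarrow> f field_differentiable (at l)"
  shows "\<exists>q. \<forall>E. L E = mat_poly_deriv q A E"
proof -
  let ?i = "eig_index (cmat A)"
  have dA: "defined_on_spectrum f (cmat A)" using ev by (rule eventually_nhds_x_imp_x)
  have "\<exists>d. \<forall>m. ?i (complex_of_real m) = 1 \<longrightarrow> ((\<lambda>t. f (of_real (m + t))) has_vector_derivative d m) (at 0)"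
    using real_derivative_index_1[OF der] by metis
  then obtain d where d: "\<And>m. ?i (complex_of_real m) = 1 \<Longrightarrow>
    ((\<lambda>t. f (of_real (m + t))) has_vector_derivative d m) (at 0)" by blast
  have "\<exists>a b. \<forall>m. ?i (complex_of_real m) = 2 \<longrightarrow> second_order_data f m (a m) (b m)"
    using second_order_data_index_2[OF ev der] by metis
  then obtain a b where ab: "\<And>m. ?i (complex_of_real m) = 2 \<Longrightarrow> second_order_data f m (a m) (b m)" by blast
  \<comment> \<open>Derivatives of f, except at the orders where a real eigenvalue of index 1 or 2
    offers only a derivative along the reals or a limit. The factor 6 turns b into a third
    derivative.\<close>
  define c where "c l j =
    (if l \<in> \<real> \<and> ?i l = 1 \<and> j = 1 then d (Re l)
     else if l \<in> \<real> \<and> ?i l = 2 \<and> j = 2 then a (Re l)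
     else if l \<in> \<real> \<and> ?i l = 2 \<and> j = 3 then 6 * b (Re l)
     else (deriv ^^ j) f l)" for l j
  \<comment> \<open>The fourth power prescribes 4 times the index many derivatives: enough for order
    1 at index 1, orders 2 and 3 at index 2, and the doubled index of the holomorphic case.\<close>
  have "min_poly (cmat A) ^ 4 \<noteq> 0" using min_poly_nonzero by simp
  from hermite_interpolation[OF this, where c = c] obtain q where
    q0: "\<And>l j. j < order l (min_poly (cmat A) ^ 4) \<Longrightarrow> poly ((pderiv ^^ j) q) l = c l j" by blast
  have q: "poly ((pderiv ^^ j) q) l = c l j" if "j < 4 * ?i l" for l j
    using q0[of j l] that by (simp add: order_power min_poly_nonzero eig_index_def)
  interpret interpolation A f q L
  proof
    show "poly ((pderiv ^^ j) q) l = (deriv ^^ j) f l" if "j < ?i l" for j l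
      using q[of j l] that by (auto simp: c_def)
  qed (rule der)
  have "LG E = 0" for E
  proof (rule LG_zero)
    fix D l x y
    assume D: "\<And>E. LG E = 0 \<Longrightarrow> E \<bullet> D = 0"
      and comm: "\<And>w. transpose (cmat A) *v (cmat D *v w) = cmat D *v (transpose (cmat A) *v w)"
      and xy: "x \<in> geig (cmat A) l" "y \<in> geig (transpose (cmat A)) l"
    have holo: "scalar_product x (cmat D *v y) = 0"
      if h: "\<exists>r>0. f holomorphic_on ball l r" "\<exists>r>0. f holomorphic_on ball (cnj l) r"
        and cj: "\<And>j. c l j = (deriv ^^ j) f l" "\<And>j. c (cnj l) j = (deriv ^^ j) f (cnj l)"
    proof -
      obtain r s where r: "r > 0" "f holomorphic_on ball l r" and s: "s > 0" "f holomorphic_on ball (cnj l) s"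
        using h by blast
      have 1: "f holomorphic_on ball l (min r s)" "f holomorphic_on ball (cnj l) (min r s)"
        using holomorphic_on_subset[OF r(2)] holomorphic_on_subset[OF s(2)] by (auto simp: subset_ball)
      show ?thesis
        by (rule orthogonal_holomorphic[OF _ 1 _ _ D xy])
          (use r s q[of _ l] q[of _ "cnj l"] cj in \<open>auto simp: eig_index_cnj\<close>)
    qed
    consider "?i l = 0" | m where "l = of_real m" "?i l = 1" | m where "l = of_real m" "?i l = 2"
      | m where "l = of_real m" "3 \<le> ?i l" | "l \<notin> \<real>" "?i l = 1" | "l \<notin> \<real>" "2 \<le> ?i l"
      by (cases "l \<in> \<real>") (auto elim!: Reals_cases, force+)
    then show "scalar_product x (cmat D *v y) = 0"
    proof cases
      case 1
      then show ?thesis using xy(1) by (simp add: geig_eig_index)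
    next
      case (2 m)
      have i: "?i (complex_of_real m) = 1" using 2 by simp
      have "((\<lambda>t. complex_of_real (m + t)) has_vector_derivative 1) (at 0)"
        by (auto intro!: derivative_eq_intros simp: has_vector_derivative_def scaleR_conv_of_real)
      from field_vector_diff_chain_at[OF this poly_DERIV]
      have "((\<lambda>t. poly q (of_real (m + t))) has_vector_derivative poly (pderiv q) (of_real m)) (at 0)"
        by (simp add: o_def)
      from has_vector_derivative_diff[OF d[OF i] this]
      have "((\<lambda>t. f (of_real (m + t)) - poly q (of_real (m + t))) has_vector_derivative 0) (at 0)"
        using q[of 1 l] 2 by (simp add: c_def)
      from orthogonal_semisimple_real[OF i this D] show ?thesis using xy 2 by simp
    next
      case (3 m)
      have i: "?i (complex_of_real m) = 2" using 3 by simp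
      show ?thesis
        by (rule orthogonal_second_order_data[OF i ab[OF i] _ _ D comm])
          (use 3 q[of 2 l] q[of 3 l] xy in \<open>simp_all add: c_def\<close>)
    next
      case (4 m)
      then show ?thesis
        by (intro holo holomorphic_near_index_ge_3[OF dA]) (simp_all add: c_def)
    next
      case 5
      then have nr: "cnj l \<notin> \<real>" "cnj l \<noteq> l" by (auto simp: complex_is_Real_iff complex_eq_iff)
      have sp: "l \<in> spectrum (cmat A)" "cnj l \<in> spectrum (cmat A)"
        using 5 by (simp_all add: eig_index_pos_iff[symmetric] eig_index_cnj)
      have q1: "poly (pderiv q) l = deriv f l" "poly (pderiv q) (cnj l) = deriv f (cnj l)"
        using q[of 1 l] q[of 1 "cnj l"] 5 nr by (simp_all add: c_def eig_index_cnj)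
      show ?thesis
        by (rule orthogonal_semisimple_nonreal[OF 5(2) nr(2) nonreal[OF sp(1) 5(1)] nonreal[OF sp(2) nr(1)] q1 D xy])
    next
      case 6
      then have nr: "cnj l \<notin> \<real>" "cnj l \<noteq> l" by (auto simp: complex_is_Real_iff complex_eq_iff)
      then show ?thesis using 6
        by (intro holo holomorphic_near_nonreal_index_ge_2[OF ev])
          (auto simp: c_def eig_index_cnj)
    qed
  qed
  then show ?thesis by (auto simp: LG_def)
qed

section \<open>Transposition of the derivative and the entrywise identity\<close>

lemma transpose_outer: "transpose (outer u v) = outer v u"
  by (simp add: vec_eq_iff transpose_def outer_def mult.commute)

text \<open>The matrix function commutes with transposition, which is linear, so the chain rule
  conjugates its derivative by transposition.\<close>

lemma mat_fun_frechet_transpose: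
  fixes A :: "real^'n^'n"
  assumes der: "((\<lambda>M. mat_fun f (cmat M)) has_derivative L) (at A)"
  shows "mat_fun_frechet f (transpose A) E = transpose (L (transpose E))"
proof -
  have bl: "bounded_linear (transpose :: real^'n^'n \<Rightarrow> _)" "bounded_linear (transpose :: complex^'n^'n \<Rightarrow> _)"
    unfolding linear_conv_bounded_linear[symmetric]
    by (auto intro!: linearI simp: vec_eq_iff transpose_def)
  have "((\<lambda>M. mat_fun f (cmat M)) has_derivative L) (at (transpose (transpose A)))" using der by simp
  from has_derivative_compose[OF bounded_linear_imp_has_derivative[OF bl(1)] this]
  have "((\<lambda>M. mat_fun f (cmat (transpose M))) has_derivative (\<lambda>E. L (transpose E))) (at (transpose A))" .
  from bounded_linear.has_derivative[OF bl(2) this]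
  have "((\<lambda>M. mat_fun f (cmat M)) has_derivative (\<lambda>E. transpose (L (transpose E)))) (at (transpose A))"
    by (simp add: cmat_transpose mat_fun_transpose)
  from fun_cong[OF frechet_derivative_at[OF this], of E] show ?thesis
    unfolding mat_fun_frechet_def by (rule sym)
qed

theorem theorem2p3:
  fixes A :: "real^'n^'n" and u v :: "real^'n" and f :: "complex \<Rightarrow> complex" and i j :: 'n
  assumes "mat_fun_frechet_differentiable f A"
    and "\<And>\<mu>. \<mu> \<in> spectrum (cmat A) \<Longrightarrow> \<mu> \<notin> \<real> \<Longrightarrow> f field_differentiable (at \<mu>)"
  shows "scalar_product (cvec u) (mat_fun_frechet f A (outer (axis i 1) (axis j 1)) *v cvec v)
         = mat_fun_frechet f (transpose A) (outer u v) $ i $ j"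
proof -
  define L where "L = mat_fun_frechet f A"
  have ev: "eventually (\<lambda>M. defined_on_spectrum f (cmat M)) (nhds A)"
    and der: "((\<lambda>M. mat_fun f (cmat M)) has_derivative L) (at A)"
    using assms(1) by (simp_all add: mat_fun_frechet_differentiable_def L_def mat_fun_frechet_def
        frechet_derivative_works[symmetric])
  obtain q where q: "\<And>E. L E = mat_poly_deriv q A E"
    using frechet_eq_polynomial[OF ev der assms(2)] by blast
  have axis: "cvec (axis k 1) = axis k 1" for k :: 'n
    by (simp add: vec_eq_iff cvec_def axis_def)
  \<comment> \<open>Symmetry of the form for the pair e_i e_j^T and v u^T yields the (j, i) entry of
    L at v u^T; transposing then exchanges both the entry indices and u with v.\<close>
  have "scalar_product (cvec u) (L (outer (axis i 1) (axis j 1)) *v cvec v) = L (outer v u) $ j $ i"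
    unfolding q mat_poly_deriv_symmetric[of u] axis scalar_product_axis
    by (simp add: matrix_vector_mult_def scalar_product_axis(2)[unfolded scalar_product_def])
  also have "\<dots> = mat_fun_frechet f (transpose A) (outer u v) $ i $ j"
    by (simp add: mat_fun_frechet_transpose[OF der] transpose_outer) (simp add: transpose_def)
  finally show ?thesis by (simp add: L_def)
qed

end
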